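(* Let $\underline{\mathcal C}=D+C$ be a plane curve of type $(d_0,d_1;n,\nu)$, put $\mu:=n/\nu$, and suppose that $D$ is defined by $f_0=0$ and $C$ is defined by $f_1:=h^\mu+f_0g=0$, where $f_0,g,h$ are homogeneous polynomials of degrees $d_0$, $d_1-d_0$ and $d_1/\mu$, respectively. Let $k$ be an integer satisfying $kd_0\ge d_1$. Then the curve $B_{D,k}$ defined by $f_0^k+f_1g'=0$ is smooth for a general homogeneous polynomial $g'$ of degree $kd_0-d_1$. Moreover (for such general $g'$), $B_{D,k}+C$ is a plane curve of type $$\begin{cases}(d_1,kd_0;kn,n)&\text{if } d_0\equiv0\pmod n\text{ and }d_0<d_1,\\(d_1,kd_0;kn,\nu)&\text{if }d_0=d_1,\end{cases}$$ where $C$ (of degree $d_1$) plays the role of the first curve and $B_{D,k}$ (of degree $kd_0$) that of the second.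
   Context: All curves are in the complex projective plane $\mathbb P^2$. Let $d_1\ge d_0\geq 1$ and let $n$ be a divisor of $d_1$. A plane curve $\underline{\mathcal C}=D+C$, with $D$ and $C$ distinct smooth curves of degrees $d_0$ and $d_1$ respectively, is *of type $(d_0,d_1;n)$* if the local intersection number satisfies $(D\cdot C)_P=n$ for each $P\in C\cap D$. For such a curve let $\mathfrak o_D:=L|_D$ for a general line $L$ and $\mathfrak d:=\sum_{P\in C\cap D}P$, divisors on $D$. Then $n\mathfrak d=C|_D\sim d_1\mathfrak o_D$, so the class of $\mathfrak d-\frac{d_1}{n}\mathfrak o_D$ in $\mathrm{Pic}^0(D)$ is $n$-torsion. $\underline{\mathcal C}$ is *of type $(d_0,d_1;n,\nu)$* if it is of type $(d_0,d_1;n)$ and the order of $\mathfrak d-\frac{d_1}{n}\mathfrak o_D$ in $\mathrm{Pic}^0(D)$ is exactly $\nu$. "General" means for all $g'$ in some nonempty Zariski open subset of the space of homogeneous polynomials of degree $kd_0-d_1$. *)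

theory Defs
  imports
    "HOL-Analysis.Analysis"
    "HOL-Library.Poly_Mapping"
    "HOL-Library.Extended_Nat"
    "HOL-Computational_Algebra.Fraction_Field"
    "HOL-Algebra.Multiplicative_Group"
begin

section \<open>Polynomials and forms\<close>

text \<open>A monomial is a finitely supported exponent function, and a polynomial is a finitely
  supported family of coefficients; the ring structure is the convolution product on
  \<open>poly_mapping\<close>.\<close>

type_synonym 'v mpoly = "('v \<Rightarrow>\<^sub>0 nat) \<Rightarrow>\<^sub>0 complex"

definition mpoly_eval :: "('v \<Rightarrow> complex) \<Rightarrow> 'v mpoly \<Rightarrow> complex" where
  "mpoly_eval a p =
    (\<Sum>m\<in>Poly_Mapping.keys p. Poly_Mapping.lookup p m *
      (\<Prod>i\<in>Poly_Mapping.keys m. a i ^ Poly_Mapping.lookup m i))"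

definition mpoly_const :: "complex \<Rightarrow> 'v mpoly" where
  "mpoly_const c = Poly_Mapping.single 0 c"

definition mpoly_pderiv :: "'v \<Rightarrow> 'v mpoly \<Rightarrow> 'v mpoly" where
  "mpoly_pderiv i p =
    (\<Sum>m\<in>Poly_Mapping.keys p.
      Poly_Mapping.single (m - Poly_Mapping.single i 1)
        (of_nat (Poly_Mapping.lookup m i) * Poly_Mapping.lookup p m))"

text \<open>The space of homogeneous polynomials of degree \<open>d\<close> in three variables; it contains \<open>0\<close>.\<close>

definition forms :: "nat \<Rightarrow> 3 mpoly set" where
  "forms d = {f. \<forall>m\<in>Poly_Mapping.keys f. (\<Sum>i\<in>UNIV. Poly_Mapping.lookup m i) = d}"

text \<open>Zariski open subsets of the affine space \<open>forms d\<close>. The polynomials in \<open>S\<close> are polynomials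
  in the coefficients of a form, so their variables are indexed by the monomials in three
  variables.\<close>

definition zariski_open_in_forms :: "nat \<Rightarrow> 3 mpoly set \<Rightarrow> bool" where
  "zariski_open_in_forms d U \<longleftrightarrow>
    (\<exists>S :: (3 \<Rightarrow>\<^sub>0 nat) mpoly set.
      U = {g \<in> forms d. \<exists>p\<in>S. mpoly_eval (Poly_Mapping.lookup g) p \<noteq> 0})"

definition for_general_form :: "nat \<Rightarrow> (3 mpoly \<Rightarrow> bool) \<Rightarrow> bool" where
  "for_general_form d Q \<longleftrightarrow>
    (\<exists>U. zariski_open_in_forms d U \<and> U \<noteq> {} \<and> (\<forall>g\<in>U. Q g))"

section \<open>The projective plane and its smooth curves\<close>

typedef proj_plane = "{L :: (complex ^ 3) set. \<exists>v. v \<noteq> 0 \<and> L = range (\<lambda>c. c *s v)}"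
  by (auto intro: exI[of _ "axis 1 1"])

text \<open>Only meaningful for homogeneous \<open>f\<close>, for which it suffices to test one nonzero vector of
  the line \<open>P\<close>.\<close>

definition vanishes_at :: "3 mpoly \<Rightarrow> proj_plane \<Rightarrow> bool" where
  "vanishes_at f P \<longleftrightarrow> (\<forall>v\<in>Rep_proj_plane P. mpoly_eval (($) v) f = 0)"

definition curve_points :: "3 mpoly \<Rightarrow> proj_plane set" where
  "curve_points f = {P. vanishes_at f P}"

text \<open>A plane curve is represented by a defining form. The condition excludes \<open>f = 0\<close>.\<close>

definition smooth_curve :: "nat \<Rightarrow> 3 mpoly \<Rightarrow> bool" where
  "smooth_curve d f \<longleftrightarrow> f \<in> forms d \<and>
    (\<forall>P\<in>curve_points f. \<exists>i. \<not> vanishes_at (mpoly_pderiv i f) P)"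

section \<open>Local intersection numbers\<close>

text \<open>The local ring of the plane at \<open>P\<close>, inside the fraction field of the homogeneous
  coordinate ring, and the stalk at \<open>P\<close> of the ideal sheaf of the curve \<open>f = 0\<close>.\<close>

definition local_ring_at :: "proj_plane \<Rightarrow> 3 mpoly fract set" where
  "local_ring_at P =
    {Fract a b | a b. \<exists>d. a \<in> forms d \<and> b \<in> forms d \<and> \<not> vanishes_at b P}"

definition local_ideal_at :: "proj_plane \<Rightarrow> 3 mpoly \<Rightarrow> 3 mpoly fract set" where
  "local_ideal_at P f =
    {Fract (a * f) b | a b. \<exists>d. a * f \<in> forms d \<and> b \<in> forms d \<and> \<not> vanishes_at b P}"

text \<open>The dimension of the complex vector space \<open>V / W\<close>, as the supremum of the sizes of finite
  subsets of \<open>V\<close> that are linearly independent modulo \<open>W\<close>.\<close>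

definition quotient_dim :: "3 mpoly fract set \<Rightarrow> 3 mpoly fract set \<Rightarrow> enat" where
  "quotient_dim V W =
    (SUP B \<in> {B. finite B \<and> B \<subseteq> V \<and>
        (\<forall>c. (\<Sum>b\<in>B. Fract (mpoly_const (c b)) 1 * b) \<in> W \<longrightarrow> (\<forall>b\<in>B. c b = 0))}.
      enat (card B))"

definition intersection_number :: "proj_plane \<Rightarrow> 3 mpoly \<Rightarrow> 3 mpoly \<Rightarrow> enat" where
  "intersection_number P f g =
    quotient_dim (local_ring_at P)
      {x + y | x y. x \<in> local_ideal_at P f \<and> y \<in> local_ideal_at P g}"

section \<open>Divisors on a smooth plane curve\<close>

text \<open>In this section \<open>f = 0\<close> is a smooth curve of positive degree. It is irreducible, so a form
  vanishes identically on it iff the form is a multiple of \<open>f\<close>.\<close>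

definition divisors :: "3 mpoly \<Rightarrow> (proj_plane \<Rightarrow> int) set" where
  "divisors f = {\<delta>. finite {P. \<delta> P \<noteq> 0} \<and> {P. \<delta> P \<noteq> 0} \<subseteq> curve_points f}"

definition divisor_degree :: "(proj_plane \<Rightarrow> int) \<Rightarrow> int" where
  "divisor_degree \<delta> = (\<Sum>P | \<delta> P \<noteq> 0. \<delta> P)"

text \<open>The divisor cut out by a form \<open>g\<close> that is not a multiple of \<open>f\<close>.\<close>

definition cut_divisor :: "3 mpoly \<Rightarrow> 3 mpoly \<Rightarrow> proj_plane \<Rightarrow> int" where
  "cut_divisor f g = (\<lambda>P. int (the_enat (intersection_number P f g)))"

text \<open>A nonzero rational function on the curve is a quotient \<open>g / h\<close> of forms of the same degree
  that do not vanish identically on it; its divisor is the difference of the divisors cut out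
  by \<open>g\<close> and \<open>h\<close>.\<close>

definition principal_divisors :: "3 mpoly \<Rightarrow> (proj_plane \<Rightarrow> int) set" where
  "principal_divisors f =
    {(\<lambda>P. cut_divisor f g P - cut_divisor f h P) | g h.
      \<exists>d. g \<in> forms d \<and> h \<in> forms d \<and> \<not> f dvd g \<and> \<not> f dvd h}"

definition degree_zero_divisors :: "3 mpoly \<Rightarrow> (proj_plane \<Rightarrow> int) monoid" where
  "degree_zero_divisors f =
    \<lparr>carrier = {\<delta> \<in> divisors f. divisor_degree \<delta> = 0},
     mult = (\<lambda>\<delta> \<epsilon> P. \<delta> P + \<epsilon> P),
     one = (\<lambda>_. 0)\<rparr>"

definition Pic0 :: "3 mpoly \<Rightarrow> (proj_plane \<Rightarrow> int) set monoid" where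
  "Pic0 f = degree_zero_divisors f Mod principal_divisors f"

definition Pic0_class :: "3 mpoly \<Rightarrow> (proj_plane \<Rightarrow> int) \<Rightarrow> (proj_plane \<Rightarrow> int) set" where
  "Pic0_class f \<delta> = principal_divisors f #>\<^bsub>degree_zero_divisors f\<^esub> \<delta>"

section \<open>Plane curves of type \<open>(d\<^sub>0, d\<^sub>1; n)\<close> and \<open>(d\<^sub>0, d\<^sub>1; n, \<nu>)\<close>\<close>

text \<open>The arguments \<open>f\<^sub>0\<close> and \<open>f\<^sub>1\<close> define the two components \<open>D\<close> and \<open>C\<close>, in this order.\<close>

definition curve_of_type ::
    "nat \<Rightarrow> nat \<Rightarrow> nat \<Rightarrow> 3 mpoly \<Rightarrow> 3 mpoly \<Rightarrow> bool" where
  "curve_of_type d\<^sub>0 d\<^sub>1 n f\<^sub>0 f\<^sub>1 \<longleftrightarrow>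
    1 \<le> d\<^sub>0 \<and> d\<^sub>0 \<le> d\<^sub>1 \<and> n dvd d\<^sub>1 \<and>
    smooth_curve d\<^sub>0 f\<^sub>0 \<and> smooth_curve d\<^sub>1 f\<^sub>1 \<and>
    curve_points f\<^sub>0 \<noteq> curve_points f\<^sub>1 \<and>
    (\<forall>P \<in> curve_points f\<^sub>0 \<inter> curve_points f\<^sub>1. intersection_number P f\<^sub>0 f\<^sub>1 = enat n)"

definition contact_divisor :: "3 mpoly \<Rightarrow> 3 mpoly \<Rightarrow> proj_plane \<Rightarrow> int" where
  "contact_divisor f\<^sub>0 f\<^sub>1 =
    (\<lambda>P. if P \<in> curve_points f\<^sub>0 \<inter> curve_points f\<^sub>1 then 1 else 0)"

definition curve_of_torsion_type ::
    "nat \<Rightarrow> nat \<Rightarrow> nat \<Rightarrow> nat \<Rightarrow> 3 mpoly \<Rightarrow> 3 mpoly \<Rightarrow> bool" where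
  "curve_of_torsion_type d\<^sub>0 d\<^sub>1 n \<nu> f\<^sub>0 f\<^sub>1 \<longleftrightarrow>
    curve_of_type d\<^sub>0 d\<^sub>1 n f\<^sub>0 f\<^sub>1 \<and>
    for_general_form 1 (\<lambda>l.
      group.ord (Pic0 f\<^sub>0)
        (Pic0_class f\<^sub>0
          (\<lambda>P. contact_divisor f\<^sub>0 f\<^sub>1 P - int (d\<^sub>1 div n) * cut_divisor f\<^sub>0 l P)) = \<nu>)"

end

theory Submission
  imports Defs
    "HOL-Computational_Algebra.Field_as_Ring"
    "HOL-Computational_Algebra.Fundamental_Theorem_Algebra"
    "HOL-Computational_Algebra.Polynomial_Factorial"
begin

text \<open>Let \<open>S = C \<inter> D\<close>. Restricted to \<open>C\<close>, the form \<open>f\<^sub>0 ^ k + f\<^sub>1 * g'\<close> is \<open>f\<^sub>0 ^ k\<close>, which vanishes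
  to order \<open>k * n\<close> at the points of \<open>S\<close> and nowhere else, so the class to be studied on \<open>C\<close> is that of
  \<open>\<delta> - (d\<^sub>0 / n) o\<^sub>C\<close>, where \<open>\<delta>\<close> is the sum of the points of \<open>S\<close> and \<open>o\<^sub>C\<close> is a line section. It is
  killed by \<open>n\<close>, because \<open>f\<^sub>0\<close> cuts out \<open>n \<delta>\<close>. If it is killed by \<open>j < n\<close>, Max Noether's theorem
  yields a form \<open>G\<close> of degree \<open>j d\<^sub>0 / n < d\<^sub>0\<close> that cuts out \<open>j \<delta>\<close> on \<open>C\<close>. As \<open>C\<close> and \<open>D\<close> have contact of
  order \<open>n > j\<close> at the points of \<open>S\<close>, the form \<open>G\<close> also has order at least \<open>j\<close> there on \<open>D\<close>, and
  Bezout on \<open>D\<close> gives \<open>j d\<^sub>0 d\<^sub>1 / n \<le> j d\<^sub>0 ^ 2 / n\<close>. Hence \<open>d\<^sub>0 = d\<^sub>1\<close>, and then equality shows that \<open>G\<close>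
  cuts out \<open>j \<delta>\<close> on \<open>D\<close> too; by symmetry the orders of the two classes agree. Smoothness is
  an open condition on \<open>g'\<close>, and the forms \<open>g'\<close> that give a singular curve have measure zero.\<close>

section \<open>Substitution into polynomials\<close>

text \<open>A local statement at a point \<open>p\<close> is kept as a polynomial identity
  \<open>b * G = a * f + c * u ^ j\<close> with \<open>b\<close> nonzero at \<open>p\<close>.
  Passing from one curve to the other is then substitution, and fractions appear only where
  intersection numbers are computed. Noether's theorem and the upper half of Bezout's theorem rest
  on one reduction: modulo \<open>f\<close>, some multiple of \<open>g\<close> is a product of
  lines, and on a line everything becomes a univariate polynomial. The lower half of Bezout combines
  a dimension count with Noether's theorem. Openness of smoothness helps only once one smooth member
  is known. If \<open>k * d\<^sub>0 = d\<^sub>1\<close>, then \<open>g'\<close> is a constant, and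
  rescaling turns the member into a small perturbation of \<open>f\<^sub>1\<close>. If
  \<open>k * d\<^sub>0 > d\<^sub>1\<close>, then \<open>k \<ge> 2\<close>, so at a base point the
  gradient is \<open>g'\<close> times that of \<open>f\<^sub>1\<close>; off \<open>C\<close>, the
  nine-parameter family of the forms \<open>a_ij * x_i ^ s * x_j\<close>, summed over
  \<open>i\<close> and \<open>j\<close>, already prescribes value and gradient at any point.\<close>

definition monom_eval :: "('v \<Rightarrow> 'a::comm_ring_1) \<Rightarrow> ('v \<Rightarrow>\<^sub>0 nat) \<Rightarrow> 'a" where
  "monom_eval a m = (\<Prod>i\<in>Poly_Mapping.keys m. a i ^ Poly_Mapping.lookup m i)"

lemma monom_eval_superset:
  "finite A \<Longrightarrow> Poly_Mapping.keys m \<subseteq> A \<Longrightarrow>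
    monom_eval a m = (\<Prod>i\<in>A. a i ^ Poly_Mapping.lookup m i)"
  unfolding monom_eval_def
  by (rule prod.mono_neutral_left) (auto simp: in_keys_iff)

lemma monom_eval_0 [simp]: "monom_eval a 0 = 1"
  by (simp add: monom_eval_def)

lemma monom_eval_add: "monom_eval a (m + m') = monom_eval a m * monom_eval a m'"
proof -
  let ?A = "Poly_Mapping.keys m \<union> Poly_Mapping.keys m'"
  have "monom_eval a (m + m') = (\<Prod>i\<in>?A. a i ^ Poly_Mapping.lookup (m + m') i)"
    by (rule monom_eval_superset) (auto simp: keys_add)
  also have "\<dots> = (\<Prod>i\<in>?A. a i ^ Poly_Mapping.lookup m i) * (\<Prod>i\<in>?A. a i ^ Poly_Mapping.lookup m' i)"
    by (simp add: lookup_add power_add prod.distrib)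
  also have "\<dots> = monom_eval a m * monom_eval a m'"
    by (simp add: monom_eval_superset[of ?A])
  finally show ?thesis .
qed

lemma monom_eval_single [simp]: "monom_eval a (Poly_Mapping.single i k) = a i ^ k"
  by (cases "k = 0") (auto simp: monom_eval_def)

lemma poly_mapping_sum_singles:
  "p = (\<Sum>m\<in>Poly_Mapping.keys p. Poly_Mapping.single m (Poly_Mapping.lookup p m))"
proof (rule poly_mapping_eqI)
  fix m
  show "Poly_Mapping.lookup p m =
      Poly_Mapping.lookup (\<Sum>m\<in>Poly_Mapping.keys p. Poly_Mapping.single m (Poly_Mapping.lookup p m)) m"
    by (auto simp: lookup_sum lookup_single when_def sum.delta in_keys_iff)
qed

lemma poly_mapping_single_induct [case_names zero add]:
  fixes p :: "'a \<Rightarrow>\<^sub>0 'b::comm_monoid_add"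
  assumes "P 0" "\<And>m c p. P p \<Longrightarrow> P (Poly_Mapping.single m c + p)"
  shows "P p"
proof -
  have "P (\<Sum>m\<in>A. Poly_Mapping.single m (Poly_Mapping.lookup p m))" if "finite A" for A
    using that by (induction A) (auto intro: assms)
  from this[OF finite_keys[of p]] show ?thesis
    using poly_mapping_sum_singles[of p] by simp
qed

text \<open>The coefficient map is left abstract so that one development serves evaluation at a
  vector, restriction to a line, substitution of polynomials, and the passage to an iterated
  univariate polynomial ring.\<close>

locale mpoly_subst =
  fixes c :: "complex \<Rightarrow> 'a::comm_ring_1"
  assumes c_add: "c (x + y) = c x + c y" and c_mult: "c (x * y) = c x * c y" and c_1: "c 1 = 1"
begin

definition subst :: "('v \<Rightarrow> 'a) \<Rightarrow> 'v mpoly \<Rightarrow> 'a" where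
  "subst a p = (\<Sum>m\<in>Poly_Mapping.keys p. c (Poly_Mapping.lookup p m) * monom_eval a m)"

lemma c_0 [simp]: "c 0 = 0"
  using c_add[of 0 0] by simp

lemma subst_superset:
  "finite A \<Longrightarrow> Poly_Mapping.keys p \<subseteq> A \<Longrightarrow>
    subst a p = (\<Sum>m\<in>A. c (Poly_Mapping.lookup p m) * monom_eval a m)"
  unfolding subst_def
  by (rule sum.mono_neutral_left) (auto simp: in_keys_iff)

lemma subst_0 [simp]: "subst a 0 = 0"
  by (simp add: subst_def)

lemma subst_add [simp]: "subst a (p + q) = subst a p + subst a q"
proof -
  let ?A = "Poly_Mapping.keys p \<union> Poly_Mapping.keys q"
  have "subst a (p + q) = (\<Sum>m\<in>?A. c (Poly_Mapping.lookup (p + q) m) * monom_eval a m)"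
    by (rule subst_superset) (auto simp: keys_add)
  also have "\<dots> = subst a p + subst a q"
    by (simp add: subst_superset[of ?A] lookup_add c_add algebra_simps sum.distrib)
  finally show ?thesis .
qed

lemma subst_single [simp]: "subst a (Poly_Mapping.single m z) = c z * monom_eval a m"
  by (cases "z = 0") (auto simp: subst_def)

lemma subst_mult [simp]: "subst a (p * q) = subst a p * subst a q"
proof (induction p rule: poly_mapping_single_induct)
  case (add m z p)
  have "subst a (Poly_Mapping.single m z * q) = c z * monom_eval a m * subst a q"
    by (induction q rule: poly_mapping_single_induct)
      (auto simp: algebra_simps mult_single monom_eval_add c_mult)
  with add show ?case by (simp add: algebra_simps)
qed simp

lemma subst_1 [simp]: "subst a 1 = 1"
  by (simp add: c_1 flip: single_one)

lemma subst_uminus [simp]: "subst a (- p) = - subst a p"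
  using subst_add[of a p "- p"] by (simp add: eq_neg_iff_add_eq_0 add.commute)

lemma subst_diff [simp]: "subst a (p - q) = subst a p - subst a q"
  using subst_add[of a p "- q"] by simp

lemma subst_power [simp]: "subst a (p ^ k) = subst a p ^ k"
  by (induction k) auto

lemma subst_sum [simp]: "subst a (sum f A) = (\<Sum>x\<in>A. subst a (f x))"
  by (induction A rule: infinite_finite_induct) auto

lemma subst_prod [simp]: "subst a (prod f A) = (\<Prod>x\<in>A. subst a (f x))"
  by (induction A rule: infinite_finite_induct) auto

lemma subst_const [simp]: "subst a (mpoly_const z) = c z"
  by (simp add: mpoly_const_def)

end

definition mvar :: "'v \<Rightarrow> 'v mpoly" where
  "mvar i = Poly_Mapping.single (Poly_Mapping.single i 1) 1"

lemma (in mpoly_subst) subst_mvar [simp]: "subst a (mvar i) = a i"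
  by (simp add: mvar_def c_1)

lemma mpoly_const_add: "mpoly_const (x + y) = mpoly_const x + mpoly_const y"
  by (simp add: mpoly_const_def single_add)

lemma mpoly_const_mult: "mpoly_const (x * y) = mpoly_const x * mpoly_const y"
  by (simp add: mpoly_const_def mult_single)

lemma mpoly_const_0 [simp]: "mpoly_const 0 = 0"
  by (simp add: mpoly_const_def)

lemma mpoly_const_1 [simp]: "mpoly_const 1 = 1"
  by (simp add: mpoly_const_def)

lemma mpoly_const_eq_iff [simp]: "mpoly_const x = mpoly_const y \<longleftrightarrow> x = y"
  by (metis mpoly_const_def lookup_single_eq)

lemma mpoly_const_eq_0_iff [simp]: "mpoly_const x = 0 \<longleftrightarrow> x = 0"
  using mpoly_const_eq_iff[of x 0] by (simp del: mpoly_const_eq_iff)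

lemma mpoly_const_uminus: "mpoly_const (- x) = - mpoly_const x"
  by (simp add: mpoly_const_def single_uminus)

lemma mpoly_const_diff: "mpoly_const (x - y) = mpoly_const x - mpoly_const y"
  by (simp add: mpoly_const_def single_diff)

lemma mpoly_const_sum: "mpoly_const (sum f A) = (\<Sum>x\<in>A. mpoly_const (f x))"
  by (induction A rule: infinite_finite_induct) (auto simp: mpoly_const_add)

lemma lookup_mpoly_const_mult [simp]:
  "Poly_Mapping.lookup (mpoly_const z * p) m = z * Poly_Mapping.lookup p m"
proof (induction p rule: poly_mapping_single_induct)
  case (add m' w p)
  then show ?case
    by (simp add: algebra_simps lookup_add mpoly_const_def mult_single lookup_single when_def)
qed simp

interpretation ev: mpoly_subst "id :: complex \<Rightarrow> complex"
  by unfold_locales auto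

lemma mpoly_eval_conv_subst: "mpoly_eval = ev.subst"
  by (intro ext) (simp add: ev.subst_def mpoly_eval_def monom_eval_def)

lemma mpoly_eval_simps [simp]:
  "mpoly_eval a 0 = 0" "mpoly_eval a 1 = 1" "mpoly_eval a (mpoly_const z) = z"
  "mpoly_eval a (mvar i) = a i" "mpoly_eval a (p + q) = mpoly_eval a p + mpoly_eval a q"
  "mpoly_eval a (p * q) = mpoly_eval a p * mpoly_eval a q"
  "mpoly_eval a (p - q) = mpoly_eval a p - mpoly_eval a q"
  "mpoly_eval a (- p) = - mpoly_eval a p" "mpoly_eval a (p ^ k) = mpoly_eval a p ^ k"
  "mpoly_eval a (Poly_Mapping.single m z) = z * monom_eval a m"
  by (simp_all add: mpoly_eval_conv_subst)

lemma mpoly_eval_sum [simp]: "mpoly_eval a (sum f A) = (\<Sum>x\<in>A. mpoly_eval a (f x))"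
  and mpoly_eval_prod [simp]: "mpoly_eval a (prod f A) = (\<Prod>x\<in>A. mpoly_eval a (f x))"
  by (simp_all add: mpoly_eval_conv_subst)

interpretation pol: mpoly_subst "\<lambda>z::complex. [:z:]"
  by unfold_locales (auto simp: one_pCons)

interpretation self: mpoly_subst "mpoly_const :: complex \<Rightarrow> 'w mpoly"
  by unfold_locales (auto simp: mpoly_const_add mpoly_const_mult)

lemma mpoly_induct [case_names const add mult_var]:
  fixes p :: "'v mpoly"
  assumes const: "\<And>z. P (mpoly_const z)"
    and add: "\<And>p q. P p \<Longrightarrow> P q \<Longrightarrow> P (p + q)"
    and mult_var: "\<And>p i. P p \<Longrightarrow> P (p * mvar i)"
  shows "P p"
proof -
  have pow: "P (q * mvar i ^ k)" if "P q" for q i k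
    using that by (induction k) (auto simp: power_Suc2 mult.assoc[symmetric] simp del: power_Suc intro: mult_var)
  have "P (Poly_Mapping.single m z)" for m :: "'v \<Rightarrow>\<^sub>0 nat" and z
  proof (induction m rule: poly_mapping_single_induct)
    case zero
    show ?case using const[of z] by (simp add: mpoly_const_def)
  next
    case (add i k m)
    have "mvar i ^ k = Poly_Mapping.single (Poly_Mapping.single i k) 1" for i :: 'v
      by (induction k) (auto simp: mvar_def mult_single single_add[symmetric])
    then have "Poly_Mapping.single (Poly_Mapping.single i k + m) z
        = Poly_Mapping.single m z * mvar i ^ k"
      by (simp add: mult_single add.commute)
    then show ?case using pow[OF add] by simp
  qed
  then show ?thesis
    by (induction p rule: poly_mapping_single_induct) (use const[of 0] in \<open>auto intro: assms\<close>)
qed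

section \<open>Homogeneous components\<close>

definition mdeg :: "(3 \<Rightarrow>\<^sub>0 nat) \<Rightarrow> nat" where
  "mdeg m = (\<Sum>i\<in>UNIV. Poly_Mapping.lookup m i)"

lemma mdeg_0 [simp]: "mdeg 0 = 0"
  by (simp add: mdeg_def)

lemma mdeg_add [simp]: "mdeg (m + m') = mdeg m + mdeg m'"
  by (simp add: mdeg_def lookup_add sum.distrib)

lemma mdeg_single [simp]: "mdeg (Poly_Mapping.single i k) = k"
  by (simp add: mdeg_def lookup_single when_def)

lemma forms_iff: "f \<in> forms d \<longleftrightarrow> (\<forall>m\<in>Poly_Mapping.keys f. mdeg m = d)"
  by (simp add: forms_def mdeg_def)

lemma forms_0 [simp]: "0 \<in> forms d"
  by (simp add: forms_iff)

lemma forms_add: "f \<in> forms d \<Longrightarrow> g \<in> forms d \<Longrightarrow> f + g \<in> forms d"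
  using keys_add[of f g] by (auto simp: forms_iff)

lemma forms_mult: "f \<in> forms d \<Longrightarrow> g \<in> forms e \<Longrightarrow> f * g \<in> forms (d + e)"
  using keys_mult[of f g] by (fastforce simp: forms_iff)

lemma forms_mpoly_const [simp]: "mpoly_const z \<in> forms 0"
  by (auto simp: forms_iff mpoly_const_def split: if_splits)

lemma forms_1 [simp]: "1 \<in> forms 0"
  using forms_mpoly_const[of 1] by (simp del: forms_mpoly_const)

lemma forms_mvar [simp]: "mvar i \<in> forms 1"
  by (auto simp: forms_iff mvar_def)

lemma forms_uminus: "f \<in> forms d \<Longrightarrow> - f \<in> forms d"
  by (auto simp: forms_iff in_keys_iff)

lemma forms_diff: "f \<in> forms d \<Longrightarrow> g \<in> forms d \<Longrightarrow> f - g \<in> forms d"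
  using forms_add[of f d "- g"] forms_uminus by auto

lemma forms_const_mult: "f \<in> forms d \<Longrightarrow> mpoly_const z * f \<in> forms d"
  using forms_mult[of "mpoly_const z" 0 f d] by simp

lemma forms_power: "f \<in> forms d \<Longrightarrow> f ^ k \<in> forms (k * d)"
proof (induction k)
  case (Suc k)
  then show ?case using forms_mult[of f d "f ^ k" "k * d"] by simp
qed simp

lemma forms_sum: "(\<And>x. x \<in> A \<Longrightarrow> f x \<in> forms d) \<Longrightarrow> sum f A \<in> forms d"
  by (induction A rule: infinite_finite_induct) (auto intro: forms_add)

lemma forms_single: "mdeg m = d \<Longrightarrow> Poly_Mapping.single m z \<in> forms d"
  by (auto simp: forms_iff split: if_splits)

lemma forms_degree_unique: "f \<in> forms d \<Longrightarrow> f \<in> forms e \<Longrightarrow> f \<noteq> 0 \<Longrightarrow> d = e"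
  using keys_eq_empty[of f] by (auto simp: forms_iff)

text \<open>The homogeneous component of degree \<open>d\<close>. Applied to both sides of an
  identity with arbitrary cofactors, it replaces the cofactors by forms.\<close>

definition hc :: "nat \<Rightarrow> 3 mpoly \<Rightarrow> 3 mpoly" where
  "hc d p = Poly_Mapping.mapp (\<lambda>m z. z when mdeg m = d) p"

lemma lookup_hc [simp]:
  "Poly_Mapping.lookup (hc d p) m = (Poly_Mapping.lookup p m when mdeg m = d)"
  by (auto simp: hc_def lookup_mapp when_def in_keys_iff)

lemma hc_0 [simp]: "hc d 0 = 0"
  by (rule poly_mapping_eqI) simp

lemma hc_add: "hc d (p + q) = hc d p + hc d q"
  by (rule poly_mapping_eqI) (auto simp: lookup_add when_def)

lemma hc_diff: "hc d (p - q) = hc d p - hc d q"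
  by (rule poly_mapping_eqI) (auto simp: lookup_minus when_def)

lemma hc_sum: "hc d (sum f A) = (\<Sum>x\<in>A. hc d (f x))"
  by (induction A rule: infinite_finite_induct) (auto simp: hc_add)

lemma hc_forms [simp]: "hc d p \<in> forms d"
  by (auto simp: forms_iff in_keys_iff when_def split: if_splits)

lemma hc_form: "p \<in> forms e \<Longrightarrow> hc d p = (if d = e then p else 0)"
  by (rule poly_mapping_eqI) (auto simp: forms_iff in_keys_iff when_def)

lemma hc_single: "hc d (Poly_Mapping.single m z) = (Poly_Mapping.single m z when mdeg m = d)"
  by (rule poly_mapping_eqI) (auto simp: when_def lookup_single)

lemma hc_mult_form:
  assumes "f \<in> forms e"
  shows "hc d (p * f) = (if e \<le> d then hc (d - e) p * f else 0)"
proof (induction p rule: poly_mapping_single_induct)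
  case (add m z p)
  have "Poly_Mapping.single m z * f \<in> forms (mdeg m + e)"
    using assms by (intro forms_mult forms_single) auto
  then have "hc d (Poly_Mapping.single m z * f) =
      (if e \<le> d then hc (d - e) (Poly_Mapping.single m z) * f else 0)"
    by (auto simp: hc_form hc_single when_def)
  with add show ?case by (simp add: hc_add algebra_simps)
qed simp

lemma mpoly_sum_hc: "\<exists>D. p = (\<Sum>d\<le>D. hc d p) \<and> (\<forall>d>D. hc d p = 0)"
proof -
  define D where "D = Max (insert 0 (mdeg ` Poly_Mapping.keys p))"
  have D: "mdeg m \<le> D" if "m \<in> Poly_Mapping.keys p" for m
    unfolding D_def using that by (intro Max_ge) auto
  have "p = (\<Sum>d\<le>D. hc d p)"
  proof (rule poly_mapping_eqI)
    fix m
    show "Poly_Mapping.lookup p m = Poly_Mapping.lookup (\<Sum>d\<le>D. hc d p) m"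
      using D[of m] by (cases "m \<in> Poly_Mapping.keys p")
        (auto simp: lookup_sum when_def in_keys_iff)
  qed
  moreover have "\<forall>d>D. hc d p = 0"
    using D by (auto intro!: poly_mapping_eqI simp: when_def) (force simp: in_keys_iff)
  ultimately show ?thesis by blast
qed

lemma mpoly_eq_0_if_hc: "(\<And>d. hc d p = 0) \<Longrightarrow> p = 0"
  using mpoly_sum_hc[of p] by auto

lemma mpoly_eval_hc_nonzero:
  assumes "mpoly_eval a b \<noteq> 0"
  obtains d where "mpoly_eval a (hc d b) \<noteq> 0"
proof -
  obtain D where "b = (\<Sum>d\<le>D. hc d b)" using mpoly_sum_hc[of b] by auto
  then have "mpoly_eval a b = (\<Sum>d\<le>D. mpoly_eval a (hc d b))"
    by (metis mpoly_eval_sum)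
  with assms show ?thesis using that by (metis sum.neutral)
qed

section \<open>Values and derivatives of forms\<close>

lemma (in mpoly_subst) subst_scale:
  assumes "f \<in> forms d"
  shows "subst (\<lambda>i. s * a i) f = s ^ d * subst a f"
proof -
  have "monom_eval (\<lambda>i. s * a i) m = s ^ mdeg m * monom_eval a m" for m :: "3 \<Rightarrow>\<^sub>0 nat"
    by (simp add: monom_eval_superset[of UNIV] power_mult_distrib prod.distrib mdeg_def power_sum)
  with assms show ?thesis
    by (simp add: subst_def sum_distrib_left forms_iff algebra_simps)
qed

lemma mpoly_eval_zero_vector: "f \<in> forms d \<Longrightarrow> 0 < d \<Longrightarrow> mpoly_eval (\<lambda>_. 0) f = 0"
  using ev.subst_scale[of f d 0 "\<lambda>_. 0"] by (auto simp: mpoly_eval_conv_subst power_0_left)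

lemma forms_0_const: "f \<in> forms 0 \<Longrightarrow> f = mpoly_const (Poly_Mapping.lookup f 0)"
proof (rule poly_mapping_eqI)
  fix m
  assume f: "f \<in> forms 0"
  have "m = 0" if "mdeg m = 0"
    using that by (intro poly_mapping_eqI) (auto simp: mdeg_def)
  then have "Poly_Mapping.lookup f m = 0" if "m \<noteq> 0"
    using f that by (metis forms_iff in_keys_iff)
  then show "Poly_Mapping.lookup f m = Poly_Mapping.lookup (mpoly_const (Poly_Mapping.lookup f 0)) m"
    by (auto simp: mpoly_const_def lookup_single when_def)
qed

lemma mpoly_pderiv_superset:
  "finite A \<Longrightarrow> Poly_Mapping.keys p \<subseteq> A \<Longrightarrow>
    mpoly_pderiv i p = (\<Sum>m\<in>A. Poly_Mapping.single (m - Poly_Mapping.single i 1)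
        (of_nat (Poly_Mapping.lookup m i) * Poly_Mapping.lookup p m))"
  unfolding mpoly_pderiv_def
  by (rule sum.mono_neutral_left) (auto simp: in_keys_iff)

lemma mpoly_pderiv_0 [simp]: "mpoly_pderiv i 0 = 0"
  by (simp add: mpoly_pderiv_def)

lemma mpoly_pderiv_add: "mpoly_pderiv i (p + q) = mpoly_pderiv i p + mpoly_pderiv i q"
proof -
  let ?A = "Poly_Mapping.keys p \<union> Poly_Mapping.keys q"
  show ?thesis
    by (simp add: mpoly_pderiv_superset[of ?A] keys_add lookup_add algebra_simps sum.distrib single_add)
qed

lemma mpoly_pderiv_single:
  "mpoly_pderiv i (Poly_Mapping.single m z) =
    Poly_Mapping.single (m - Poly_Mapping.single i 1) (of_nat (Poly_Mapping.lookup m i) * z)"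
  by (cases "z = 0") (auto simp: mpoly_pderiv_def)

lemma mpoly_pderiv_mult:
  "mpoly_pderiv i (p * q) = mpoly_pderiv i p * q + p * mpoly_pderiv i q"
proof (induction p rule: poly_mapping_single_induct)
  case (add m z p)
  have shift: "Poly_Mapping.single (m - Poly_Mapping.single i 1 + m') (of_nat (Poly_Mapping.lookup m i) * w)
      = Poly_Mapping.single (m + m' - Poly_Mapping.single i 1) (of_nat (Poly_Mapping.lookup m i) * w)"
    for m m' and w :: complex
  proof (cases "Poly_Mapping.lookup m i = 0")
    case False
    then have "m - Poly_Mapping.single i 1 + m' = m + m' - Poly_Mapping.single i 1"
      by (intro poly_mapping_eqI) (auto simp: lookup_add lookup_minus lookup_single when_def)
    then show ?thesis by simp
  qed simp
  have "mpoly_pderiv i (Poly_Mapping.single m z * q) =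
      mpoly_pderiv i (Poly_Mapping.single m z) * q + Poly_Mapping.single m z * mpoly_pderiv i q"
  proof (induction q rule: poly_mapping_single_induct)
    case (add m' w q)
    have "mpoly_pderiv i (Poly_Mapping.single m z * Poly_Mapping.single m' w) =
      mpoly_pderiv i (Poly_Mapping.single m z) * Poly_Mapping.single m' w +
      Poly_Mapping.single m z * mpoly_pderiv i (Poly_Mapping.single m' w)"
      using shift[of m m' "z * w"] shift[of m' m "w * z"]
      by (simp add: mult_single mpoly_pderiv_single lookup_add algebra_simps single_add)
    with add show ?case by (simp add: mpoly_pderiv_add algebra_simps)
  qed simp
  with add show ?case by (simp add: mpoly_pderiv_add algebra_simps)
qed simp

lemma mpoly_pderiv_const [simp]: "mpoly_pderiv i (mpoly_const z) = 0"
  by (simp add: mpoly_const_def mpoly_pderiv_single)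

lemma mpoly_pderiv_mvar: "mpoly_pderiv i (mvar j) = (if i = j then 1 else 0)"
  by (simp add: mvar_def mpoly_pderiv_single lookup_single)

lemma mpoly_pderiv_uminus: "mpoly_pderiv i (- p) = - mpoly_pderiv i p"
  using mpoly_pderiv_add[of i p "- p"] by (simp add: eq_neg_iff_add_eq_0 add.commute)

lemma mpoly_pderiv_diff: "mpoly_pderiv i (p - q) = mpoly_pderiv i p - mpoly_pderiv i q"
  using mpoly_pderiv_add[of i p "- q"] by (simp add: mpoly_pderiv_uminus)

lemma mpoly_pderiv_sum: "mpoly_pderiv i (sum f A) = (\<Sum>x\<in>A. mpoly_pderiv i (f x))"
  by (induction A rule: infinite_finite_induct) (auto simp: mpoly_pderiv_add)

lemma mpoly_pderiv_power:
  "mpoly_pderiv i (p ^ k) = of_nat k * p ^ (k - 1) * mpoly_pderiv i p"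
proof (induction k)
  case (Suc k)
  then show ?case
    by (cases k) (simp_all add: mpoly_pderiv_mult algebra_simps)
qed (use mpoly_pderiv_const[of i 1] in simp)

lemma forms_mpoly_pderiv:
  assumes "f \<in> forms d"
  shows "mpoly_pderiv i f \<in> forms (d - 1)"
  unfolding mpoly_pderiv_def
proof (rule forms_sum)
  fix m
  assume m: "m \<in> Poly_Mapping.keys f"
  show "Poly_Mapping.single (m - Poly_Mapping.single i 1)
      (of_nat (Poly_Mapping.lookup m i) * Poly_Mapping.lookup f m) \<in> forms (d - 1)"
  proof (cases "Poly_Mapping.lookup m i = 0")
    case False
    then have "m - Poly_Mapping.single i 1 + Poly_Mapping.single i 1 = m"
      by (intro poly_mapping_eqI) (auto simp: lookup_add lookup_minus lookup_single when_def)
    from arg_cong[OF this, of mdeg] assms m show ?thesis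
      by (intro forms_single) (auto simp: forms_iff)
  qed simp
qed

section \<open>Linear systems with more unknowns than equations\<close>

text \<open>Gaussian elimination, one equation at a time: either the equation is void, or it has a
  pivot \<open>b0\<close>, and solving for that unknown removes one equation and one
  unknown.\<close>

lemma homogeneous_system_nontrivial:
  fixes M :: "'b \<Rightarrow> 'k \<Rightarrow> complex"
  assumes "finite K" "finite B" "card K < card B"
  shows "\<exists>c. (\<exists>b\<in>B. c b \<noteq> 0) \<and> (\<forall>k\<in>K. (\<Sum>b\<in>B. c b * M b k) = 0)"
  using assms
proof (induction K arbitrary: B M rule: finite_induct)
  case empty
  then show ?case by (intro exI[of _ "\<lambda>_. 1"]) (auto simp: card_gt_0_iff)
next
  case (insert k K)
  show ?case
  proof (cases "\<forall>b\<in>B. M b k = 0")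
    case True
    then show ?thesis using insert.IH[of B M] insert.prems insert.hyps by auto
  next
    case False
    then obtain b0 where b0: "b0 \<in> B" "M b0 k \<noteq> 0" by blast
    define M' where "M' = (\<lambda>b k'. M b k' - M b k / M b0 k * M b0 k')"
    obtain c where c: "\<exists>b\<in>B - {b0}. c b \<noteq> 0" "\<forall>k\<in>K. (\<Sum>b\<in>B - {b0}. c b * M' b k) = 0"
    proof -
      have "finite (B - {b0})" "card K < card (B - {b0})"
        using insert.prems insert.hyps b0 by auto
      from insert.IH[OF this, of M'] show ?thesis using that by blast
    qed
    define s where "s = (\<Sum>b\<in>B - {b0}. c b * M b k)"
    define c' where "c' = c(b0 := - s / M b0 k)"
    have split: "(\<Sum>b\<in>B. c' b * M b k') = (\<Sum>b\<in>B - {b0}. c b * M b k') - s / M b0 k * M b0 k'" for k'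
    proof -
      have "(\<Sum>b\<in>B. c' b * M b k') = c' b0 * M b0 k' + (\<Sum>b\<in>B - {b0}. c' b * M b k')"
        using b0 insert.prems by (intro sum.remove) auto
      also have "(\<Sum>b\<in>B - {b0}. c' b * M b k') = (\<Sum>b\<in>B - {b0}. c b * M b k')"
        by (intro sum.cong) (auto simp: c'_def)
      finally show ?thesis by (simp add: c'_def)
    qed
    have "(\<Sum>b\<in>B. c' b * M b k') = 0" if "k' \<in> K" for k'
    proof -
      have "(\<Sum>b\<in>B - {b0}. c b * M' b k') = (\<Sum>b\<in>B - {b0}. c b * M b k') - s / M b0 k * M b0 k'"
        by (simp add: M'_def s_def algebra_simps sum_subtractf sum_distrib_left sum_distrib_right sum_divide_distrib)
      with c(2) that show ?thesis by (simp add: split)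
    qed
    moreover have "(\<Sum>b\<in>B. c' b * M b k) = 0"
      using b0 by (simp add: split s_def)
    moreover have "\<exists>b\<in>B. c' b \<noteq> 0"
      using c(1) by (auto simp: c'_def)
    ultimately show ?thesis by (intro exI[of _ c']) auto
  qed
qed

section \<open>The projective Nullstellensatz\<close>

definition is_ideal :: "'a::comm_ring_1 set \<Rightarrow> bool" where
  "is_ideal I \<longleftrightarrow> 0 \<in> I \<and> (\<forall>x\<in>I. \<forall>y\<in>I. x + y \<in> I) \<and> (\<forall>x\<in>I. \<forall>r. r * x \<in> I)"

lemma is_ideal_add: "is_ideal I \<Longrightarrow> x \<in> I \<Longrightarrow> y \<in> I \<Longrightarrow> x + y \<in> I"
  and is_ideal_mult: "is_ideal I \<Longrightarrow> x \<in> I \<Longrightarrow> r * x \<in> I"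
  and is_ideal_mult_right: "is_ideal I \<Longrightarrow> x \<in> I \<Longrightarrow> x * r \<in> I"
  and is_ideal_0: "is_ideal I \<Longrightarrow> 0 \<in> I"
  by (auto simp: is_ideal_def mult.commute)

lemma is_ideal_diff: "is_ideal I \<Longrightarrow> x \<in> I \<Longrightarrow> y \<in> I \<Longrightarrow> x - y \<in> I"
  using is_ideal_add[of I x "- y"] is_ideal_mult[of I y "- 1"] by auto

lemma is_ideal_sum: "is_ideal I \<Longrightarrow> (\<And>x. x \<in> A \<Longrightarrow> f x \<in> I) \<Longrightarrow> sum f A \<in> I"
  by (induction A rule: infinite_finite_induct) (auto intro: is_ideal_add is_ideal_0)

lemma is_ideal_adjoin:
  assumes "is_ideal I"
  shows "is_ideal {y + r * x | y r. y \<in> I}"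
  unfolding is_ideal_def
proof (intro conjI ballI allI)
  show "0 \<in> {y + r * x | y r. y \<in> I}"
    using is_ideal_0[OF assms] by (auto intro!: exI[of _ 0])
next
  fix a b
  assume "a \<in> {y + r * x | y r. y \<in> I}" "b \<in> {y + r * x | y r. y \<in> I}"
  then obtain y r y' r' where "a = y + r * x" "b = y' + r' * x" "y \<in> I" "y' \<in> I" by blast
  then have "a + b = (y + y') + (r + r') * x" "y + y' \<in> I"
    using assms by (auto simp: algebra_simps is_ideal_add)
  then show "a + b \<in> {y + r * x | y r. y \<in> I}" by blast
next
  fix a s
  assume "a \<in> {y + r * x | y r. y \<in> I}"
  then obtain y r where "a = y + r * x" "y \<in> I" by blast
  then have "s * a = s * y + (s * r) * x" "s * y \<in> I"
    using assms by (auto simp: algebra_simps is_ideal_mult)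
  then show "s * a \<in> {y + r * x | y r. y \<in> I}" by blast
qed

lemma adjoin_mem:
  assumes "is_ideal I"
  shows "x \<in> {y + r * x | y r. y \<in> I}"
proof -
  have "x = 0 + 1 * x" by simp
  then show ?thesis using is_ideal_0[OF assms] by blast
qed

lemma adjoin_subset: "I \<subseteq> {y + r * x | y r. y \<in> I}" for I :: "'a::comm_ring_1 set"
proof
  fix y assume "y \<in> I"
  moreover have "y = y + 0 * x" by simp
  ultimately show "y \<in> {y + r * x | y r. y \<in> I}" by blast
qed

text \<open>Zorn's lemma. The last clause says that the quotient by \<open>M\<close> is a field:
  adjoining \<open>x\<close> to \<open>M\<close> must yield \<open>1\<close>.\<close>

lemma maximal_ideal_exists:
  fixes I :: "'a::comm_ring_1 set"
  assumes "is_ideal I" "1 \<notin> I"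
  obtains M where "is_ideal M" "1 \<notin> M" "I \<subseteq> M" "\<And>x. x \<notin> M \<Longrightarrow> \<exists>q. x * q - 1 \<in> M"
proof -
  define S where "S = {J. is_ideal J \<and> 1 \<notin> J \<and> I \<subseteq> J}"
  have "\<exists>M\<in>S. \<forall>X\<in>S. M \<subseteq> X \<longrightarrow> X = M"
  proof (rule subset_Zorn_nonempty)
    show "S \<noteq> {}" using assms by (auto simp: S_def)
  next
    fix C
    assume C: "C \<noteq> {}" "subset.chain S C"
    then have chain: "\<And>X Y. X \<in> C \<Longrightarrow> Y \<in> C \<Longrightarrow> X \<subseteq> Y \<or> Y \<subseteq> X" and sub: "C \<subseteq> S"
      by (auto simp: subset.chain_def)
    have "is_ideal (\<Union>C)"
      unfolding is_ideal_def
    proof (intro conjI ballI allI)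
      show "0 \<in> \<Union>C" using C(1) sub by (auto simp: S_def is_ideal_def)
    next
      fix x y assume "x \<in> \<Union>C" "y \<in> \<Union>C"
      then obtain X Y where XY: "X \<in> C" "Y \<in> C" "x \<in> X" "y \<in> Y" by blast
      then obtain Z where Z: "Z \<in> C" "x \<in> Z" "y \<in> Z" using chain[of X Y] by blast
      with sub have "x + y \<in> Z" by (auto simp: S_def is_ideal_def)
      with Z(1) show "x + y \<in> \<Union>C" by blast
    next
      fix x r assume "x \<in> \<Union>C"
      then obtain X where X: "X \<in> C" "x \<in> X" by blast
      with sub have "r * x \<in> X" by (auto simp: S_def is_ideal_def)
      with X(1) show "r * x \<in> \<Union>C" by blast
    qed
    then show "\<Union>C \<in> S" using C(1) sub by (auto simp: S_def)
  qed
  then obtain M where M: "M \<in> S" "\<And>X. X \<in> S \<Longrightarrow> M \<subseteq> X \<Longrightarrow> X = M" by blast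
  show thesis
  proof (rule that[of M])
    show idM: "is_ideal M" and M1: "1 \<notin> M" and "I \<subseteq> M" using M(1) by (auto simp: S_def)
    fix x assume x: "x \<notin> M"
    let ?J = "{y + r * x | y r. y \<in> M}"
    have "x \<in> ?J" by (rule adjoin_mem[OF idM])
    moreover have "M \<subseteq> ?J" by (rule adjoin_subset)
    moreover have "is_ideal ?J" by (rule is_ideal_adjoin[OF idM])
    moreover have "I \<subseteq> ?J" using \<open>I \<subseteq> M\<close> \<open>M \<subseteq> ?J\<close> by (rule order_trans)
    ultimately have "1 \<in> ?J" using M(2)[of ?J] x unfolding S_def by blast
    then obtain y r where "1 = y + r * x" "y \<in> M" by blast
    then have "x * r - 1 = (- 1) * y" by (simp add: algebra_simps)
    then show "\<exists>q. x * q - 1 \<in> M" using is_ideal_mult[OF idM \<open>y \<in> M\<close>] by metis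
  qed
qed

definition mdegs :: "nat \<Rightarrow> (3 \<Rightarrow>\<^sub>0 nat) set" where
  "mdegs t = {m. mdeg m = t}"

definition mono3 :: "nat \<Rightarrow> nat \<Rightarrow> nat \<Rightarrow> 3 \<Rightarrow>\<^sub>0 nat" where
  "mono3 a b c = Poly_Mapping.single 1 a + Poly_Mapping.single 2 b + Poly_Mapping.single 3 c"

lemma lookup_mono3 [simp]:
  "Poly_Mapping.lookup (mono3 a b c) 1 = a" "Poly_Mapping.lookup (mono3 a b c) 2 = b"
  "Poly_Mapping.lookup (mono3 a b c) 3 = c"
  by (simp_all add: mono3_def lookup_add lookup_single)

lemma mono3_cases: "\<exists>a b c. m = mono3 a b c"
proof -
  have "m = mono3 (Poly_Mapping.lookup m 1) (Poly_Mapping.lookup m 2) (Poly_Mapping.lookup m 3)"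
  proof (rule poly_mapping_eqI)
    fix k :: 3
    show "Poly_Mapping.lookup m k = Poly_Mapping.lookup
      (mono3 (Poly_Mapping.lookup m 1) (Poly_Mapping.lookup m 2) (Poly_Mapping.lookup m 3)) k"
      using exhaust_3[of k] by auto
  qed
  then show ?thesis by blast
qed

lemma mono3_eq_iff [simp]: "mono3 a b c = mono3 a' b' c' \<longleftrightarrow> a = a' \<and> b = b' \<and> c = c'"
  by (metis lookup_mono3)

lemma mdeg_mono3 [simp]: "mdeg (mono3 a b c) = a + b + c"
  by (simp add: mono3_def)

lemma mdegs_conv: "mdegs t = (\<lambda>(a, b). mono3 a b (t - a - b)) ` (SIGMA a:{..t}. {..t - a})"
proof
  show "mdegs t \<subseteq> (\<lambda>(a, b). mono3 a b (t - a - b)) ` (SIGMA a:{..t}. {..t - a})"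
  proof
    fix m assume "m \<in> mdegs t"
    then obtain a b c where m: "m = mono3 a b c" "a + b + c = t"
      using mono3_cases[of m] by (auto simp: mdegs_def)
    then have "m = (\<lambda>(a, b). mono3 a b (t - a - b)) (a, b)" "(a, b) \<in> (SIGMA a:{..t}. {..t - a})"
      by auto
    then show "m \<in> (\<lambda>(a, b). mono3 a b (t - a - b)) ` (SIGMA a:{..t}. {..t - a})" by blast
  qed
qed (auto simp: mdegs_def)

lemma finite_mdegs [simp]: "finite (mdegs t)"
  by (simp add: mdegs_conv)

lemma card_mdegs: "2 * card (mdegs t) = (t + 1) * (t + 2)"
proof -
  have "card (mdegs t) = card (SIGMA a:{..t}. {..t - a})"
    unfolding mdegs_conv by (rule card_image) (auto simp: inj_on_def)
  also have "\<dots> = (\<Sum>a\<le>t. Suc (t - a))" by simp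
  also have "\<dots> = (\<Sum>a\<le>t. Suc a)"
    by (rule sum.reindex_bij_witness[of _ "\<lambda>a. t - a" "\<lambda>a. t - a"]) auto
  finally have "card (mdegs t) = (\<Sum>a\<le>t. Suc a)" .
  moreover have "2 * (\<Sum>a\<le>t. Suc a) = (t + 1) * (t + 2)" by (induction t) auto
  ultimately show ?thesis by simp
qed

lemma prime_elem_of_maximal:
  assumes "is_ideal M" "\<And>x. x \<notin> M \<Longrightarrow> \<exists>q. x * q - 1 \<in> M" "x * y \<in> M"
  shows "x \<in> M \<or> y \<in> M"
proof (rule ccontr)
  assume "\<not> (x \<in> M \<or> y \<in> M)"
  then obtain q where "x * q - 1 \<in> M" and y: "y \<notin> M" using assms(2) by blast
  then have "x * y * q - y * (x * q - 1) \<in> M"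
    using is_ideal_diff[OF assms(1) is_ideal_mult_right[OF assms(1,3)] is_ideal_mult[OF assms(1)]] by blast
  then show False using y by (simp add: algebra_simps)
qed

text \<open>If no \<open>mvar i - c\<close> lay in \<open>M\<close>, all of them would have inverses
  modulo \<open>M\<close>. These are uncountably many elements of a space of countable dimension, so
  some of them are linearly dependent, which makes \<open>mvar i\<close> algebraic over the complex
  numbers modulo \<open>M\<close>.\<close>

lemma root_mod_maximal:
  fixes M :: "3 mpoly set"
  assumes M: "is_ideal M" "1 \<notin> M" "\<And>x. x \<notin> M \<Longrightarrow> \<exists>q. x * q - 1 \<in> M"
  shows "\<exists>c. mvar i - mpoly_const c \<in> M"
proof (rule ccontr)
  assume "\<not> ?thesis"
  then have "\<forall>c. \<exists>q. (mvar i - mpoly_const c) * q - 1 \<in> M" using M(3) by blast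
  then obtain q where q: "\<And>c. (mvar i - mpoly_const c) * q c - 1 \<in> M" by metis
  \<comment> \<open>A degree bound for the chosen inverse \<open>q c\<close>.\<close>
  define bound where "bound = (\<lambda>c. SOME D. \<forall>d>D. hc d (q c) = 0)"
  have bound: "hc d (q c) = 0" if "d > bound c" for c d
    using someI_ex[of "\<lambda>D. \<forall>d>D. hc d (q c) = 0"] mpoly_sum_hc[of "q c"] that
    unfolding bound_def by blast
  have "\<not> countable (UNIV :: complex set)"
    using uncountable_UNIV_complex by simp
  \<comment> \<open>Uncountably many \<open>c\<close> share countably many bounds, so infinitely
    many inverses lie in one finite-dimensional space of polynomials of degree at most
    \<open>D\<close>.\<close>
  then have "\<exists>D. \<not> finite (bound -` {D})"
  proof (rule contrapos_np)
    assume "\<nexists>D. infinite (bound -` {D})"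
    then have "countable (\<Union>D. bound -` {D})"
      by (intro countable_UN) (auto intro: countable_finite)
    moreover have "(\<Union>D. bound -` {D}) = UNIV" by auto
    ultimately show "countable (UNIV :: complex set)" by simp
  qed
  then obtain D where D: "infinite (bound -` {D})" by blast
  define K where "K = (\<Union>d\<le>D. mdegs d)"
  obtain B where B: "B \<subseteq> bound -` {D}" "finite B" "card B = Suc (card K)"
    using infinite_arbitrarily_large[OF D] by metis
  obtain a where a: "\<exists>c\<in>B. a c \<noteq> 0" "\<forall>k\<in>K. (\<Sum>c\<in>B. a c * Poly_Mapping.lookup (q c) k) = 0"
    using homogeneous_system_nontrivial[of K B "\<lambda>c. Poly_Mapping.lookup (q c)"] B
    by (auto simp: K_def)
  have "(\<Sum>c\<in>B. mpoly_const (a c) * q c) = 0"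
  proof (rule poly_mapping_eqI)
    fix k
    show "Poly_Mapping.lookup (\<Sum>c\<in>B. mpoly_const (a c) * q c) k = Poly_Mapping.lookup 0 k"
    proof (cases "k \<in> K")
      case False
      have "Poly_Mapping.lookup (q c) k = 0" if "c \<in> B" for c
      proof -
        have "hc (mdeg k) (q c) = 0"
          using False B(1) that by (intro bound) (auto simp: K_def mdegs_def)
        then show ?thesis using lookup_hc[of "mdeg k" "q c" k] by simp
      qed
      then show ?thesis by (simp add: lookup_sum)
    qed (use a in \<open>simp add: lookup_sum\<close>)
  qed
  \<comment> \<open>clearing the denominators \<open>x - c\<close> of the relation puts a nonzero univariate polynomial
    into \<open>M\<close>, which then contains one of its linear factors\<close>
  define \<eta> :: "complex poly \<Rightarrow> 3 mpoly" where "\<eta> = (\<lambda>p. poly (map_poly mpoly_const p) (mvar i))"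
  have \<eta>_pCons: "\<eta> (pCons z p) = mpoly_const z + mvar i * \<eta> p" for z p
    by (simp add: \<eta>_def map_poly_pCons)
  have \<eta>_0: "\<eta> 0 = 0" by (simp add: \<eta>_def)
  have \<eta>_smult: "\<eta> (Polynomial.smult z p) = mpoly_const z * \<eta> p" for z p
    by (induction p) (simp_all add: \<eta>_pCons \<eta>_0 mpoly_const_mult algebra_simps)
  have \<eta>_add: "\<eta> (p + p') = \<eta> p + \<eta> p'" for p p'
    by (induction p p' rule: poly_induct2) (simp_all add: \<eta>_pCons \<eta>_0 mpoly_const_add algebra_simps)
  have \<eta>_mult: "\<eta> (p * p') = \<eta> p * \<eta> p'" for p p'
    by (induction p) (simp_all add: \<eta>_pCons \<eta>_0 \<eta>_add \<eta>_smult mult_pCons_left algebra_simps)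
  have \<eta>_sum: "\<eta> (sum g A) = (\<Sum>x\<in>A. \<eta> (g x))" for g :: "complex \<Rightarrow> complex poly" and A
    by (induction A rule: infinite_finite_induct) (auto simp: \<eta>_0 \<eta>_add)
  define Q where "Q = (\<Sum>c\<in>B. Polynomial.smult (a c) (\<Prod>c'\<in>B - {c}. [:- c', 1:]))"
  \<comment> \<open>At a \<open>c0\<close> with nonzero coefficient, every summand except its own
    contains the vanishing factor.\<close>
  have "Q \<noteq> 0"
  proof -
    obtain c0 where c0: "c0 \<in> B" "a c0 \<noteq> 0" using a(1) by blast
    have "poly Q c0 = (\<Sum>c\<in>B. a c * (\<Prod>c'\<in>B - {c}. c0 - c'))"
      by (simp add: Q_def poly_sum poly_prod)
    also have "\<dots> = (\<Sum>c\<in>{c0}. a c * (\<Prod>c'\<in>B - {c}. c0 - c'))"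
      using B(2) c0(1) by (intro sum.mono_neutral_right) (auto simp: prod_zero_iff)
    also have "\<dots> \<noteq> 0" using c0 B(2) by (auto simp: prod_zero_iff)
    finally show ?thesis by auto
  qed
  have "\<eta> Q \<in> M"
  proof -
    define L where "L = (\<lambda>c. mvar i - mpoly_const c :: 3 mpoly)"
    have \<eta>_prod: "\<eta> (\<Prod>c'\<in>A. [:- c', 1:]) = (\<Prod>c'\<in>A. L c')" for A
    proof (induction A rule: infinite_finite_induct)
      case (insert x F)
      then show ?case
        by (simp add: \<eta>_mult \<eta>_pCons \<eta>_0 mpoly_const_uminus L_def del: mult_pCons_left)
    qed (simp_all add: \<eta>_pCons \<eta>_0 one_pCons)
    have "\<eta> Q = (\<Sum>c\<in>B. mpoly_const (a c) * (\<Prod>c'\<in>B - {c}. L c'))"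
      by (simp only: Q_def \<eta>_sum \<eta>_smult \<eta>_prod)
    also have "\<dots> = (\<Prod>c'\<in>B. L c') * (\<Sum>c\<in>B. mpoly_const (a c) * q c)
        - (\<Sum>c\<in>B. mpoly_const (a c) * (\<Prod>c'\<in>B - {c}. L c') * (L c * q c - 1))"
    proof -
      have "(\<Prod>c'\<in>B. L c') * (mpoly_const (a c) * q c)
          - mpoly_const (a c) * (\<Prod>c'\<in>B - {c}. L c') * (L c * q c - 1)
        = mpoly_const (a c) * (\<Prod>c'\<in>B - {c}. L c')" if "c \<in> B" for c
        using B(2) that by (simp add: prod.remove[of B c] algebra_simps)
      then show ?thesis by (simp add: sum_distrib_left flip: sum_subtractf)
    qed
    also have "\<dots> = - 1 * (\<Sum>c\<in>B. mpoly_const (a c) * (\<Prod>c'\<in>B - {c}. L c') * (L c * q c - 1))"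
      using \<open>(\<Sum>c\<in>B. mpoly_const (a c) * q c) = 0\<close> by simp
    also have "\<dots> \<in> M"
      using q M(1) by (intro is_ideal_mult is_ideal_sum) (auto simp: L_def)
    finally show ?thesis .
  qed
  with \<open>Q \<noteq> 0\<close> have "\<exists>c. \<eta> [:- c, 1:] \<in> M"
  proof (induction "degree Q" arbitrary: Q)
    case 0
    then obtain z where z: "Q = [:z:]" "z \<noteq> 0" by (metis degree_eq_zeroE pCons_eq_0_iff)
    then have "mpoly_const (1 / z) * mpoly_const z \<in> M"
      using 0 M(1) by (auto simp: \<eta>_pCons \<eta>_0 intro: is_ideal_mult)
    then show ?case using z M(2) by (simp flip: mpoly_const_mult)
  next
    case (Suc n)
    then obtain r where "poly Q r = 0"
      using fundamental_theorem_of_algebra constant_degree[of Q] by (metis nat.simps(3))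
    then obtain Q' where Q': "Q = [:- r, 1:] * Q'" by (auto simp: poly_eq_0_iff_dvd)
    with Suc have "Q' \<noteq> 0" "degree Q = Suc (degree Q')"
      by (auto simp: degree_mult_eq simp del: mult_pCons_left)
    moreover have "\<eta> [:- r, 1:] \<in> M \<or> \<eta> Q' \<in> M"
      using prime_elem_of_maximal[OF M(1) M(3)] Suc.prems by (simp add: Q' \<eta>_mult del: mult_pCons_left)
    ultimately show ?case using Suc by auto
  qed
  then obtain c where "mvar i - mpoly_const c \<in> M"
    by (auto simp: \<eta>_pCons \<eta>_0 mpoly_const_uminus)
  then have "(mvar i - mpoly_const c) * q c - ((mvar i - mpoly_const c) * q c - 1) \<in> M"
    by (rule is_ideal_diff[OF M(1) is_ideal_mult_right[OF M(1)] q])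
  with M(2) show False by simp
qed

text \<open>Modulo a maximal ideal containing \<open>I\<close> every variable is a constant
  \<open>a i\<close>, hence every polynomial is congruent to its value at \<open>a\<close>. A
  nonzero value of an element of \<open>I\<close> would put a unit into the maximal ideal.\<close>

theorem weak_Nullstellensatz:
  fixes I :: "3 mpoly set"
  assumes "is_ideal I" "1 \<notin> I"
  shows "\<exists>a. \<forall>p\<in>I. mpoly_eval a p = 0"
proof -
  obtain M where M: "is_ideal M" "1 \<notin> M" "I \<subseteq> M" "\<And>x. x \<notin> M \<Longrightarrow> \<exists>q. x * q - 1 \<in> M"
    using maximal_ideal_exists[OF assms] by blast
  obtain a where a: "\<And>i. mvar i - mpoly_const (a i) \<in> M"
    using root_mod_maximal[OF M(1,2,4)] by metis
  have eval: "p - mpoly_const (mpoly_eval a p) \<in> M" for p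
  proof (induction p rule: mpoly_induct)
    case (add p q)
    then show ?case using is_ideal_add[OF M(1) add] by (simp add: mpoly_const_add algebra_simps)
  next
    case (mult_var p i)
    have "(p - mpoly_const (mpoly_eval a p)) * mvar i
        + mpoly_const (mpoly_eval a p) * (mvar i - mpoly_const (a i)) \<in> M"
      using mult_var a M(1) by (intro is_ideal_add is_ideal_mult is_ideal_mult_right) auto
    then show ?case by (simp add: mpoly_const_mult algebra_simps)
  qed (use M(1) in \<open>simp add: is_ideal_0\<close>)
  have "mpoly_eval a p = 0" if "p \<in> I" for p
  proof (rule ccontr)
    assume "mpoly_eval a p \<noteq> 0"
    moreover have "p - (p - mpoly_const (mpoly_eval a p)) \<in> M"
      by (rule is_ideal_diff[OF M(1)]) (use that M(3) eval in auto)
    then have "mpoly_const (1 / mpoly_eval a p) * mpoly_const (mpoly_eval a p) \<in> M"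
      using M(1) by (auto intro: is_ideal_mult)
    ultimately show False using M(2) by (simp flip: mpoly_const_mult)
  qed
  then show ?thesis by blast
qed

text \<open>A homogeneous form of Rabinowitsch's argument: instead of a new variable,
  \<open>mvar i\<close> is set to \<open>1\<close>. Comparing components in
  \<open>1 = q + b * (mvar i - 1)\<close> gives \<open>hc j b + mvar i ^ j \<in> I\<close> for all
  \<open>j\<close>, and \<open>hc j b\<close> vanishes for large \<open>j\<close>.\<close>

lemma power_var_in_ideal:
  assumes I: "is_ideal I" "\<And>p d. p \<in> I \<Longrightarrow> hc d p \<in> I"
    and no_zero: "\<And>a. a i \<noteq> 0 \<Longrightarrow> \<exists>p\<in>I. mpoly_eval a p \<noteq> 0"
  shows "\<exists>N. \<forall>k\<ge>N. mvar i ^ k \<in> I"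
proof -
  let ?J = "{y + r * (mvar i - 1) | y r. y \<in> I}"
  have "1 \<in> ?J"
  proof (rule ccontr)
    assume "1 \<notin> ?J"
    from weak_Nullstellensatz[OF is_ideal_adjoin[OF I(1)] this]
    obtain a where a: "\<forall>p\<in>?J. mpoly_eval a p = 0" by blast
    have "mvar i - 1 \<in> ?J" by (rule adjoin_mem[OF I(1)])
    with a have "mpoly_eval a (mvar i - 1) = 0" by (rule bspec)
    then have "a i \<noteq> 0" by auto
    moreover have "I \<subseteq> ?J" by (rule adjoin_subset)
    ultimately show False using no_zero[of a] a by blast
  qed
  then obtain q b where b: "1 = q + b * (mvar i - 1)" "q \<in> I" by blast
  have comp: "hc j 1 = hc j q + (hc j (b * mvar i) - hc j b)" for j
  proof -
    have "1 = q + (b * mvar i - b)" using b(1) by (simp add: algebra_simps)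
    from arg_cong[OF this, of "hc j"] show ?thesis by (simp only: hc_add hc_diff)
  qed
  have shift: "hc j (b * mvar i) = (if 1 \<le> j then hc (j - 1) b * mvar i else 0)" for j
    by (rule hc_mult_form[OF forms_mvar])
  have one: "hc j 1 = (if j = 0 then 1 else 0)" for j
    by (rule hc_form[OF forms_1])
  have pow: "hc j b + mvar i ^ j \<in> I" for j
  proof (induction j)
    case 0
    have "hc 0 b + 1 = hc 0 q" using comp[of 0] shift[of 0] one[of 0] by (simp add: algebra_simps)
    then show ?case using I(2)[OF b(2)] by simp
  next
    case (Suc j)
    have "hc (Suc j) b = hc (Suc j) q + hc j b * mvar i"
      using comp[of "Suc j"] shift[of "Suc j"] one[of "Suc j"] by (simp add: algebra_simps)
    then have "hc (Suc j) b + mvar i ^ Suc j = hc (Suc j) q + (hc j b + mvar i ^ j) * mvar i"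
      by (simp add: algebra_simps)
    then show ?case using Suc I b(2) by (auto intro: is_ideal_add is_ideal_mult_right)
  qed
  obtain D where D: "\<forall>d>D. hc d b = 0" using mpoly_sum_hc[of b] by blast
  have "mvar i ^ k \<in> I" if "k \<ge> Suc D" for k
  proof -
    have "hc k b + mvar i ^ k = mvar i ^ k" using D that by simp
    with pow[of k] show ?thesis by simp
  qed
  then show ?thesis by blast
qed

text \<open>Some power of each variable lies in \<open>I\<close>, and a monomial of large degree
  contains one of these powers by the pigeonhole principle.\<close>

theorem projective_Nullstellensatz:
  assumes I: "is_ideal I" "\<And>p d. p \<in> I \<Longrightarrow> hc d p \<in> I"
    and no_zero: "\<And>a. a \<noteq> (\<lambda>_. 0) \<Longrightarrow> \<exists>p\<in>I. mpoly_eval a p \<noteq> 0"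
  shows "\<exists>N0. \<forall>N\<ge>N0. forms N \<subseteq> I"
proof -
  have "\<exists>N. \<forall>k\<ge>N. mvar i ^ k \<in> I" for i
    by (rule power_var_in_ideal[OF I]) (use no_zero in force)+
  then obtain N where N: "\<And>i k. k \<ge> N i \<Longrightarrow> mvar i ^ k \<in> I" by metis
  define M where "M = N 1 + N 2 + N 3"
  have "forms t \<subseteq> I" if t: "t \<ge> 3 * M" for t
  proof
    fix f assume f: "f \<in> forms t"
    have "Poly_Mapping.single m z \<in> I" if "mdeg m = t" for m z
    proof -
      have "\<exists>i. Poly_Mapping.lookup m i \<ge> M"
      proof (rule ccontr)
        assume "\<nexists>i. M \<le> Poly_Mapping.lookup m i"
        then have "Poly_Mapping.lookup m i < M" for i by (meson not_le)
        from this[of 1] this[of 2] this[of 3] that t show False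
          by (simp add: mdeg_def sum_3)
      qed
      then obtain i where i: "Poly_Mapping.lookup m i \<ge> M" by blast
      have "N i \<le> M" using exhaust_3[of i] by (auto simp: M_def)
      then have mem: "mvar i ^ M \<in> I" by (rule N)
      have pow: "mvar i ^ k = Poly_Mapping.single (Poly_Mapping.single i k) 1" for k
        by (induction k) (auto simp: mvar_def mult_single single_add[symmetric])
      have "m = (m - Poly_Mapping.single i M) + Poly_Mapping.single i M"
        using i by (intro poly_mapping_eqI) (auto simp: lookup_add lookup_minus lookup_single when_def)
      then have "Poly_Mapping.single m z = Poly_Mapping.single (m - Poly_Mapping.single i M) z * mvar i ^ M"
        by (simp add: pow mult_single)
      then show ?thesis using is_ideal_mult[OF I(1) mem] by metis
    qed
    then show "f \<in> I"
      using f by (subst poly_mapping_sum_singles) (auto simp: forms_iff intro!: is_ideal_sum[OF I(1)])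
  qed
  then show ?thesis by blast
qed

section \<open>Unique factorization\<close>

interpretation tower: mpoly_subst "\<lambda>z::complex. [:[:[:z:]:]:]"
  by unfold_locales (auto simp: one_pCons)

text \<open>Images of the three variables in \<open>complex poly poly poly\<close>, the first
  variable innermost. The resulting \<open>tower_map\<close> is a ring isomorphism, along which
  factoriality of the iterated polynomial ring is carried to \<open>3 mpoly\<close>.\<close>

definition tower_vars :: "3 \<Rightarrow> complex poly poly poly" where
  "tower_vars i = (if i = 1 then [:[:[:0, 1:]:]:] else if i = 2 then [:[:0, 1:]:] else [:0, 1:])"

abbreviation tower_map :: "3 mpoly \<Rightarrow> complex poly poly poly" where
  "tower_map \<equiv> tower.subst tower_vars"

lemma tower_map_single:
  "tower_map (Poly_Mapping.single (mono3 i j k) z) = Polynomial.monom (Polynomial.monom (Polynomial.monom z i) j) k"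
proof -
  have "monom_eval tower_vars (mono3 i j k) = [:[:[:0, 1:] ^ i:]:] * [:[:0, 1:] ^ j:] * [:0, 1:] ^ k"
    by (simp add: mono3_def monom_eval_add tower_vars_def poly_const_pow)
  then show ?thesis
    by (simp add: monom_altdef)
qed

lemma coeff_tower_map:
  "Polynomial.coeff (Polynomial.coeff (Polynomial.coeff (tower_map p) k) j) i =
    Poly_Mapping.lookup p (mono3 i j k)"
proof (induction p rule: poly_mapping_single_induct)
  case (add m z p)
  obtain i' j' k' where "m = mono3 i' j' k'" using mono3_cases by blast
  with add show ?case
    by (auto simp: tower_map_single lookup_add lookup_single when_def simp del: tower.subst_single)
qed simp

lemma inj_tower_map: "tower_map p = tower_map q \<Longrightarrow> p = q"
proof (rule poly_mapping_eqI)
  fix m assume "tower_map p = tower_map q"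
  moreover obtain i j k where "m = mono3 i j k" using mono3_cases by blast
  ultimately show "Poly_Mapping.lookup p m = Poly_Mapping.lookup q m"
    by (metis coeff_tower_map)
qed

lemma surj_tower_map: "\<exists>p. tower_map p = P"
proof -
  have 1: "\<exists>p. tower_map p = [:[:r:]:]" for r
  proof (induction r)
    case 0
    have "tower_map 0 = [:[:0:]:]" by simp
    then show ?case by blast
  next
    case (pCons z r)
    then obtain p where "tower_map p = [:[:r:]:]" by blast
    then have "tower_map (mpoly_const z + mvar 1 * p) = [:[:pCons z r:]:]"
      by (simp add: tower_vars_def)
    then show ?case by blast
  qed
  have 2: "\<exists>p. tower_map p = [:q:]" for q
  proof (induction q)
    case 0
    have "tower_map 0 = [:0:]" by simp
    then show ?case by blast
  next
    case (pCons r q)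
    obtain p p' where "tower_map p = [:q:]" "tower_map p' = [:[:r:]:]" using pCons 1 by blast
    then have "tower_map (p' + mvar 2 * p) = [:pCons r q:]"
      by (simp add: tower_vars_def)
    then show ?case by blast
  qed
  show ?thesis
  proof (induction P)
    case 0
    have "tower_map 0 = 0" by simp
    then show ?case by blast
  next
    case (pCons q P)
    obtain p p' where "tower_map p = P" "tower_map p' = [:q:]" using pCons 2 by blast
    then have "tower_map (p' + mvar 3 * p) = pCons q P"
      by (simp add: tower_vars_def)
    then show ?case by blast
  qed
qed

lemma tower_map_dvd_iff: "tower_map f dvd tower_map g \<longleftrightarrow> f dvd g"
proof
  assume "tower_map f dvd tower_map g"
  then obtain P where "tower_map g = tower_map f * P" by blast
  moreover obtain p where "tower_map p = P" using surj_tower_map by blast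
  ultimately have "tower_map g = tower_map (f * p)" by simp
  then have "g = f * p" by (rule inj_tower_map)
  then show "f dvd g" by simp
qed (auto elim!: dvdE)

lemma mpoly_irreducible_imp_prime_elem:
  fixes f :: "3 mpoly"
  assumes "Factorial_Ring.irreducible f"
  shows "prime_elem f"
proof -
  have unit: "tower_map a dvd 1 \<longleftrightarrow> a dvd 1" for a
    using tower_map_dvd_iff[of a 1] by simp
  have zero: "tower_map a = 0 \<longleftrightarrow> a = 0" for a
    using inj_tower_map[of a 0] by auto
  have "Factorial_Ring.irreducible (tower_map f)"
  proof (rule Factorial_Ring.irreducibleI)
    fix A B assume AB: "tower_map f = A * B"
    obtain a b where ab: "A = tower_map a" "B = tower_map b" using surj_tower_map by metis
    then have "tower_map f = tower_map (a * b)" using AB by simp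
    then have "f = a * b" by (rule inj_tower_map)
    then show "A dvd 1 \<or> B dvd 1"
      using assms Factorial_Ring.irreducibleD[of f a b] by (simp add: ab unit)
  qed (use assms in \<open>auto simp: unit zero Factorial_Ring.irreducible_def\<close>)
  then have p: "prime_elem (tower_map f)" by (rule irreducible_imp_prime_elem)
  show ?thesis
  proof (rule prime_elemI)
    fix a b assume "f dvd a * b"
    then have "tower_map f dvd tower_map a * tower_map b"
      using tower_map_dvd_iff[of f "a * b"] by simp
    then show "f dvd a \<or> f dvd b"
      using p by (simp add: prime_elem_dvd_mult_iff tower_map_dvd_iff)
  qed (use assms in \<open>auto simp: Factorial_Ring.irreducible_def\<close>)
qed

section \<open>Codimension of an ideal generated by two forms\<close>

interpretation mv: vector_space "\<lambda>c (p::3 mpoly). mpoly_const c * p"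
  by unfold_locales (simp_all add: algebra_simps mpoly_const_add mpoly_const_mult)

definition monomials :: "nat \<Rightarrow> 3 mpoly set" where
  "monomials t = (\<lambda>m. Poly_Mapping.single m 1) ` mdegs t"

lemma monomials_forms: "monomials t \<subseteq> forms t"
  by (auto simp: monomials_def mdegs_def forms_single)

lemma finite_monomials [simp]: "finite (monomials t)"
  by (simp add: monomials_def)

lemma inj_monomial: "inj (\<lambda>m. Poly_Mapping.single m (1::complex))"
  by (rule injI) (metis lookup_single_eq lookup_single_not_eq zero_neq_one)

lemma card_monomials: "card (monomials t) = card (mdegs t)"
  unfolding monomials_def by (intro card_image inj_on_subset[OF inj_monomial]) auto

lemma subspace_forms: "mv.subspace (forms t)"
  by (rule mv.subspaceI) (auto intro: forms_add forms_const_mult)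

lemma span_monomials: "mv.span (monomials t) = forms t"
proof
  show "mv.span (monomials t) \<subseteq> forms t"
    by (rule mv.span_minimal[OF monomials_forms subspace_forms])
  show "forms t \<subseteq> mv.span (monomials t)"
  proof
    fix f assume f: "f \<in> forms t"
    have "Poly_Mapping.single m z \<in> mv.span (monomials t)" if "mdeg m = t" for m z
    proof -
      have "mpoly_const z * Poly_Mapping.single m 1 \<in> mv.span (monomials t)"
        by (rule mv.span_scale, rule mv.span_base) (use that in \<open>auto simp: monomials_def mdegs_def\<close>)
      then show ?thesis by (simp add: mpoly_const_def mult_single)
    qed
    then show "f \<in> mv.span (monomials t)"
      using f by (subst poly_mapping_sum_singles) (auto simp: forms_iff intro!: mv.span_sum)
  qed
qed

lemma independent_monomials: "mv.independent (monomials t)"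
proof
  assume "mv.dependent (monomials t)"
  then obtain u v where u: "(\<Sum>p\<in>monomials t. mpoly_const (u p) * p) = 0" "v \<in> monomials t" "u v \<noteq> 0"
    using mv.dependent_finite[of "monomials t"] by auto
  obtain m where m: "v = Poly_Mapping.single m 1" "m \<in> mdegs t" using u(2) by (auto simp: monomials_def)
  have "(\<Sum>p\<in>monomials t. mpoly_const (u p) * p) =
      (\<Sum>m\<in>mdegs t. mpoly_const (u (Poly_Mapping.single m 1)) * Poly_Mapping.single m 1)"
    unfolding monomials_def by (rule sum.reindex_cong[OF inj_on_subset[OF inj_monomial]]) auto
  then have "Poly_Mapping.lookup (\<Sum>m\<in>mdegs t. mpoly_const (u (Poly_Mapping.single m 1)) * Poly_Mapping.single m 1) m = 0"
    using u(1) by simp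
  then have "u v = 0"
    using m by (simp add: lookup_sum lookup_single when_def if_distrib[of "(*) _"] cong: if_cong)
  with u(3) show False by blast
qed

lemma mult_span: "x \<in> mv.span S \<Longrightarrow> b * x \<in> mv.span ((*) b ` S)"
proof (induction rule: mv.span_induct_alt)
  case (step c x y)
  have "b * x \<in> mv.span ((*) b ` S)" using step by (intro mv.span_base) auto
  then have "mpoly_const c * (b * x) + b * y \<in> mv.span ((*) b ` S)"
    using step by (intro mv.span_add mv.span_scale)
  then show ?case by (simp add: algebra_simps)
qed (simp add: mv.span_zero)

lemma independent_mult:
  assumes "a \<noteq> 0" "mv.independent S"
  shows "mv.independent ((*) a ` S)"
proof
  assume "mv.dependent ((*) a ` S)"
  then obtain T u where T: "finite T" "T \<subseteq> (*) a ` S" "(\<Sum>v\<in>T. mpoly_const (u v) * v) = 0" "\<exists>v\<in>T. u v \<noteq> 0"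
    unfolding mv.dependent_explicit by blast
  obtain S' where S': "S' \<subseteq> S" "T = (*) a ` S'" "finite S'"
    using finite_subset_image[OF T(1,2)] by blast
  have "(\<Sum>v\<in>T. mpoly_const (u v) * v) = (\<Sum>v\<in>S'. mpoly_const (u (a * v)) * (a * v))"
    unfolding S'(2) by (rule sum.reindex_cong[of "(*) a"]) (use assms(1) in \<open>auto simp: inj_on_def\<close>)
  also have "\<dots> = a * (\<Sum>v\<in>S'. mpoly_const (u (a * v)) * v)"
    by (simp add: sum_distrib_left algebra_simps)
  finally have "(\<Sum>v\<in>S'. mpoly_const (u (a * v)) * v) = 0" using T(3) assms(1) by simp
  moreover have "\<exists>v\<in>S'. u (a * v) \<noteq> 0" using T(4) S'(2) by auto
  ultimately show False
    using assms(2) S'(1,3) unfolding mv.dependent_explicit by (auto dest: spec[of _ S'] spec[of _ "\<lambda>v. u (a * v)"])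
qed

lemma ideal2_component:
  assumes "a \<in> forms d" "b \<in> forms e" "h \<in> forms t" "h = x * a + y * b" "d \<le> t" "e \<le> t"
  shows "h = hc (t - d) x * a + hc (t - e) y * b"
proof -
  have "h = hc t (x * a + y * b)" using assms(3,4) by (simp add: hc_form)
  then show ?thesis by (simp add: hc_add hc_mult_form[OF assms(1)] hc_mult_form[OF assms(2)] assms(5,6))
qed

text \<open>The degree \<open>t\<close> part of the ideal of \<open>a\<close> and \<open>b\<close>
  is spanned by the multiples of \<open>a\<close> and those multiples of \<open>b\<close> whose
  cofactor is not a multiple of \<open>a\<close>. With \<open>N(t)\<close> monomials of degree
  \<open>t\<close>, its dimension is at most \<open>N(t - d) + N(t - e) - N(t - d - e)\<close>.
  \<open>Q\<close> completes a basis of it to a basis of \<open>forms t\<close>.\<close>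

lemma codim_ideal2:
  assumes a: "a \<in> forms d" "a \<noteq> 0" and b: "b \<in> forms e" and t: "d + e \<le> t"
  obtains Q where "Q \<subseteq> forms t" "finite Q" "d * e \<le> card Q"
    "\<And>c x y. (\<Sum>q\<in>Q. mpoly_const (c q) * q) = x * a + y * b \<Longrightarrow> \<forall>q\<in>Q. c q = 0"
proof -
  \<comment> \<open>Cofactors of \<open>b\<close> that contribute nothing new, since
    \<open>b * (a * m)\<close> is already a multiple of \<open>a\<close>.\<close>
  define A0 where "A0 = (*) a ` monomials (t - d - e)"
  have A0_forms: "A0 \<subseteq> forms (t - e)"
    using forms_mult[OF a(1)] monomials_forms[of "t - d - e"] t
    by (fastforce simp: A0_def)
  have ind_A0: "mv.independent A0"
    unfolding A0_def by (intro independent_mult a independent_monomials)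
  have card_A0: "card A0 = card (mdegs (t - d - e))"
    unfolding A0_def using a(2) by (subst card_image) (auto simp: inj_on_def card_monomials)
  obtain C where C: "A0 \<subseteq> C" "C \<subseteq> forms (t - e)" "mv.independent C" "forms (t - e) \<subseteq> mv.span C"
    using mv.maximal_independent_subset_extend[OF A0_forms ind_A0] by blast
  have finC: "finite C" and card_C: "card C \<le> card (mdegs (t - e))"
    using mv.independent_span_bound[OF finite_monomials[of "t - e"] C(3)] C(2)
    by (auto simp: span_monomials card_monomials)
  define T where "T = (*) b ` (C - A0) \<union> (*) a ` monomials (t - d)"
  have finT: "finite T" using finC by (simp add: T_def)
  have "card T \<le> card (C - A0) + card (monomials (t - d))"
    unfolding T_def using card_Un_le card_image_le finC finite_monomials
    by (meson add_mono finite_Diff le_trans)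
  also have "card (C - A0) = card C - card A0"
    using C(1) finC by (simp add: card_Diff_subset finite_subset)
  finally have card_T: "card T \<le> card (mdegs (t - e)) - card (mdegs (t - d - e)) + card (mdegs (t - d))"
    using card_C card_A0 by (simp add: card_monomials)
  have span_a: "a * x \<in> mv.span T" if "x \<in> forms (t - d)" for x
    using mult_span[of x "monomials (t - d)" a] that mv.span_mono[of "(*) a ` monomials (t - d)" T]
    by (auto simp: span_monomials T_def)
  have "(*) b ` C \<subseteq> mv.span T"
  proof
    fix v assume "v \<in> (*) b ` C"
    then obtain c where c: "c \<in> C" "v = b * c" by blast
    show "v \<in> mv.span T"
    proof (cases "c \<in> A0")
      case True
      then obtain m where "m \<in> monomials (t - d - e)" "c = a * m" by (auto simp: A0_def)
      moreover from this have "b * m \<in> forms (t - d)"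
        using forms_mult[OF b, of m "t - d - e"] monomials_forms[of "t - d - e"] t by auto
      ultimately show ?thesis using span_a[of "b * m"] c by (simp add: algebra_simps)
    next
      case False
      then show ?thesis using c by (auto simp: T_def intro: mv.span_base)
    qed
  qed
  then have span_b: "b * y \<in> mv.span T" if "y \<in> forms (t - e)" for y
    using mult_span[of y C b] that C(4) mv.span_mono[of "(*) b ` C" "mv.span T"]
    by (auto simp: mv.span_span)
  have T_forms: "T \<subseteq> forms t"
    using forms_mult[OF a(1)] forms_mult[OF b] monomials_forms[of "t - d"] C(2) t
    by (fastforce simp: T_def)
  obtain T0 where T0: "T0 \<subseteq> T" "mv.independent T0" "T \<subseteq> mv.span T0"
    using mv.maximal_independent_subset[of T] by blast
  obtain C2 where C2: "T0 \<subseteq> C2" "C2 \<subseteq> forms t" "mv.independent C2" "forms t \<subseteq> mv.span C2"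
    using mv.maximal_independent_subset_extend[of T0 "forms t"] T0 T_forms by blast
  have finC2: "finite C2"
    using mv.independent_span_bound[OF finite_monomials[of t] C2(3)] C2(2) by (auto simp: span_monomials)
  have card_C2: "card (mdegs t) \<le> card C2"
    using mv.independent_span_bound[OF finC2 independent_monomials[of t]] C2(4) monomials_forms[of t]
    by (auto simp: card_monomials)
  have ind: "\<forall>q\<in>C2 - T0. c q = 0"
    if eq: "(\<Sum>q\<in>C2 - T0. mpoly_const (c q) * q) = x * a + y * b" for c x y
  proof (rule ccontr)
    assume "\<not> (\<forall>q\<in>C2 - T0. c q = 0)"
    then obtain q0 where q0: "q0 \<in> C2" "q0 \<notin> T0" "c q0 \<noteq> 0" by blast
    let ?S = "\<Sum>q\<in>C2 - T0. mpoly_const (c q) * q"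
    have "?S \<in> forms t" using C2(2) by (auto intro!: forms_sum forms_const_mult)
    then have "?S = a * hc (t - d) x + b * hc (t - e) y"
      using ideal2_component[OF a(1) b _ eq] t by (simp add: mult.commute)
    then have "?S \<in> mv.span T" using span_a span_b by (simp add: mv.span_add)
    then have "?S \<in> mv.span T0" using T0(3) mv.span_mono[OF T0(3)] by (auto simp: mv.span_span)
    moreover have "T0 \<subseteq> C2 - {q0}" using C2(1) q0(2) by blast
    ultimately have S: "?S \<in> mv.span (C2 - {q0})" using mv.span_mono by blast
    let ?R = "\<Sum>q\<in>C2 - T0 - {q0}. mpoly_const (c q) * q"
    have split: "?S = mpoly_const (c q0) * q0 + ?R"
      using q0 finC2 by (intro sum.remove) auto
    have R: "?R \<in> mv.span (C2 - {q0})"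
      by (intro mv.span_sum mv.span_scale mv.span_base) auto
    have "mpoly_const (c q0) * q0 \<in> mv.span (C2 - {q0})"
      using mv.span_diff[OF S R] by (simp only: split add_diff_cancel_right')
    then have "mpoly_const (1 / c q0) * (mpoly_const (c q0) * q0) \<in> mv.span (C2 - {q0})"
      by (rule mv.span_scale)
    then have "q0 \<in> mv.span (C2 - {q0})"
      using q0(3) by (simp add: mult.assoc[symmetric] flip: mpoly_const_mult)
    then show False using C2(3) q0(1) by (auto simp: mv.dependent_def)
  qed
  have "d * e \<le> card (C2 - T0)"
  proof -
    have "card T0 \<le> card T" using T0(1) finT by (rule card_mono[rotated])
    moreover have "card (C2 - T0) = card C2 - card T0"
      using C2(1) finC2 by (simp add: card_Diff_subset finite_subset)
    ultimately have "card (mdegs t) \<le> card (C2 - T0) + (card (mdegs (t - e)) - card (mdegs (t - d - e)) + card (mdegs (t - d)))"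
      using card_C2 card_T by linarith
    moreover obtain s where s: "t = s + d + e" using t by (metis add.assoc add.commute le_iff_add)
    \<comment> \<open>The mixed second difference of the quadratic function counting monomials is
      exactly \<open>d * e\<close>.\<close>
    have "2 * card (mdegs (s + d + e)) + 2 * card (mdegs s) = 2 * (d * e) + 2 * card (mdegs (s + d)) + 2 * card (mdegs (s + e))"
      by (simp only: card_mdegs) (simp add: algebra_simps)
    moreover have "2 * card (mdegs s) \<le> 2 * card (mdegs (s + d))"
      by (simp only: card_mdegs) (intro mult_mono, auto)
    ultimately show ?thesis using s by (simp add: algebra_simps)
  qed
  with ind finC2 C2(2) show thesis by (intro that[of "C2 - T0"]) auto
qed

section \<open>Points of the projective plane\<close>

definition pvec :: "proj_plane \<Rightarrow> complex ^ 3" where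
  "pvec P = (SOME v. v \<noteq> 0 \<and> Rep_proj_plane P = range (\<lambda>c. c *s v))"

definition pt :: "proj_plane \<Rightarrow> 3 \<Rightarrow> complex" where
  "pt P = (\<lambda>i. pvec P $ i)"

lemma pvec: "pvec P \<noteq> 0" "Rep_proj_plane P = range (\<lambda>c. c *s pvec P)"
proof -
  have "\<exists>v. v \<noteq> 0 \<and> Rep_proj_plane P = range (\<lambda>c. c *s v)"
    using Rep_proj_plane[of P] by blast
  from someI_ex[OF this] show "pvec P \<noteq> 0" "Rep_proj_plane P = range (\<lambda>c. c *s pvec P)"
    by (auto simp: pvec_def)
qed

lemma pt_nonzero: "pt P \<noteq> (\<lambda>_. 0)"
  using pvec(1)[of P] by (auto simp: pt_def vec_eq_iff fun_eq_iff)

lemma vanishes_at_iff: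
  assumes "f \<in> forms d"
  shows "vanishes_at f P \<longleftrightarrow> mpoly_eval (pt P) f = 0"
proof -
  have "($) (c *s pvec P) = (\<lambda>i. c * pt P i)" for c
    by (auto simp: pt_def)
  then have "mpoly_eval (($) (c *s pvec P)) f = c ^ d * mpoly_eval (pt P) f" for c
    using ev.subst_scale[OF assms, of c "pt P"] by (simp add: mpoly_eval_conv_subst)
  then show ?thesis
    unfolding vanishes_at_def pvec(2) by (auto dest: spec[of _ 1])
qed

lemma pt_exists:
  assumes "p \<noteq> (\<lambda>_. 0)"
  obtains P c where "c \<noteq> 0" "p = (\<lambda>i. c * pt P i)"
proof -
  define v :: "complex ^ 3" where "v = (\<chi> i. p i)"
  have v: "v \<noteq> 0" using assms by (auto simp: v_def vec_eq_iff)
  define P where "P = Abs_proj_plane (range (\<lambda>c. c *s v))"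
  have "Rep_proj_plane P = range (\<lambda>c. c *s v)"
    unfolding P_def using v by (intro Abs_proj_plane_inverse) auto
  then have "v \<in> range (\<lambda>c. c *s pvec P)"
    using pvec(2)[of P] by (metis rangeI vector_smult_lid)
  then obtain c where c: "v = c *s pvec P" by blast
  then have "p = (\<lambda>i. c * pt P i)"
    by (auto simp: v_def pt_def vec_eq_iff fun_eq_iff)
  moreover have "c \<noteq> 0" using c v by auto
  ultimately show thesis using that by blast
qed

lemma pt_eqI:
  assumes "pt P = (\<lambda>i. c * pt Q i)"
  shows "P = Q"
proof -
  have eq: "pvec P = c *s pvec Q"
    using assms by (auto simp: pt_def vec_eq_iff fun_eq_iff)
  then have c: "c \<noteq> 0" using pvec(1)[of P] by auto
  have "range (\<lambda>z. z *s pvec P) = range (\<lambda>z. z *s pvec Q)"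
  proof
    show "range (\<lambda>z. z *s pvec P) \<subseteq> range (\<lambda>z. z *s pvec Q)"
      unfolding eq by (auto simp: vector_smult_assoc)
    have "z *s pvec Q = (z / c) *s pvec P" for z
      unfolding eq using c by (simp add: vector_smult_assoc)
    then show "range (\<lambda>z. z *s pvec Q) \<subseteq> range (\<lambda>z. z *s pvec P)" by blast
  qed
  then show ?thesis using pvec(2) by (metis Rep_proj_plane_inject)
qed

lemma mpoly_eval_scale: "f \<in> forms d \<Longrightarrow> mpoly_eval (\<lambda>i. s * a i) f = s ^ d * mpoly_eval a f"
  using ev.subst_scale[of f d s a] by (simp add: mpoly_eval_conv_subst)

lemma smooth_curve_iff:
  "smooth_curve d f \<longleftrightarrow> f \<in> forms d \<and>
    (\<forall>p. p \<noteq> (\<lambda>_. 0) \<longrightarrow> mpoly_eval p f = 0 \<longrightarrow> (\<exists>i. mpoly_eval p (mpoly_pderiv i f) \<noteq> 0))"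
proof (cases "f \<in> forms d")
  case True
  have pd: "mpoly_pderiv i f \<in> forms (d - 1)" for i by (rule forms_mpoly_pderiv[OF True])
  have smooth: "smooth_curve d f \<longleftrightarrow>
      (\<forall>P. mpoly_eval (pt P) f = 0 \<longrightarrow> (\<exists>i. mpoly_eval (pt P) (mpoly_pderiv i f) \<noteq> 0))"
    unfolding smooth_curve_def curve_points_def using True
    by (simp add: vanishes_at_iff[OF True] vanishes_at_iff[OF pd])
  show ?thesis
  proof
    assume *: "smooth_curve d f"
    have "\<exists>i. mpoly_eval p (mpoly_pderiv i f) \<noteq> 0" if p: "p \<noteq> (\<lambda>_. 0)" "mpoly_eval p f = 0" for p
    proof -
      obtain P c where "c \<noteq> 0" "p = (\<lambda>i. c * pt P i)" using pt_exists[OF p(1)] by blast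
      with p(2) * show ?thesis
        unfolding smooth by (simp add: mpoly_eval_scale[OF True] mpoly_eval_scale[OF pd])
    qed
    with True show "f \<in> forms d \<and> (\<forall>p. p \<noteq> (\<lambda>_. 0) \<longrightarrow> mpoly_eval p f = 0 \<longrightarrow>
        (\<exists>i. mpoly_eval p (mpoly_pderiv i f) \<noteq> 0))" by blast
  qed (use pt_nonzero in \<open>auto simp: smooth\<close>)
qed (simp add: smooth_curve_def)

section \<open>Smooth plane curves are irreducible\<close>

lemma ideal2_is_ideal: "is_ideal {x * a + y * b | x y. True}" for a b :: "'a::comm_ring_1"
  unfolding is_ideal_def
proof (intro conjI ballI allI)
  show "0 \<in> {x * a + y * b | x y. True}" by (auto intro!: exI[of _ 0])
next
  fix u v assume "u \<in> {x * a + y * b | x y. True}" "v \<in> {x * a + y * b | x y. True}"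
  then obtain x y x' y' where "u = x * a + y * b" "v = x' * a + y' * b" by blast
  then have "u + v = (x + x') * a + (y + y') * b" by (simp add: algebra_simps)
  then show "u + v \<in> {x * a + y * b | x y. True}" by blast
next
  fix u r assume "u \<in> {x * a + y * b | x y. True}"
  then obtain x y where "u = x * a + y * b" by blast
  then have "r * u = (r * x) * a + (r * y) * b" by (simp add: algebra_simps)
  then show "r * u \<in> {x * a + y * b | x y. True}" by blast
qed

text \<open>Without a common zero the Nullstellensatz puts all forms of large degree into the ideal
  of \<open>a\<close> and \<open>b\<close>, whose codimension there is at least
  \<open>d * e > 0\<close>.\<close>

lemma forms_common_zero:
  assumes a: "a \<in> forms d" "a \<noteq> 0" "0 < d" and b: "b \<in> forms e" "0 < e"
  shows "\<exists>p. p \<noteq> (\<lambda>_. 0) \<and> mpoly_eval p a = 0 \<and> mpoly_eval p b = 0"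
proof (rule ccontr)
  assume no: "\<not> ?thesis"
  let ?I = "{x * a + y * b | x y. True}"
  have "\<exists>N0. \<forall>N\<ge>N0. forms N \<subseteq> ?I"
  proof (rule projective_Nullstellensatz[OF ideal2_is_ideal])
    fix p k assume "p \<in> ?I"
    then obtain x y where p: "p = x * a + y * b" by blast
    have "hc k p = (if d \<le> k then hc (k - d) x else 0) * a + (if e \<le> k then hc (k - e) y else 0) * b"
      by (simp add: p hc_add hc_mult_form[OF a(1)] hc_mult_form[OF b(1)])
    then show "hc k p \<in> ?I" by blast
  next
    fix p :: "3 \<Rightarrow> complex" assume "p \<noteq> (\<lambda>_. 0)"
    then have "mpoly_eval p a \<noteq> 0 \<or> mpoly_eval p b \<noteq> 0" using no by blast
    moreover have "a = 1 * a + 0 * b" "b = 0 * a + 1 * b" by simp_all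
    then have "a \<in> ?I" "b \<in> ?I" by blast+
    ultimately show "\<exists>q\<in>?I. mpoly_eval p q \<noteq> 0" by blast
  qed
  then obtain N0 where N0: "\<And>N. N \<ge> N0 \<Longrightarrow> forms N \<subseteq> ?I" by blast
  obtain Q where Q: "Q \<subseteq> forms (N0 + d + e)" "finite Q" "d * e \<le> card Q"
    "\<And>c x y. (\<Sum>q\<in>Q. mpoly_const (c q) * q) = x * a + y * b \<Longrightarrow> \<forall>q\<in>Q. c q = 0"
    using codim_ideal2[OF a(1,2) b(1), of "N0 + d + e"] by auto
  have "Q \<noteq> {}" using Q(3) a(3) b(2) by auto
  have "(\<Sum>q\<in>Q. mpoly_const 1 * q) \<in> forms (N0 + d + e)"
    using Q(1) by (intro forms_sum forms_const_mult) auto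
  then obtain x y where "(\<Sum>q\<in>Q. mpoly_const 1 * q) = x * a + y * b"
    using N0[of "N0 + d + e"] by auto
  with Q(4)[of "\<lambda>_. 1"] \<open>Q \<noteq> {}\<close> show False by auto
qed

lemma hc_mult: "hc n (p * q) = (\<Sum>i\<le>n. hc i p * hc (n - i) q)"
proof (induction q rule: poly_mapping_single_induct)
  case (add m z q)
  let ?s = "Poly_Mapping.single m z"
  have s: "?s \<in> forms (mdeg m)" by (rule forms_single) simp
  have "(\<Sum>i\<le>n. hc i p * hc (n - i) ?s) = (\<Sum>i\<le>n. if i = n - mdeg m \<and> mdeg m \<le> n then hc i p * ?s else 0)"
    by (intro sum.cong) (auto simp: hc_form[OF s])
  also have "\<dots> = hc n (p * ?s)"
    by (simp add: hc_mult_form[OF s])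
  finally show ?case using add by (simp add: hc_add algebra_simps sum.distrib)
qed simp

text \<open>The product of the top components of \<open>a\<close> and \<open>b\<close> cannot
  cancel, nor can that of the lowest ones. Both products have degree \<open>d\<close>, so top and
  lowest degree agree in each factor.\<close>

lemma form_factor:
  assumes "a * b \<in> forms d" "a * b \<noteq> 0"
  shows "\<exists>i j. i + j = d \<and> a \<in> forms i \<and> b \<in> forms j"
proof -
  define H where "H = (\<lambda>p. {j. hc j p \<noteq> 0})"
  have fin: "finite (H p)" for p
  proof -
    obtain D where "\<forall>d>D. hc d p = 0" using mpoly_sum_hc[of p] by blast
    then have "H p \<subseteq> {..D}" by (auto simp: H_def not_less[symmetric])
    then show ?thesis by (rule finite_subset) simp
  qed
  have ne: "H a \<noteq> {}" "H b \<noteq> {}"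
    using assms(2) mpoly_eq_0_if_hc[of a] mpoly_eq_0_if_hc[of b] by (auto simp: H_def)
  have single: "hc (i + j) (a * b) = hc i a * hc j b"
    if "\<And>i' j'. i' + j' = i + j \<Longrightarrow> i' \<noteq> i \<Longrightarrow> hc i' a * hc j' b = 0" for i j
  proof -
    have "hc (i + j) (a * b) = (\<Sum>i'\<in>{i}. hc i' a * hc (i + j - i') b)"
      unfolding hc_mult using that by (intro sum.mono_neutral_right) auto
    then show ?thesis by simp
  qed
  let ?ma = "Max (H a)" and ?mb = "Max (H b)" and ?la = "Min (H a)" and ?lb = "Min (H b)"
  have mem: "?ma \<in> H a" "?mb \<in> H b" "?la \<in> H a" "?lb \<in> H b" using fin ne by auto
  have le: "?la \<le> j" "j \<le> ?ma" if "hc j a \<noteq> 0" for j using fin that by (auto simp: H_def)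
  have le': "?lb \<le> j" "j \<le> ?mb" if "hc j b \<noteq> 0" for j using fin that by (auto simp: H_def)
  have "hc (?ma + ?mb) (a * b) = hc ?ma a * hc ?mb b"
  proof (rule single)
    fix i' j' assume ij: "i' + j' = ?ma + ?mb" "i' \<noteq> ?ma"
    show "hc i' a * hc j' b = 0"
    proof (rule ccontr)
      assume "hc i' a * hc j' b \<noteq> 0"
      then have "i' \<le> ?ma" "j' \<le> ?mb" using le(2) le'(2) by auto
      with ij show False by linarith
    qed
  qed
  then have top: "?ma + ?mb = d" using mem assms(1) by (auto simp: H_def hc_form split: if_splits)
  have "hc (?la + ?lb) (a * b) = hc ?la a * hc ?lb b"
  proof (rule single)
    fix i' j' assume ij: "i' + j' = ?la + ?lb" "i' \<noteq> ?la"
    show "hc i' a * hc j' b = 0"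
    proof (rule ccontr)
      assume "hc i' a * hc j' b \<noteq> 0"
      then have "?la \<le> i'" "?lb \<le> j'" using le(1) le'(1) by auto
      with ij show False by linarith
    qed
  qed
  then have low: "?la + ?lb = d" using mem assms(1) by (auto simp: H_def hc_form split: if_splits)
  have "?la \<le> ?ma" "?lb \<le> ?mb" using fin mem by auto
  then have eq: "?la = ?ma" "?lb = ?mb" using top low by linarith+
  have form: "p \<in> forms j" if j: "\<And>i. hc i p \<noteq> 0 \<Longrightarrow> i = j" for p j
  proof -
    obtain D where D: "p = (\<Sum>d\<le>D. hc d p)" using mpoly_sum_hc[of p] by blast
    have "(\<Sum>d\<le>D. hc d p) \<in> forms j"
    proof (rule forms_sum)
      fix d show "hc d p \<in> forms j"
        by (cases "hc d p = 0") (use j[of d] hc_forms[of d p] in auto)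
    qed
    with D show ?thesis by simp
  qed
  have "a \<in> forms ?ma" by (rule form) (use le eq in force)
  moreover have "b \<in> forms ?mb" by (rule form) (use le' eq in force)
  ultimately have "a \<in> forms ?ma" "b \<in> forms ?mb" by blast+
  with top show ?thesis by blast
qed

lemma nonzero_const_form_unit: "a \<in> forms 0 \<Longrightarrow> a \<noteq> 0 \<Longrightarrow> a dvd 1"
proof -
  assume a: "a \<in> forms 0" "a \<noteq> 0"
  then obtain z where z: "a = mpoly_const z" "z \<noteq> 0" using forms_0_const by fastforce
  then have "1 = a * mpoly_const (1 / z)" by (simp flip: mpoly_const_mult)
  then show "a dvd 1" by (rule dvdI)
qed

lemma smooth_curve_nonzero: "smooth_curve d f \<Longrightarrow> f \<noteq> 0"
  by (auto simp: smooth_curve_iff dest: spec[of _ "\<lambda>_. 1"] simp: fun_eq_iff)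

text \<open>If \<open>f\<close> were a product of two forms of positive degree, a common zero of the
  factors would be a singular point by the Leibniz rule. Irreducible elements are prime by
  factoriality.\<close>

theorem smooth_curve_prime_elem:
  assumes "smooth_curve d f" "0 < d"
  shows "prime_elem f"
proof (rule mpoly_irreducible_imp_prime_elem, rule Factorial_Ring.irreducibleI)
  have f: "f \<in> forms d" using assms(1) by (simp add: smooth_curve_iff)
  show f0: "f \<noteq> 0" by (rule smooth_curve_nonzero[OF assms(1)])
  show "\<not> f dvd 1"
  proof
    assume "f dvd 1"
    then obtain g where g: "1 = f * g" by blast
    then have "\<exists>i j. i + j = 0 \<and> f \<in> forms i \<and> g \<in> forms j" by (intro form_factor) (simp_all flip: g)
    then show False using forms_degree_unique[OF f] f0 assms(2) by auto
  qed
  fix a b assume ab: "f = a * b"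
  then obtain i j where ij: "i + j = d" "a \<in> forms i" "b \<in> forms j"
    using form_factor[of a b d] f f0 by auto
  show "a dvd 1 \<or> b dvd 1"
  proof (rule ccontr)
    assume "\<not> (a dvd 1 \<or> b dvd 1)"
    then have "0 < i" "0 < j" using ij ab f0 nonzero_const_form_unit by fastforce+
    then obtain p where p: "p \<noteq> (\<lambda>_. 0)" "mpoly_eval p a = 0" "mpoly_eval p b = 0"
      using forms_common_zero[of a i b j] ij ab f0 by auto
    then have "mpoly_eval p f = 0" "mpoly_eval p (mpoly_pderiv i f) = 0" for i
      by (simp_all add: ab mpoly_pderiv_mult)
    with p(1) assms(1) show False by (auto simp: smooth_curve_iff)
  qed
qed

section \<open>Lines in the plane\<close>

text \<open>The variables are specialized one at a time in the iterated polynomial ring, each time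
  avoiding finitely many roots.\<close>

lemma mpoly_nonzero_value:
  fixes p :: "3 mpoly"
  assumes "p \<noteq> 0"
  shows "\<exists>a. mpoly_eval a p \<noteq> 0"
proof -
  have nonroot: "\<exists>z. poly P (h z) \<noteq> 0"
    if "P \<noteq> 0" "inj h" for P :: "'a::idom poly" and h :: "complex \<Rightarrow> 'a"
  proof (rule ccontr)
    assume "\<nexists>z. poly P (h z) \<noteq> 0"
    then have "range h \<subseteq> {x. poly P x = 0}" by auto
    then have "finite (range h)" using poly_roots_finite[OF that(1)] finite_subset by blast
    then show False using that(2) finite_imageD infinite_UNIV_char_0 by blast
  qed
  have "tower_map p \<noteq> 0" using assms inj_tower_map[of p 0] by auto
  then obtain z3 where z3: "poly (tower_map p) [:[:z3:]:] \<noteq> 0"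
    using nonroot[of "tower_map p" "\<lambda>z. [:[:z:]:]"] by (auto simp: inj_def)
  then obtain z2 where z2: "poly (poly (tower_map p) [:[:z3:]:]) [:z2:] \<noteq> 0"
    using nonroot[of _ "\<lambda>z. [:z:]"] by (auto simp: inj_def)
  then obtain z1 where z1: "poly (poly (poly (tower_map p) [:[:z3:]:]) [:z2:]) z1 \<noteq> 0"
    using nonroot[of _ "\<lambda>z. z"] by (auto simp: inj_def)
  define a where "a = (\<lambda>i::3. if i = 1 then z1 else if i = 2 then z2 else z3)"
  have "poly (poly (poly (tower_map q) [:[:z3:]:]) [:z2:]) z1 = mpoly_eval a q" for q
    by (induction q rule: mpoly_induct) (auto simp: tower_vars_def a_def)
  with z1 show ?thesis by auto
qed

lemma linear_form_expand:
  assumes "L \<in> forms 1"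
  obtains l where "L = (\<Sum>i\<in>UNIV. mpoly_const (l i) * mvar i)"
proof -
  have "\<exists>l. Poly_Mapping.single m z = (\<Sum>i\<in>UNIV. mpoly_const (l i) * mvar i)"
    if "mdeg m = 1" for m :: "3 \<Rightarrow>\<^sub>0 nat" and z
  proof -
    obtain a b c where m: "m = mono3 a b c" using mono3_cases by blast
    have *: "Poly_Mapping.single m z = mpoly_const z * mvar i" if "m = Poly_Mapping.single i 1" for i
      using that by (simp add: mpoly_const_def mvar_def mult_single)
    have "a + b + c = 1" using that m by simp
    then have "a = 1 \<and> b = 0 \<and> c = 0 \<or> a = 0 \<and> b = 1 \<and> c = 0 \<or> a = 0 \<and> b = 0 \<and> c = 1"
      by arith
    then have "\<exists>i. m = Poly_Mapping.single i 1" by (auto simp: m mono3_def)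
    then obtain i where i: "m = Poly_Mapping.single i 1" by blast
    have "(\<Sum>j\<in>UNIV. mpoly_const (if j = i then z else 0) * mvar j) =
        (\<Sum>j\<in>{i}. mpoly_const (if j = i then z else 0) * mvar j)"
      by (rule sum.mono_neutral_right) auto
    then show ?thesis using *[OF i] by (intro exI[of _ "\<lambda>j. if j = i then z else 0"]) simp
  qed
  then obtain l where l: "\<And>m z. mdeg m = 1 \<Longrightarrow>
      Poly_Mapping.single m z = (\<Sum>i\<in>UNIV. mpoly_const (l m z i) * mvar i)" by metis
  have "L = (\<Sum>m\<in>Poly_Mapping.keys L. Poly_Mapping.single m (Poly_Mapping.lookup L m))"
    by (rule poly_mapping_sum_singles)
  also have "\<dots> = (\<Sum>m\<in>Poly_Mapping.keys L. \<Sum>i\<in>UNIV. mpoly_const (l m (Poly_Mapping.lookup L m) i) * mvar i)"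
    using assms by (intro sum.cong refl l) (auto simp: forms_iff)
  also have "\<dots> = (\<Sum>i\<in>UNIV. mpoly_const (\<Sum>m\<in>Poly_Mapping.keys L. l m (Poly_Mapping.lookup L m) i) * mvar i)"
    by (subst sum.swap) (simp add: mpoly_const_sum sum_distrib_right)
  finally show thesis by (rule that)
qed

lemma UNIV_3_other:
  fixes k :: 3
  obtains i j where "i \<noteq> k" "j \<noteq> k" "i \<noteq> j" "UNIV = {k, i, j}"
proof -
  have "k = 1 \<or> k = 2 \<or> k = 3" by (rule exhaust_3)
  then show thesis
  proof (elim disjE)
    assume "k = 1" then show thesis using that[of 2 3] UNIV_3 by auto
  next
    assume "k = 2" then show thesis using that[of 1 3] UNIV_3 by auto
  next
    assume "k = 3" then show thesis using that[of 1 2] UNIV_3 by auto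
  qed
qed

lemma UNIV_3_third:
  fixes k i :: 3
  assumes "i \<noteq> k"
  obtains j where "j \<noteq> k" "j \<noteq> i" "UNIV = {k, i, j}"
proof -
  obtain i' j' where *: "i' \<noteq> k" "j' \<noteq> k" "i' \<noteq> j'" "UNIV = {k, i', j'}" by (rule UNIV_3_other)
  then have "i = i' \<or> i = j'" using assms by (metis UNIV_I insertE singletonD)
  then show thesis
  proof
    assume "i = i'" then show thesis using that[of j'] * by auto
  next
    assume "i = j'" then show thesis using that[of i'] * by auto
  qed
qed

lemma mpoly_eval_self_subst: "mpoly_eval p (self.subst a H) = mpoly_eval (\<lambda>i. mpoly_eval p (a i)) H"
  by (induction H rule: mpoly_induct) auto

text \<open>Solving \<open>L = 0\<close> for one variable and substituting changes \<open>H\<close>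
  by a multiple of \<open>L\<close>; the result has only zero values, hence is zero.\<close>

lemma linear_form_dvd:
  assumes L: "L \<in> forms 1" "L \<noteq> 0" and H: "\<And>p. mpoly_eval p L = 0 \<Longrightarrow> mpoly_eval p H = 0"
  shows "L dvd H"
proof -
  obtain l where l: "L = (\<Sum>i\<in>UNIV. mpoly_const (l i) * mvar i)" by (rule linear_form_expand[OF L(1)])
  obtain k where k: "l k \<noteq> 0" using L(2) l by (metis (no_types, lifting) mpoly_const_0 mult_zero_left sum.neutral)
  obtain i j where ij: "i \<noteq> k" "j \<noteq> k" "i \<noteq> j" "UNIV = {k, i, j}" by (rule UNIV_3_other)
  define a where "a = (\<lambda>x. if x = k then mvar k - mpoly_const (1 / l k) * L else mvar x)"
  have *: "L dvd H' - self.subst a H'" for H'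
  proof (induction H' rule: mpoly_induct)
    case (add p q)
    have "p + q - self.subst a (p + q) = (p - self.subst a p) + (q - self.subst a q)" by simp
    then show ?case using add by (metis dvd_add)
  next
    case (mult_var p x)
    have "p * mvar x - self.subst a (p * mvar x)
        = (p - self.subst a p) * mvar x + self.subst a p * (mvar x - a x)"
      by (simp add: algebra_simps)
    moreover have "L dvd mvar x - a x" by (simp add: a_def)
    ultimately show ?case using mult_var by (metis dvd_add dvd_mult dvd_mult2)
  qed simp
  have "self.subst a H = 0"
  proof (rule ccontr)
    assume "self.subst a H \<noteq> 0"
    then obtain p where p: "mpoly_eval p (self.subst a H) \<noteq> 0" using mpoly_nonzero_value by blast
    let ?p = "\<lambda>x. mpoly_eval p (a x)"
    have "mpoly_eval ?p L = l k * ?p k + l i * ?p i + l j * ?p j"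
      using ij by (simp add: l ij(4))
    also have "?p k = p k - (l k * p k + l i * p i + l j * p j) / l k"
      using ij by (simp add: a_def l ij(4))
    also have "l k * (p k - (l k * p k + l i * p i + l j * p j) / l k) + l i * ?p i + l j * ?p j = 0"
      using k ij by (simp add: a_def field_simps)
    finally have "mpoly_eval ?p H = 0" by (rule H)
    with p show False by (simp add: mpoly_eval_self_subst)
  qed
  with *[of H] show ?thesis by simp
qed

text \<open>The given \<open>\<beta>\<close> is completed by \<open>\<alpha>\<close> to a basis of
  the plane \<open>L = 0\<close>; \<open>\<kappa>\<^sub>1\<close> and
  \<open>\<kappa>\<^sub>2\<close> are linear forms on the whole space that restrict to the dual
  basis.\<close>

lemma linear_form_kernel_basis:
  assumes L: "L \<in> forms 1" "L \<noteq> 0" and \<beta>: "mpoly_eval \<beta> L = 0" "\<beta> \<noteq> (\<lambda>_. 0)"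
  obtains \<alpha> \<kappa>\<^sub>1 \<kappa>\<^sub>2 where "\<kappa>\<^sub>1 \<in> forms 1" "\<kappa>\<^sub>2 \<in> forms 1" "mpoly_eval \<alpha> L = 0"
    "mpoly_eval \<alpha> \<kappa>\<^sub>1 = 1" "mpoly_eval \<beta> \<kappa>\<^sub>1 = 0" "mpoly_eval \<alpha> \<kappa>\<^sub>2 = 0" "mpoly_eval \<beta> \<kappa>\<^sub>2 = 1"
    "\<forall>p. mpoly_eval p L = 0 \<longrightarrow> p = (\<lambda>i. mpoly_eval p \<kappa>\<^sub>1 * \<alpha> i + mpoly_eval p \<kappa>\<^sub>2 * \<beta> i)"
proof -
  obtain l where l: "L = (\<Sum>i\<in>UNIV. mpoly_const (l i) * mvar i)" by (rule linear_form_expand[OF L(1)])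
  obtain k where k: "l k \<noteq> 0" using L(2) l by (metis (no_types, lifting) mpoly_const_0 mult_zero_left sum.neutral)
  have "\<exists>i. i \<noteq> k \<and> \<beta> i \<noteq> 0"
  proof (rule ccontr)
    assume no: "\<nexists>i. i \<noteq> k \<and> \<beta> i \<noteq> 0"
    obtain i j where ij: "i \<noteq> k" "j \<noteq> k" "i \<noteq> j" "UNIV = {k, i, j}" by (rule UNIV_3_other)
    have "mpoly_eval \<beta> L = l k * \<beta> k + l i * \<beta> i + l j * \<beta> j"
      using ij(1-3) by (simp add: l ij(4))
    moreover have "\<beta> i = 0" "\<beta> j = 0" using no ij(1,2) by blast+
    ultimately have "\<beta> k = 0" using \<beta>(1) k by simp
    then have "\<beta> = (\<lambda>_. 0)" using no by (intro ext) metis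
    with \<beta>(2) show False by blast
  qed
  then obtain i where i: "i \<noteq> k" "\<beta> i \<noteq> 0" by blast
  obtain j where j: "j \<noteq> k" "j \<noteq> i" "UNIV = {k, i, j}" by (rule UNIV_3_third[OF i(1)])
  have evL: "mpoly_eval p L = l k * p k + l i * p i + l j * p j" for p
    using i j by (simp add: l j(3))
  define \<alpha> where "\<alpha> = (\<lambda>x. if x = i then 0 else if x = j then 1 else - l j / l k)"
  define \<kappa>\<^sub>2 where "\<kappa>\<^sub>2 = mpoly_const (1 / \<beta> i) * (mvar i :: 3 mpoly)"
  define \<kappa>\<^sub>1 where "\<kappa>\<^sub>1 = mvar j - mpoly_const (\<beta> j / \<beta> i) * (mvar i :: 3 mpoly)"
  show thesis
  proof (rule that[of \<kappa>\<^sub>1 \<kappa>\<^sub>2 \<alpha>])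
    show "\<kappa>\<^sub>1 \<in> forms 1" "\<kappa>\<^sub>2 \<in> forms 1"
      unfolding \<kappa>\<^sub>1_def \<kappa>\<^sub>2_def by (intro forms_diff forms_const_mult forms_mvar)+
    show "mpoly_eval \<alpha> L = 0" "mpoly_eval \<alpha> \<kappa>\<^sub>1 = 1" "mpoly_eval \<beta> \<kappa>\<^sub>1 = 0"
      "mpoly_eval \<alpha> \<kappa>\<^sub>2 = 0" "mpoly_eval \<beta> \<kappa>\<^sub>2 = 1"
      using i j k by (simp_all add: evL \<alpha>_def \<kappa>\<^sub>1_def \<kappa>\<^sub>2_def)
    show "\<forall>p. mpoly_eval p L = 0 \<longrightarrow>
        p = (\<lambda>x. mpoly_eval p \<kappa>\<^sub>1 * \<alpha> x + mpoly_eval p \<kappa>\<^sub>2 * \<beta> x)"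
    proof (intro allI impI ext)
      fix p x assume p: "mpoly_eval p L = 0"
      have solve: "z = (- a - b) / c" if "c * z + a + b = 0" "c \<noteq> 0" for a b c z :: complex
      proof -
        have "z * c = (c * z + a + b) - a - b" by (simp add: algebra_simps)
        then show ?thesis using that by (simp add: nonzero_eq_divide_eq)
      qed
      have pk: "p k = (- (l i * p i) - l j * p j) / l k"
        using p k by (intro solve) (simp_all add: evL)
      have bk: "\<beta> k = (- (l i * \<beta> i) - l j * \<beta> j) / l k"
        using \<beta>(1) k by (intro solve) (simp_all add: evL)
      have "x = k \<or> x = i \<or> x = j" using j(3) by blast
      then show "p x = mpoly_eval p \<kappa>\<^sub>1 * \<alpha> x + mpoly_eval p \<kappa>\<^sub>2 * \<beta> x"
      proof (elim disjE)
        assume x: "x = k"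
        show ?thesis unfolding x pk bk
          using i j k by (simp add: \<alpha>_def \<kappa>\<^sub>1_def \<kappa>\<^sub>2_def) (simp add: field_simps)
      qed (use i j in \<open>simp_all add: \<alpha>_def \<kappa>\<^sub>1_def \<kappa>\<^sub>2_def\<close>)
    qed
  qed
qed

section \<open>Restriction to a line\<close>

definition line_restrict :: "(3 \<Rightarrow> complex) \<Rightarrow> (3 \<Rightarrow> complex) \<Rightarrow> 3 mpoly \<Rightarrow> complex poly" where
  "line_restrict \<alpha> \<beta> F = pol.subst (\<lambda>i. [:\<alpha> i, \<beta> i:]) F"

lemma poly_line_restrict: "poly (line_restrict \<alpha> \<beta> F) t = mpoly_eval (\<lambda>i. \<alpha> i + t * \<beta> i) F"
  unfolding line_restrict_def by (induction F rule: mpoly_induct) (auto simp: algebra_simps)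

lemma line_restrict_simps [simp]:
  "line_restrict \<alpha> \<beta> (F + G) = line_restrict \<alpha> \<beta> F + line_restrict \<alpha> \<beta> G"
  "line_restrict \<alpha> \<beta> (F - G) = line_restrict \<alpha> \<beta> F - line_restrict \<alpha> \<beta> G"
  "line_restrict \<alpha> \<beta> (F * G) = line_restrict \<alpha> \<beta> F * line_restrict \<alpha> \<beta> G"
  "line_restrict \<alpha> \<beta> (F ^ k) = line_restrict \<alpha> \<beta> F ^ k"
  "line_restrict \<alpha> \<beta> (mpoly_const z) = [:z:]"
  "line_restrict \<alpha> \<beta> 0 = 0"
  by (simp_all add: line_restrict_def)

lemma line_restrict_sum [simp]: "line_restrict \<alpha> \<beta> (sum F A) = (\<Sum>x\<in>A. line_restrict \<alpha> \<beta> (F x))"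
  by (simp add: line_restrict_def)

lemma coeff_mult_bounds:
  fixes p q :: "'a::comm_semiring_0 poly"
  assumes "degree p \<le> a" "degree q \<le> b"
  shows "degree (p * q) \<le> a + b \<and> Polynomial.coeff (p * q) (a + b) = Polynomial.coeff p a * Polynomial.coeff q b"
proof
  show "degree (p * q) \<le> a + b" using degree_mult_le[of p q] assms by linarith
  have "Polynomial.coeff (p * q) (a + b) = (\<Sum>i\<in>{a}. Polynomial.coeff p i * Polynomial.coeff q (a + b - i))"
    unfolding coeff_mult
  proof (rule sum.mono_neutral_right)
    show "\<forall>i\<in>{..a + b} - {a}. Polynomial.coeff p i * Polynomial.coeff q (a + b - i) = 0"
    proof
      fix i assume i: "i \<in> {..a + b} - {a}"
      then consider "i > a" | "i < a" by force
      then show "Polynomial.coeff p i * Polynomial.coeff q (a + b - i) = 0"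
      proof cases
        case 1
        then show ?thesis using assms(1) by (simp add: coeff_eq_0)
      next
        case 2
        then have "degree q < a + b - i" using assms(2) by linarith
        then show ?thesis by (simp add: coeff_eq_0)
      qed
    qed
  qed auto
  then show "Polynomial.coeff (p * q) (a + b) = Polynomial.coeff p a * Polynomial.coeff q b" by simp
qed

text \<open>The top coefficient is the value at \<open>\<beta>\<close>, the point at infinity of the
  line. A form nonzero at \<open>\<beta>\<close> therefore keeps its full degree on the
  line.\<close>

lemma line_restrict_form:
  assumes "F \<in> forms m"
  shows "degree (line_restrict \<alpha> \<beta> F) \<le> m \<and> Polynomial.coeff (line_restrict \<alpha> \<beta> F) m = mpoly_eval \<beta> F"
proof -
  have pow: "degree ([:\<alpha> i, \<beta> i:] ^ k) \<le> k \<and> Polynomial.coeff ([:\<alpha> i, \<beta> i:] ^ k) k = \<beta> i ^ k" for i k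
  proof (induction k)
    case (Suc k)
    then show ?case using coeff_mult_bounds[of "[:\<alpha> i, \<beta> i:]" 1 "[:\<alpha> i, \<beta> i:] ^ k" k]
      by (simp add: degree_pCons_le)
  qed simp
  have mon: "degree (monom_eval (\<lambda>i. [:\<alpha> i, \<beta> i:]) n) \<le> mdeg n \<and>
      Polynomial.coeff (monom_eval (\<lambda>i. [:\<alpha> i, \<beta> i:]) n) (mdeg n) = monom_eval \<beta> n" for n
  proof (induction n rule: poly_mapping_single_induct)
    case (add i k n)
    then show ?case
      using pow[where i=i and k=k]
        coeff_mult_bounds[of "[:\<alpha> i, \<beta> i:] ^ k" k "monom_eval (\<lambda>i. [:\<alpha> i, \<beta> i:]) n" "mdeg n"]
      by (simp add: monom_eval_add)
  qed simp
  have eq: "line_restrict \<alpha> \<beta> F =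
      (\<Sum>n\<in>Poly_Mapping.keys F. Polynomial.smult (Poly_Mapping.lookup F n) (monom_eval (\<lambda>i. [:\<alpha> i, \<beta> i:]) n))"
    by (simp add: line_restrict_def pol.subst_def)
  have n: "mdeg n = m" if "n \<in> Poly_Mapping.keys F" for n using assms that by (simp add: forms_iff)
  have "degree (line_restrict \<alpha> \<beta> F) \<le> m"
    unfolding eq using mon n by (intro degree_sum_le) (auto intro: order_trans[OF degree_smult_le])
  moreover have "Polynomial.coeff (line_restrict \<alpha> \<beta> F) m = mpoly_eval \<beta> F"
  proof -
    have "Polynomial.coeff (monom_eval (\<lambda>i. [:\<alpha> i, \<beta> i:]) n) m = monom_eval \<beta> n"
      if "n \<in> Poly_Mapping.keys F" for n
      using mon[of n] n[OF that] by simp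
    then show ?thesis unfolding eq by (simp add: coeff_sum mpoly_eval_conv_subst ev.subst_def)
  qed
  ultimately show ?thesis by blast
qed

text \<open>The point at infinity \<open>\<beta>\<close> of the parametrization \<open>\<alpha> + t \<beta>\<close> is kept off the curve, so that no
  intersection of the curve with the line is lost.\<close>

lemma line_parametrization:
  assumes f: "f \<in> forms d" "0 < d" "prime_elem f" and L: "L \<in> forms 1" "\<not> f dvd L"
  obtains \<alpha> \<beta> \<kappa>\<^sub>1 \<kappa>\<^sub>2 where "mpoly_eval \<beta> f \<noteq> 0" "mpoly_eval \<beta> L = 0" "\<kappa>\<^sub>1 \<in> forms 1" "\<kappa>\<^sub>2 \<in> forms 1"
    "line_restrict \<alpha> \<beta> L = 0" "line_restrict \<alpha> \<beta> \<kappa>\<^sub>1 = 1" "line_restrict \<alpha> \<beta> \<kappa>\<^sub>2 = [:0, 1:]"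
    "degree (line_restrict \<alpha> \<beta> f) = d"
    "\<forall>p. mpoly_eval p L = 0 \<longrightarrow> p = (\<lambda>i. mpoly_eval p \<kappa>\<^sub>1 * \<alpha> i + mpoly_eval p \<kappa>\<^sub>2 * \<beta> i)"
proof -
  have L0: "L \<noteq> 0" using L(2) by auto
  have "\<not> L dvd f"
  proof
    assume "L dvd f"
    then obtain c where c: "f = L * c" by blast
    then have "f dvd L \<or> f dvd c" using f(3) by (metis dvd_refl prime_elem_dvd_mult_iff)
    with L(2) obtain k where "c = f * k" by blast
    then have "f * (L * k) = f * 1" using c by (simp add: algebra_simps)
    then have "L * k = 1" using f(3) by (simp add: prime_elem_def)
    then have "\<exists>i j. i + j = 0 \<and> L \<in> forms i \<and> k \<in> forms j"
      by (intro form_factor) simp_all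
    then show False using forms_degree_unique[OF L(1)] L0 by auto
  qed
  then obtain \<beta> where \<beta>: "mpoly_eval \<beta> L = 0" "mpoly_eval \<beta> f \<noteq> 0"
    using linear_form_dvd[OF L(1) L0] by blast
  have "\<beta> \<noteq> (\<lambda>_. 0)" using \<beta>(2) mpoly_eval_zero_vector[OF f(1,2)] by auto
  then obtain \<alpha> \<kappa>\<^sub>1 \<kappa>\<^sub>2 where *: "\<kappa>\<^sub>1 \<in> forms 1" "\<kappa>\<^sub>2 \<in> forms 1" "mpoly_eval \<alpha> L = 0"
    "mpoly_eval \<alpha> \<kappa>\<^sub>1 = 1" "mpoly_eval \<beta> \<kappa>\<^sub>1 = 0" "mpoly_eval \<alpha> \<kappa>\<^sub>2 = 0" "mpoly_eval \<beta> \<kappa>\<^sub>2 = 1"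
    "\<forall>p. mpoly_eval p L = 0 \<longrightarrow> p = (\<lambda>i. mpoly_eval p \<kappa>\<^sub>1 * \<alpha> i + mpoly_eval p \<kappa>\<^sub>2 * \<beta> i)"
    by (rule linear_form_kernel_basis[OF L(1) L0 \<beta>(1)])
  have lin: "line_restrict \<alpha> \<beta> F = [:mpoly_eval \<alpha> F, mpoly_eval \<beta> F:]" if F: "F \<in> forms 1" for F
  proof -
    obtain l where l: "F = (\<Sum>i\<in>UNIV. mpoly_const (l i) * mvar i)" by (rule linear_form_expand[OF F])
    show ?thesis
      by (simp add: l line_restrict_def sum_3)
  qed
  have "degree (line_restrict \<alpha> \<beta> f) = d"
    using line_restrict_form[OF f(1), of \<alpha> \<beta>] \<beta>(2) le_degree[of "line_restrict \<alpha> \<beta> f" d] by force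
  moreover have "line_restrict \<alpha> \<beta> L = 0" "line_restrict \<alpha> \<beta> \<kappa>\<^sub>1 = 1" "line_restrict \<alpha> \<beta> \<kappa>\<^sub>2 = [:0, 1:]"
    using * \<beta> L(1) by (simp_all add: lin one_pCons)
  ultimately show thesis
    using *(1,2,8) \<beta> that by blast
qed

section \<open>Max Noether's theorem\<close>

text \<open>Divide \<open>A\<close> and \<open>G\<close> by their gcd. A root of the remaining
  factor \<open>A'\<close> of \<open>A\<close> would, by the local identity there, also be a root of
  the denominator \<open>B\<close>.\<close>

lemma poly_dvd_local:
  fixes A G :: "complex poly"
  assumes "A \<noteq> 0" and loc: "\<And>t. poly A t = 0 \<Longrightarrow> \<exists>B C. poly B t \<noteq> 0 \<and> B * G = C * A"
  shows "A dvd G"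
proof -
  let ?h = "gcd A G"
  have h: "?h \<noteq> 0" using assms(1) by simp
  obtain A' G' where AG: "A = ?h * A'" "G = ?h * G'" "coprime A' G'"
    using gcd_coprime_exists[OF h] by (metis mult.commute)
  have "degree A' = 0"
  proof (rule ccontr)
    assume "degree A' \<noteq> 0"
    then obtain t where t: "poly A' t = 0"
      using fundamental_theorem_of_algebra constant_degree[of A'] by metis
    then have "poly A t = 0" by (subst AG(1)) simp
    then obtain B C where BC: "poly B t \<noteq> 0" "B * G = C * A" using loc by blast
    then have "?h * (B * G') = ?h * (C * A')" using AG(1,2) by (metis mult.left_commute)
    then have "B * G' = C * A'" using assms(1) by auto
    then have "A' dvd B * G'" by simp
    then have "A' dvd B" using AG(3) by (simp add: coprime_dvd_mult_left_iff)
    with t BC(1) show False by (auto elim!: dvdE)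
  qed
  then obtain z where z: "A' = [:z:]" by (metis degree_eq_zeroE)
  with AG(1) assms(1) have "z \<noteq> 0" by auto
  then have "G' = A' * Polynomial.smult (1 / z) G'" using z by simp
  then have "A' dvd G'" by (rule dvdI)
  then show ?thesis by (subst AG(1), subst AG(2)) (rule mult_dvd_mono[OF dvd_refl])
qed

text \<open>Components of degree \<open>m\<close> are taken on both sides. The last two clauses
  guard against truncated subtraction in the degrees of the cofactors.\<close>

lemma ideal2_homogeneous:
  assumes "f \<in> forms d" "g \<in> forms e" "G \<in> forms m" "G = a * f + c * g"
  obtains a' c' where "G = a' * f + c' * g" "a' \<in> forms (m - d)" "c' \<in> forms (m - e)"
    "m < d \<Longrightarrow> a' = 0" "m < e \<Longrightarrow> c' = 0"
proof
  let ?a = "if d \<le> m then hc (m - d) a else 0" and ?c = "if e \<le> m then hc (m - e) c else 0"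
  show "G = ?a * f + ?c * g"
    using hc_form[OF assms(3), of m]
    by (simp add: assms(4) hc_add hc_mult_form[OF assms(1)] hc_mult_form[OF assms(2)] split: if_splits)
qed auto

text \<open>On the line, the local conditions say that \<open>f\<close> divides \<open>G\<close> as
  univariate polynomials. The quotient is lifted to a form \<open>Q\<close>, and
  \<open>G - f * Q\<close> vanishes on the line, so \<open>L\<close> divides it.\<close>

lemma Noether_line:
  assumes f: "f \<in> forms d" "0 < d" "prime_elem f" and L: "L \<in> forms 1" "\<not> f dvd L" and G: "G \<in> forms m"
    and loc: "\<And>p. p \<noteq> (\<lambda>_. 0) \<Longrightarrow> mpoly_eval p f = 0 \<Longrightarrow> mpoly_eval p L = 0 \<Longrightarrow>
      \<exists>b a c. mpoly_eval p b \<noteq> 0 \<and> b * G = a * f + c * L"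
  shows "\<exists>a c. G = a * f + c * L"
proof -
  obtain \<alpha> \<beta> \<kappa>\<^sub>1 \<kappa>\<^sub>2 where \<beta>: "mpoly_eval \<beta> f \<noteq> 0" "mpoly_eval \<beta> L = 0" and \<kappa>: "\<kappa>\<^sub>1 \<in> forms 1" "\<kappa>\<^sub>2 \<in> forms 1"
    and restr: "line_restrict \<alpha> \<beta> L = 0" "line_restrict \<alpha> \<beta> \<kappa>\<^sub>1 = 1" "line_restrict \<alpha> \<beta> \<kappa>\<^sub>2 = [:0, 1:]"
      "degree (line_restrict \<alpha> \<beta> f) = d"
    and coord: "\<forall>p. mpoly_eval p L = 0 \<longrightarrow> p = (\<lambda>i. mpoly_eval p \<kappa>\<^sub>1 * \<alpha> i + mpoly_eval p \<kappa>\<^sub>2 * \<beta> i)"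
    by (rule line_parametrization[OF f L])
  let ?r = "line_restrict \<alpha> \<beta>"
  have rf: "?r f \<noteq> 0" using restr(4) f(2) by auto
  have "?r f dvd ?r G"
  proof (rule poly_dvd_local[OF rf])
    fix t assume t: "poly (?r f) t = 0"
    let ?p = "\<lambda>i. \<alpha> i + t * \<beta> i"
    have "mpoly_eval ?p \<kappa>\<^sub>1 = 1" using poly_line_restrict[of \<alpha> \<beta> \<kappa>\<^sub>1 t] restr(2) by simp
    then have "?p \<noteq> (\<lambda>_. 0)" using mpoly_eval_zero_vector[OF \<kappa>(1)] by auto
    moreover have "mpoly_eval ?p f = 0" "mpoly_eval ?p L = 0"
      using t restr(1) poly_line_restrict[of \<alpha> \<beta> L t] by (simp_all add: poly_line_restrict)
    ultimately obtain b a c where b: "mpoly_eval ?p b \<noteq> 0" "b * G = a * f + c * L" using loc by blast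
    from arg_cong[OF b(2), of ?r] have "?r b * ?r G = ?r a * ?r f" using restr(1) by simp
    moreover have "poly (?r b) t \<noteq> 0" using b(1) by (simp add: poly_line_restrict)
    ultimately show "\<exists>B C. poly B t \<noteq> 0 \<and> B * ?r G = C * ?r f" by blast
  qed
  then obtain q where q: "?r G = ?r f * q" by blast
  have "\<exists>Q. ?r Q = q \<and> (f * Q \<in> forms m)"
  proof (cases "q = 0")
    case False
    then have "degree (?r G) = d + degree q" using q rf restr(4) by (simp add: degree_mult_eq)
    then have dm: "d + degree q \<le> m" using line_restrict_form[OF G, of \<alpha> \<beta>] by simp
    \<comment> \<open>The homogenization of \<open>q\<close> to degree \<open>m - d\<close>: on the
      line \<open>\<kappa>\<^sub>2\<close> restricts to the parameter and
      \<open>\<kappa>\<^sub>1\<close> to \<open>1\<close>.\<close>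
    define Q where "Q = (\<Sum>i\<le>m - d. mpoly_const (Polynomial.coeff q i) * (\<kappa>\<^sub>2 ^ i * \<kappa>\<^sub>1 ^ (m - d - i)))"
    have "\<kappa>\<^sub>2 ^ i * \<kappa>\<^sub>1 ^ (m - d - i) \<in> forms (m - d)" if "i \<le> m - d" for i
    proof -
      have "i * 1 + (m - d - i) * 1 = m - d" using that by simp
      then show ?thesis
        using forms_mult[OF forms_power[OF \<kappa>(2), of i] forms_power[OF \<kappa>(1), of "m - d - i"]] by metis
    qed
    then have "Q \<in> forms (m - d)" unfolding Q_def by (intro forms_sum forms_const_mult) auto
    then have "f * Q \<in> forms m" using forms_mult[OF f(1), of Q "m - d"] dm by simp
    moreover have "?r Q = q"
    proof -
    have "?r Q = (\<Sum>i\<le>m - d. Polynomial.smult (Polynomial.coeff q i) ([:0, 1:] ^ i))"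
      by (simp add: Q_def restr)
    also have "\<dots> = (\<Sum>i\<le>m - d. Polynomial.monom (Polynomial.coeff q i) i)"
      by (simp add: monom_altdef)
    also have "\<dots> = q" using dm by (intro poly_as_sum_of_monoms') simp
    finally show ?thesis .
    qed
    ultimately show ?thesis by blast
  qed (auto intro!: exI[of _ 0])
  then obtain Q where Q: "?r Q = q" "f * Q \<in> forms m" by blast
  define H where "H = G - f * Q"
  have H: "H \<in> forms m" unfolding H_def by (intro forms_diff G Q)
  have rH: "?r H = 0" by (simp add: H_def q Q)
  have "L dvd H"
  proof (rule linear_form_dvd[OF L(1)])
    fix p assume "mpoly_eval p L = 0"
    then have p: "p = (\<lambda>i. mpoly_eval p \<kappa>\<^sub>1 * \<alpha> i + mpoly_eval p \<kappa>\<^sub>2 * \<beta> i)" (is "p = (\<lambda>i. ?s * _ + ?t * _)")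
      using coord by blast
    show "mpoly_eval p H = 0"
    \<comment> \<open>In the first case \<open>p\<close> is a multiple of the point at infinity,
      where the value of \<open>H\<close> is the top coefficient of its restriction; otherwise
      \<open>p\<close> is rescaled into the affine part of the line.\<close>
    proof (cases "?s = 0")
      case True
      have "mpoly_eval \<beta> H = 0" using line_restrict_form[OF H, of \<alpha> \<beta>] rH by simp
      then have "mpoly_eval (\<lambda>i. ?t * \<beta> i) H = 0" by (simp add: mpoly_eval_scale[OF H])
      moreover have "p = (\<lambda>i. ?t * \<beta> i)" using p unfolding True by simp
      ultimately show ?thesis by metis
    next
      case False
      have "mpoly_eval (\<lambda>i. \<alpha> i + ?t / ?s * \<beta> i) H = 0"
        using rH poly_line_restrict[of \<alpha> \<beta> H "?t / ?s"] by simp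
      then have "mpoly_eval (\<lambda>i. ?s * (\<alpha> i + ?t / ?s * \<beta> i)) H = 0" by (simp add: mpoly_eval_scale[OF H])
      moreover have "p = (\<lambda>i. ?s * (\<alpha> i + ?t / ?s * \<beta> i))" using p False by (simp add: algebra_simps)
      ultimately show ?thesis by metis
    qed
  qed (use L(2) in auto)
  then obtain c where "H = L * c" by blast
  then have "G = Q * f + c * L" by (simp add: H_def algebra_simps)
  then show ?thesis by blast
qed

text \<open>Membership of \<open>G\<close> in the ideal of \<open>f\<close> and \<open>g\<close> in
  the local ring at each point of the curve \<open>f\<close>; \<open>b\<close> is the cleared
  denominator and may be inhomogeneous.\<close>

definition locally_in_ideal :: "3 mpoly \<Rightarrow> 3 mpoly \<Rightarrow> 3 mpoly \<Rightarrow> bool" where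
  "locally_in_ideal f g G \<longleftrightarrow> (\<forall>p. p \<noteq> (\<lambda>_. 0) \<longrightarrow> mpoly_eval p f = 0 \<longrightarrow>
    (\<exists>b a c. mpoly_eval p b \<noteq> 0 \<and> b * G = a * f + c * g))"

text \<open>One line is split off at a time. In \<open>G = a * f + c * L\<close> the cofactor
  \<open>c\<close> inherits the local condition for the remaining lines, because \<open>f\<close> is
  prime and does not divide \<open>L\<close>.\<close>

lemma Noether_lines:
  assumes f: "f \<in> forms d" "0 < d" "prime_elem f"
    and "\<And>L. L \<in> set Ls \<Longrightarrow> L \<in> forms 1 \<and> \<not> f dvd L"
    and "G \<in> forms m" "locally_in_ideal f (prod_list Ls) G"
  shows "\<exists>a c. G = a * f + c * prod_list Ls"
  using assms(4-)
proof (induction Ls arbitrary: G m)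
  case Nil
  have "G = 0 * f + G * prod_list []" by simp
  then show ?case by blast
next
  case (Cons L Ls)
  have L: "L \<in> forms 1" "\<not> f dvd L" using Cons.prems(1) by auto
  have "\<exists>a c. G = a * f + c * L"
  proof (rule Noether_line[OF f L Cons.prems(2)])
    fix p assume "p \<noteq> (\<lambda>_. 0)" "mpoly_eval p f = 0"
    then obtain b a c where "mpoly_eval p b \<noteq> 0" "b * G = a * f + c * (L * prod_list Ls)"
      using Cons.prems(3) by (auto simp: locally_in_ideal_def)
    moreover from this have "b * G = a * f + (c * prod_list Ls) * L" by (simp add: algebra_simps)
    ultimately show "\<exists>b a c. mpoly_eval p b \<noteq> 0 \<and> b * G = a * f + c * L" by blast
  qed
  then obtain a0 c0 where "G = a0 * f + c0 * L" by blast
  then obtain a c where ac: "G = a * f + c * L" "c \<in> forms (m - 1)"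
    using ideal2_homogeneous[OF f(1) L(1) Cons.prems(2)] by metis
  have "locally_in_ideal f (prod_list Ls) c"
    unfolding locally_in_ideal_def
  proof (intro allI impI)
    fix p assume "p \<noteq> (\<lambda>_. 0)" "mpoly_eval p f = 0"
    then obtain b x y where b: "mpoly_eval p b \<noteq> 0" "b * G = x * f + y * (L * prod_list Ls)"
      using Cons.prems(3) by (auto simp: locally_in_ideal_def)
    have "L * (b * c - y * prod_list Ls) = (x - b * a) * f"
      using b(2) by (simp add: ac(1) algebra_simps)
    then have "f dvd L * (b * c - y * prod_list Ls)" by simp
    then have "f dvd b * c - y * prod_list Ls" using L(2) f(3) by (simp add: prime_elem_dvd_mult_iff)
    then obtain k where "b * c - y * prod_list Ls = f * k" by blast
    then have "b * c = k * f + y * prod_list Ls" by (simp add: algebra_simps)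
    with b(1) show "\<exists>b a ca. mpoly_eval p b \<noteq> 0 \<and> b * c = a * f + ca * prod_list Ls" by blast
  qed
  then obtain x y where "c = x * f + y * prod_list Ls"
    using Cons.IH[OF _ ac(2)] Cons.prems(1) by auto
  then have "G = (a + x * L) * f + y * prod_list (L # Ls)" by (simp add: ac(1) algebra_simps)
  then show ?case by blast
qed

text \<open>The sum is the homogenization of \<open>q\<close> to degree \<open>n\<close> in
  \<open>u\<close> and \<open>v\<close>. A root \<open>r\<close> of \<open>q\<close> contributes the
  factor \<open>u - r * v\<close>, and each missing degree contributes a factor
  \<open>v\<close>.\<close>

lemma binary_form_factor:
  fixes u v :: "3 mpoly" and q :: "complex poly"
  assumes "q \<noteq> 0" "degree q \<le> n"
  shows "\<exists>z ps. z \<noteq> 0 \<and> (\<forall>(x, y)\<in>set ps. x \<noteq> 0 \<or> y \<noteq> 0) \<and>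
    (\<Sum>i\<le>n. mpoly_const (Polynomial.coeff q i) * (u ^ i * v ^ (n - i))) =
      mpoly_const z * prod_list (map (\<lambda>(x, y). mpoly_const x * u + mpoly_const y * v) ps)"
  using assms
proof (induction n arbitrary: q)
  case 0
  then obtain z where "q = [:z:]" "z \<noteq> 0" by (metis degree_eq_zeroE le_zero_eq pCons_eq_0_iff)
  then show ?case by (intro exI[of _ z] exI[of _ "[]"]) simp
next
  case (Suc n)
  define H where "H = (\<lambda>n (q :: complex poly). \<Sum>i\<le>n. mpoly_const (Polynomial.coeff q i) * (u ^ i * v ^ (n - i)))"
  have low: "H (Suc n) q = v * H n q" if "degree q \<le> n" for q
  proof -
    have "Polynomial.coeff q (Suc n) = 0" using that by (simp add: coeff_eq_0)
    then have "H (Suc n) q = (\<Sum>i\<le>n. mpoly_const (Polynomial.coeff q i) * (u ^ i * v ^ (Suc n - i)))"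
      by (simp add: H_def)
    also have "\<dots> = v * H n q"
      unfolding H_def sum_distrib_left by (intro sum.cong) (auto simp: Suc_diff_le algebra_simps)
    finally show ?thesis .
  qed
  have shift: "H (Suc n) (pCons 0 q) = u * H n q" for q
    unfolding H_def sum.atMost_Suc_shift sum_distrib_left by (simp add: algebra_simps)
  have lin: "H k (p - Polynomial.smult r p') = H k p - mpoly_const r * H k p'" for k p r p'
    unfolding H_def by (simp only: coeff_diff coeff_smult mpoly_const_diff mpoly_const_mult
      left_diff_distrib mult.assoc sum_subtractf sum_distrib_left)
  have step: "\<exists>z ps. z \<noteq> 0 \<and> (\<forall>(x, y)\<in>set ps. x \<noteq> 0 \<or> y \<noteq> 0) \<and>
      H (Suc n) q = mpoly_const z * prod_list (map (\<lambda>(x, y). mpoly_const x * u + mpoly_const y * v) ps)"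
    if q': "q' \<noteq> 0" "degree q' \<le> n" "H (Suc n) q = (mpoly_const x0 * u + mpoly_const y0 * v) * H n q'"
      "x0 \<noteq> 0 \<or> y0 \<noteq> 0" for q' x0 y0
  proof -
    obtain z ps where zps: "z \<noteq> 0" "\<forall>(x, y)\<in>set ps. x \<noteq> 0 \<or> y \<noteq> 0"
      "H n q' = mpoly_const z * prod_list (map (\<lambda>(x, y). mpoly_const x * u + mpoly_const y * v) ps)"
      using Suc.IH[OF q'(1,2)] unfolding H_def by blast
    then show ?thesis
      by (intro exI[of _ z] exI[of _ "(x0, y0) # ps"]) (use q'(3,4) zps in \<open>auto simp: algebra_simps\<close>)
  qed
  have "\<exists>q' x0 y0. q' \<noteq> 0 \<and> degree q' \<le> n \<and> H (Suc n) q = (mpoly_const x0 * u + mpoly_const y0 * v) * H n q' \<and>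
      (x0 \<noteq> 0 \<or> y0 \<noteq> 0)"
  proof (cases "degree q \<le> n")
    case True
    then have "H (Suc n) q = (mpoly_const 0 * u + mpoly_const 1 * v) * H n q" using low by simp
    then show ?thesis using True Suc.prems(1) by (metis zero_neq_one)
  next
    case False
    then have deg: "degree q = Suc n" using Suc.prems(2) by simp
    then obtain r where "poly q r = 0"
      using fundamental_theorem_of_algebra constant_degree[of q] by (metis nat.simps(3))
    then obtain q' where q': "q = [:- r, 1:] * q'" by (auto simp: poly_eq_0_iff_dvd)
    have "q' \<noteq> 0" using q' Suc.prems(1) by auto
    moreover have "degree q' = n" using deg q' \<open>q' \<noteq> 0\<close> by (auto simp: degree_mult_eq simp del: mult_pCons_left)
    moreover have "q = pCons 0 q' - Polynomial.smult r q'" by (simp add: q')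
    then have "H (Suc n) q = u * H n q' - mpoly_const r * (v * H n q')"
      using low[of q'] \<open>degree q' = n\<close> by (simp only: lin shift)
    then have "H (Suc n) q = (mpoly_const 1 * u + mpoly_const (- r) * v) * H n q'"
      by (simp add: mpoly_const_uminus algebra_simps)
    ultimately show ?thesis by (metis order_refl zero_neq_one)
  qed
  then show ?case using step unfolding H_def by blast
qed

text \<open>Leading zero coefficients are removed by cancelling \<open>g\<close> modulo the prime
  \<open>f\<close>; the first unmarked coefficient is then in the ideal of \<open>f\<close> and
  \<open>g\<close>. The marker \<open>Z\<close> stands for a coefficient all of whose constants
  vanish, which is more precise than \<open>N c = 0\<close>.\<close>

lemma prime_dvd_power_series:
  fixes f g :: "3 mpoly"
  assumes f: "prime_elem f" "\<not> f dvd g"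
  shows "f dvd (\<Sum>c<n. N c * g ^ c) \<Longrightarrow> \<exists>c<n. \<not> Z c \<Longrightarrow> (\<And>c. Z c \<Longrightarrow> N c = 0) \<Longrightarrow>
    \<exists>c<n. \<not> Z c \<and> (\<exists>R. f dvd N c + g * R)"
proof (induction n arbitrary: N Z)
  case (Suc n)
  have split: "(\<Sum>c<Suc n. N c * g ^ c) = N 0 + g * (\<Sum>c<n. N (Suc c) * g ^ c)"
    by (simp add: sum.lessThan_Suc_shift sum_distrib_left algebra_simps del: sum.lessThan_Suc)
  have dvd: "f dvd N 0 + g * (\<Sum>c<n. N (Suc c) * g ^ c)"
    using Suc.prems(1) unfolding split .
  show ?case
  proof (cases "Z 0")
    case False
    with dvd show ?thesis by (intro exI[of _ 0]) blast
  next
    case True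
    then have "f dvd g * (\<Sum>c<n. N (Suc c) * g ^ c)" using dvd Suc.prems(3)[OF True] by simp
    then have "f dvd (\<Sum>c<n. N (Suc c) * g ^ c)" using f by (simp add: prime_elem_dvd_mult_iff)
    moreover have "\<exists>c<n. \<not> Z (Suc c)" using Suc.prems(2) True by (auto simp: less_Suc_eq_0_disj)
    ultimately have "\<exists>c<n. \<not> Z (Suc c) \<and> (\<exists>R. f dvd N (Suc c) + g * R)"
      by (intro Suc.IH) (auto intro: Suc.prems(3))
    then obtain c where "c < n" "\<not> Z (Suc c)" "\<exists>R. f dvd N (Suc c) + g * R" by blast
    then show ?thesis by (intro exI[of _ "Suc c"]) auto
  qed
qed simp

lemma lookup_form: "f \<in> forms d \<Longrightarrow> mdeg k \<noteq> d \<Longrightarrow> Poly_Mapping.lookup f k = 0"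
  by (auto simp: forms_iff in_keys_iff)

text \<open>Growth rates: the monomials in \<open>u\<close>, \<open>v\<close>, \<open>g\<close> of weighted degree \<open>t\<close> are too many to be linearly
  independent modulo \<open>f\<close>.\<close>

lemma relation_mod_curve:
  fixes u v f g :: "3 mpoly"
  assumes f: "f \<in> forms d" "f \<noteq> 0" and g: "g \<in> forms e" "0 < e"
    and u: "u \<in> forms 1" and v: "v \<in> forms 1"
  obtains z K where
    "f dvd (\<Sum>c<Suc K. (\<Sum>i\<le>e * (K - c). mpoly_const (z c i) * (u ^ i * v ^ (e * (K - c) - i))) * g ^ c)"
    "\<exists>c<Suc K. \<exists>i\<le>e * (K - c). z c i \<noteq> 0"
proof -
  \<comment> \<open>In weighted degree \<open>t = e * K\<close> there are about
    \<open>e * K ^ 2 / 2\<close> monomials in \<open>u\<close>, \<open>v\<close>, \<open>g\<close>,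
    but only about \<open>d * e * K\<close> independent forms modulo \<open>f\<close>. Thus
    \<open>K\<close> must exceed a multiple of \<open>d\<close>, and \<open>4 * d\<close> is
    ample.\<close>
  define K where "K = 4 * d"
  define t where "t = e * K"
  define S where "S = (SIGMA c:{..<Suc K}. {..e * (K - c)})"
  have "d \<le> t"
  proof -
    have "1 * d \<le> (4 * e) * d" using g(2) by (intro mult_right_mono) auto
    then show ?thesis by (simp add: t_def K_def algebra_simps)
  qed
  then obtain s where s: "t = s + d" by (metis add.commute le_iff_add)
  \<comment> \<open>Left summands index the monomials in \<open>u\<close>, \<open>v\<close>,
    \<open>g\<close>, right summands the multiples of \<open>f\<close>; a linear relation among all
    of them is a relation of the former modulo \<open>f\<close>.\<close>
  define M where "M = (\<lambda>x. case x of Inl (c, i) \<Rightarrow> (u ^ i * v ^ (e * (K - c) - i)) * g ^ c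
      | Inr m \<Rightarrow> f * Poly_Mapping.single m 1)"
  have M_forms: "M x \<in> forms t" if "x \<in> S <+> mdegs s" for x
  proof -
    from that consider c i where "x = Inl (c, i)" "(c, i) \<in> S" | m where "x = Inr m" "m \<in> mdegs s" by auto
    then show ?thesis
    proof cases
      case 1
      then have ci: "c \<le> K" "i \<le> e * (K - c)" by (auto simp: S_def)
      have "i * 1 + (e * (K - c) - i) * 1 + c * e = t"
        using ci by (simp add: t_def) (metis add.commute diff_mult_distrib2 le_add_diff_inverse2 mult.commute mult_le_mono2)
      then show ?thesis
        using forms_mult[OF forms_mult[OF forms_power[OF u, of i] forms_power[OF v, of "e * (K - c) - i"]] forms_power[OF g(1), of c]]
        by (simp add: 1 M_def)
    next
      case 2
      then show ?thesis using forms_mult[OF f(1) forms_single[of m s 1]] s by (simp add: M_def mdegs_def add.commute)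
    qed
  qed
  have finS: "finite S" by (simp add: S_def)
  have "2 * card (mdegs t) < 2 * card (S <+> mdegs s)"
  proof -
    have "card S = (\<Sum>c<Suc K. Suc (e * (K - c)))" by (simp add: S_def del: sum.lessThan_Suc)
    also have "\<dots> = (\<Sum>c\<le>K. Suc (e * (K - c)))" by (simp only: lessThan_Suc_atMost)
    also have "\<dots> = (\<Sum>c\<le>K. Suc (e * c))"
      by (rule sum.reindex_bij_witness[of _ "\<lambda>c. K - c" "\<lambda>c. K - c"]) auto
    finally have "card S = (\<Sum>c\<le>K. Suc (e * c))" .
    moreover have "2 * (\<Sum>c\<le>k. Suc (e * c)) = e * (k * (k + 1)) + 2 * (k + 1)" for k
      by (induction k) (simp_all add: algebra_simps)
    ultimately have "2 * card S = e * (K * (K + 1)) + 2 * (K + 1)" by simp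
    moreover have "card (S <+> mdegs s) = card S + card (mdegs s)" using finS by (simp add: card_Plus)
    ultimately have "2 * card (S <+> mdegs s) = e * (K * (K + 1)) + 2 * (K + 1) + (s + 1) * (s + 2)"
      using card_mdegs[of s] by simp
    moreover have "2 * card (mdegs t) = (s + d + 1) * (s + d + 2)" by (simp only: card_mdegs s)
    moreover have "(s + d + 1) * (s + d + 2) \<le> (s + 1) * (s + 2) + d * (2 * (s + d) + 3)"
      by (simp add: algebra_simps)
    moreover have "d * (2 * (s + d) + 3) < e * (K * (K + 1)) + 2 * (K + 1)"
      unfolding s[symmetric] t_def K_def by (simp add: algebra_simps)
    ultimately show ?thesis by linarith
  qed
  then have card: "card (mdegs t) < card (S <+> mdegs s)" by simp
  obtain w where w: "\<exists>x\<in>S <+> mdegs s. w x \<noteq> 0"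
    "\<forall>k\<in>mdegs t. (\<Sum>x\<in>S <+> mdegs s. w x * Poly_Mapping.lookup (M x) k) = 0"
    using homogeneous_system_nontrivial[OF _ _ card, of "\<lambda>x. Poly_Mapping.lookup (M x)"] finS by auto
  have "(\<Sum>x\<in>S <+> mdegs s. mpoly_const (w x) * M x) = 0" (is "?sum = 0")
  proof (rule poly_mapping_eqI)
    fix k
    have sum: "?sum \<in> forms t" using M_forms by (intro forms_sum forms_const_mult)
    have "Poly_Mapping.lookup ?sum k = 0"
    proof (cases "k \<in> mdegs t")
      case True
      have "Poly_Mapping.lookup ?sum k = (\<Sum>x\<in>S <+> mdegs s. w x * Poly_Mapping.lookup (M x) k)"
        by (simp only: lookup_sum lookup_mpoly_const_mult)
      also have "\<dots> = 0" using w(2) True by (rule bspec)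
      finally show ?thesis .
    next
      case False
      then show ?thesis using lookup_form[OF sum] by (simp only: mdegs_def mem_Collect_eq not_False_eq_True)
    qed
    then show "Poly_Mapping.lookup ?sum k = Poly_Mapping.lookup 0 k" by (simp only: lookup_zero)
  qed
  define h where "h = (\<Sum>m\<in>mdegs s. mpoly_const (w (Inr m)) * Poly_Mapping.single m 1)"
  have "(\<Sum>x\<in>S. mpoly_const (w (Inl x)) * M (Inl x)) + f * h = 0"
    using \<open>?sum = 0\<close> finS by (simp add: sum.Plus h_def M_def sum_distrib_left algebra_simps)
  moreover define z where "z = (\<lambda>c i. w (Inl (c, i)))"
  have "(\<Sum>x\<in>S. mpoly_const (w (Inl x)) * M (Inl x)) =
      (\<Sum>c<Suc K. (\<Sum>i\<le>e * (K - c). mpoly_const (z c i) * (u ^ i * v ^ (e * (K - c) - i))) * g ^ c)"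
    unfolding S_def sum_distrib_right
    by (subst sum.Sigma) (auto simp: z_def M_def algebra_simps intro!: sum.cong)
  ultimately have rel: "(\<Sum>c<Suc K. (\<Sum>i\<le>e * (K - c). mpoly_const (z c i) * (u ^ i * v ^ (e * (K - c) - i))) * g ^ c) = f * (- h)"
    by (simp add: eq_neg_iff_add_eq_0 del: sum.lessThan_Suc)
  have "\<exists>c<Suc K. \<exists>i\<le>e * (K - c). z c i \<noteq> 0"
  proof (rule ccontr)
    assume no: "\<not> ?thesis"
    then have "f * (- h) = 0" unfolding rel[symmetric] by (intro sum.neutral) auto
    then have "h = 0" using f(2) by simp
    have "w (Inr m) = 0" if "m \<in> mdegs s" for m
    proof -
      have "Poly_Mapping.lookup h m = w (Inr m)"
        using that by (simp add: h_def lookup_sum lookup_single when_def if_distrib[of "(*) _"] cong: if_cong)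
      with \<open>h = 0\<close> show ?thesis by simp
    qed
    moreover have "w (Inl (c, i)) = 0" if "(c, i) \<in> S" for c i
      using no that by (auto simp: S_def z_def)
    ultimately show False using w(1) by auto
  qed
  with rel show thesis by (intro that[where z=z and K=K]) auto
qed

lemma line_not_multiple:
  assumes f: "f \<in> forms d" "0 < d" "mpoly_eval p f \<noteq> 0" and L: "L \<in> forms 1" "L \<noteq> 0" "mpoly_eval p L = 0"
  shows "\<not> f dvd L"
proof
  assume "f dvd L"
  then obtain k where k: "L = f * k" by blast
  then obtain i j where ij: "i + j = 1" "f \<in> forms i" "k \<in> forms j"
    using form_factor[of f k 1] L by auto
  then have "j = 0" using forms_degree_unique[OF f(1)] f(2,3) by force
  then obtain z where "k = mpoly_const z" using ij(3) forms_0_const by blast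
  with L(2,3) f(3) show False by (simp add: k)
qed

lemma prime_not_dvd_prod_list:
  "prime_elem f \<Longrightarrow> (\<And>L. L \<in> set Ls \<Longrightarrow> \<not> f dvd L) \<Longrightarrow> \<not> f dvd prod_list Ls"
  by (induction Ls) (auto simp: prime_elem_dvd_mult_iff prime_elem_not_unit)

lemma prod_list_forms: "(\<And>L. L \<in> set Ls \<Longrightarrow> L \<in> forms 1) \<Longrightarrow> prod_list Ls \<in> forms (length Ls)"
proof (induction Ls)
  case (Cons L Ls)
  then show ?case using forms_mult[of L 1 "prod_list Ls" "length Ls"] by simp
qed simp

text \<open>The lines pass through a common point off the curve: eliminating \<open>g\<close> leaves a binary form in
  the lines \<open>u\<close>, \<open>v\<close> through that point, which splits into linear factors.\<close>

lemma lines_in_ideal: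
  assumes f: "f \<in> forms d" "0 < d" "prime_elem f" and g: "g \<in> forms e" "\<not> f dvd g"
  obtains Ls a b where "\<And>L. L \<in> set Ls \<Longrightarrow> L \<in> forms 1 \<and> \<not> f dvd L"
    "b * g = prod_list Ls + a * f" "b \<in> forms (length Ls - e)" "e \<le> length Ls" "\<not> f dvd b"
proof -
  have "\<exists>Ls a b. (\<forall>L\<in>set Ls. L \<in> forms 1 \<and> \<not> f dvd L) \<and> b * g = prod_list Ls + a * f"
  proof (cases "e = 0")
    case True
    then have "g dvd 1" using g by (intro nonzero_const_form_unit) auto
    then obtain b where "1 = g * b" by (rule dvdE)
    then show ?thesis by (intro exI[of _ "[]"] exI[of _ 0] exI[of _ b]) (simp add: mult.commute)
  next
    case False
    have f0: "f \<noteq> 0" using f(3) by (simp add: prime_elem_def)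
    obtain p where p: "mpoly_eval p f \<noteq> 0" using mpoly_nonzero_value[OF f0] by blast
    have "p \<noteq> (\<lambda>_. 0)" using p mpoly_eval_zero_vector[OF f(1,2)] by auto
    then obtain l where l: "p l \<noteq> 0" by auto
    obtain i j where ij: "i \<noteq> l" "j \<noteq> l" "i \<noteq> j" "UNIV = {l, i, j}" by (rule UNIV_3_other)
    \<comment> \<open>\<open>u\<close> and \<open>v\<close> span the linear forms vanishing at
      \<open>p\<close>. Since \<open>f\<close> does not vanish at \<open>p\<close>, it divides no
      nonzero combination of them.\<close>
    define u where "u = mpoly_const (p l) * mvar i - mpoly_const (p i) * (mvar l :: 3 mpoly)"
    define v where "v = mpoly_const (p l) * mvar j - mpoly_const (p j) * (mvar l :: 3 mpoly)"
    have uv: "u \<in> forms 1" "v \<in> forms 1"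
      unfolding u_def v_def by (intro forms_diff forms_const_mult forms_mvar)+
    have line: "mpoly_const x * u + mpoly_const y * v \<in> forms 1 \<and> \<not> f dvd mpoly_const x * u + mpoly_const y * v"
      if "x \<noteq> 0 \<or> y \<noteq> 0" for x y
    proof -
      let ?L = "mpoly_const x * u + mpoly_const y * v"
      have "mpoly_pderiv i ?L = mpoly_const (x * p l)" "mpoly_pderiv j ?L = mpoly_const (y * p l)"
        using ij by (simp_all add: u_def v_def mpoly_pderiv_add mpoly_pderiv_diff mpoly_pderiv_mult mpoly_pderiv_mvar mpoly_const_mult)
      then have "?L \<noteq> 0" using that l by (metis mpoly_const_eq_0_iff mpoly_pderiv_0 mult_eq_0_iff)
      moreover have "?L \<in> forms 1" by (intro forms_add forms_const_mult uv)
      moreover have "mpoly_eval p ?L = 0" by (simp add: u_def v_def)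
      ultimately show ?thesis using line_not_multiple[OF f(1,2) p] by blast
    qed
    obtain z K where zK:
      "f dvd (\<Sum>c<Suc K. (\<Sum>i\<le>e * (K - c). mpoly_const (z c i) * (u ^ i * v ^ (e * (K - c) - i))) * g ^ c)"
      "\<exists>c<Suc K. \<exists>i\<le>e * (K - c). z c i \<noteq> 0"
      by (rule relation_mod_curve[OF f(1) f0 g(1) _ uv]) (use False in simp)
    define N where "N = (\<lambda>c. \<Sum>i\<le>e * (K - c). mpoly_const (z c i) * (u ^ i * v ^ (e * (K - c) - i)))"
    define Z where "Z = (\<lambda>c. \<forall>i\<le>e * (K - c). z c i = 0)"
    \<comment> \<open>The lowest nontrivial coefficient of the relation, a binary form in
      \<open>u\<close> and \<open>v\<close>, is the element of the ideal that will split into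
      lines.\<close>
    have "\<exists>c<Suc K. \<not> Z c \<and> (\<exists>R. f dvd N c + g * R)"
    proof (rule prime_dvd_power_series[OF f(3) g(2)])
      show "f dvd (\<Sum>c<Suc K. N c * g ^ c)" using zK(1) unfolding N_def .
      show "\<exists>c<Suc K. \<not> Z c" using zK(2) unfolding Z_def by blast
      show "N c = 0" if "Z c" for c using that by (simp add: N_def Z_def)
    qed
    then obtain c R where c: "\<not> Z c" "f dvd N c + g * R" by blast
    define n where "n = e * (K - c)"
    define q where "q = (\<Sum>i\<le>n. Polynomial.monom (z c i) i)"
    have coeff_q: "Polynomial.coeff q i = z c i" if "i \<le> n" for i
      using that by (simp add: q_def coeff_sum)
    have "degree q \<le> n" unfolding q_def by (intro degree_sum_le) (auto intro: order_trans[OF degree_monom_le])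
    moreover have "q \<noteq> 0" using c(1) coeff_q unfolding Z_def n_def[symmetric] by force
    ultimately obtain z0 ps where ps: "z0 \<noteq> 0" "\<forall>(x, y)\<in>set ps. x \<noteq> 0 \<or> y \<noteq> 0"
      "(\<Sum>i\<le>n. mpoly_const (Polynomial.coeff q i) * (u ^ i * v ^ (n - i))) =
        mpoly_const z0 * prod_list (map (\<lambda>(x, y). mpoly_const x * u + mpoly_const y * v) ps)"
      using binary_form_factor[of q n u v] by blast
    let ?Ls = "map (\<lambda>(x, y). mpoly_const x * u + mpoly_const y * v) ps"
    have N: "N c = mpoly_const z0 * prod_list ?Ls"
      using ps(3) coeff_q by (simp add: N_def n_def[symmetric])
    obtain k where k: "N c + g * R = f * k" using c(2) by blast
    have "mpoly_const (- 1 / z0) * R * g = mpoly_const (- 1 / z0) * (f * k - N c)"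
      by (simp add: k[symmetric] algebra_simps)
    also have "\<dots> = mpoly_const (- 1 / z0) * k * f - mpoly_const (- 1 / z0 * z0) * prod_list ?Ls"
      by (simp add: N mpoly_const_mult algebra_simps)
    also have "\<dots> = prod_list ?Ls + mpoly_const (- 1 / z0) * k * f"
      using ps(1) by (simp add: mpoly_const_uminus)
    finally have "mpoly_const (- 1 / z0) * R * g = prod_list ?Ls + mpoly_const (- 1 / z0) * k * f" .
    moreover have "\<forall>L\<in>set ?Ls. L \<in> forms 1 \<and> \<not> f dvd L" using ps(2) line by auto
    ultimately show ?thesis by blast
  qed
  then obtain Ls a0 b0 where Ls: "\<And>L. L \<in> set Ls \<Longrightarrow> L \<in> forms 1 \<and> \<not> f dvd L"
    and ab0: "b0 * g = prod_list Ls + a0 * f" by blast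
  have prod: "prod_list Ls \<in> forms (length Ls)" "\<not> f dvd prod_list Ls"
    using Ls prod_list_forms[of Ls] prime_not_dvd_prod_list[OF f(3), of Ls] by blast+
  have "prod_list Ls = (- a0) * f + b0 * g" using ab0 by (simp add: algebra_simps)
  then obtain a b where ab: "prod_list Ls = a * f + b * g" "b \<in> forms (length Ls - e)" "length Ls < e \<Longrightarrow> b = 0"
    using ideal2_homogeneous[OF f(1) g(1) prod(1)] by metis
  have "e \<le> length Ls" using ab prod(2) by (cases "length Ls < e") auto
  moreover have "\<not> f dvd b" using ab(1) prod(2) by auto
  moreover have "b * g = prod_list Ls + (- a) * f" using ab(1) by (simp add: algebra_simps)
  ultimately show thesis using Ls ab(2) by (intro that[where Ls = Ls and b = b and a = "- a"])
qed

text \<open>Multiplying by \<open>b\<close> turns the condition for \<open>g\<close> into one for a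
  product of lines. This yields \<open>b * (G - y * g)\<close> divisible by \<open>f\<close>, and
  \<open>f\<close> is prime and does not divide \<open>b\<close>.\<close>

theorem Max_Noether:
  assumes f: "f \<in> forms d" "0 < d" "prime_elem f" and g: "g \<in> forms e" "\<not> f dvd g"
    and G: "G \<in> forms m" "locally_in_ideal f g G"
  shows "\<exists>a c. G = a * f + c * g"
proof -
  obtain Ls a b where Ls: "\<And>L. L \<in> set Ls \<Longrightarrow> L \<in> forms 1 \<and> \<not> f dvd L"
    and ab: "b * g = prod_list Ls + a * f" "b \<in> forms (length Ls - e)" "\<not> f dvd b"
    using lines_in_ideal[OF f g] by metis
  have "locally_in_ideal f (prod_list Ls) (b * G)"
    unfolding locally_in_ideal_def
  proof (intro allI impI)
    fix p assume "p \<noteq> (\<lambda>_. 0)" "mpoly_eval p f = 0"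
    then obtain b' x y where b': "mpoly_eval p b' \<noteq> 0" "b' * G = x * f + y * g"
      using G(2) by (auto simp: locally_in_ideal_def)
    have "b' * (b * G) = b * (b' * G)" by (simp add: algebra_simps)
    also have "\<dots> = b * x * f + y * (b * g)" by (simp only: b'(2)) (simp add: algebra_simps)
    also have "\<dots> = (b * x + y * a) * f + y * prod_list Ls" by (simp add: ab(1) algebra_simps)
    finally show "\<exists>b' x y. mpoly_eval p b' \<noteq> 0 \<and> b' * (b * G) = x * f + y * prod_list Ls"
      using b'(1) by blast
  qed
  then obtain x y where xy: "b * G = x * f + y * prod_list Ls"
    using Noether_lines[OF f Ls forms_mult[OF ab(2) G(1)]] by blast
  have "b * (G - y * g) = (x - y * a) * f"
  proof -
    have "b * (G - y * g) = b * G - y * (b * g)" by (simp add: algebra_simps)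
    also have "\<dots> = (x - y * a) * f" by (simp only: xy ab(1)) (simp add: algebra_simps)
    finally show ?thesis .
  qed
  then have "f dvd b * (G - y * g)" by simp
  then have "f dvd G - y * g" using f(3) ab(3) by (simp add: prime_elem_dvd_mult_iff)
  then obtain k where "G - y * g = f * k" by blast
  then have "G = k * f + y * g" by (simp add: algebra_simps)
  then show ?thesis by blast
qed

text \<open>The parameter \<open>\<tau>\<close> along the line maps these points injectively to
  roots of the restriction of \<open>f\<close>; it is defined at all of them because
  \<open>\<beta>\<close> lies off the curve.\<close>

lemma finite_line_points:
  assumes f: "f \<in> forms d" "0 < d" "prime_elem f" and L: "L \<in> forms 1" "\<not> f dvd L"
  shows "finite {P. mpoly_eval (pt P) f = 0 \<and> mpoly_eval (pt P) L = 0}"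
proof -
  obtain \<alpha> \<beta> \<kappa>\<^sub>1 \<kappa>\<^sub>2 where \<beta>: "mpoly_eval \<beta> f \<noteq> 0" and deg: "degree (line_restrict \<alpha> \<beta> f) = d"
    and coord: "\<forall>p. mpoly_eval p L = 0 \<longrightarrow> p = (\<lambda>i. mpoly_eval p \<kappa>\<^sub>1 * \<alpha> i + mpoly_eval p \<kappa>\<^sub>2 * \<beta> i)"
    by (rule line_parametrization[OF f L])
  let ?S = "{P. mpoly_eval (pt P) f = 0 \<and> mpoly_eval (pt P) L = 0}"
  define \<tau> where "\<tau> = (\<lambda>P. mpoly_eval (pt P) \<kappa>\<^sub>2 / mpoly_eval (pt P) \<kappa>\<^sub>1)"
  have \<tau>: "\<exists>s. s \<noteq> 0 \<and> pt P = (\<lambda>i. s * (\<alpha> i + \<tau> P * \<beta> i))" if P: "P \<in> ?S" for P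
  proof -
    let ?s = "mpoly_eval (pt P) \<kappa>\<^sub>1" and ?t = "mpoly_eval (pt P) \<kappa>\<^sub>2"
    have p: "pt P = (\<lambda>i. ?s * \<alpha> i + ?t * \<beta> i)" using coord P by blast
    have s: "?s \<noteq> 0"
    proof
      assume "?s = 0"
      then have p': "pt P = (\<lambda>i. ?t * \<beta> i)" using p by simp
      then have "mpoly_eval (\<lambda>i. ?t * \<beta> i) f = 0" using P by (metis (mono_tags, lifting) mem_Collect_eq)
      then have "?t = 0" using \<beta> by (simp add: mpoly_eval_scale[OF f(1)])
      with p' pt_nonzero[of P] show False by simp
    qed
    then have "pt P = (\<lambda>i. ?s * (\<alpha> i + \<tau> P * \<beta> i))"
      by (subst p) (simp add: \<tau>_def algebra_simps)
    with s show ?thesis by blast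
  qed
  have "\<tau> ` ?S \<subseteq> {t. poly (line_restrict \<alpha> \<beta> f) t = 0}"
  proof clarify
    fix P assume P: "mpoly_eval (pt P) f = 0" "mpoly_eval (pt P) L = 0"
    then obtain s where s: "s \<noteq> 0" "pt P = (\<lambda>i. s * (\<alpha> i + \<tau> P * \<beta> i))" using \<tau>[of P] by blast
    then show "poly (line_restrict \<alpha> \<beta> f) (\<tau> P) = 0"
      using P(1) by (simp add: poly_line_restrict mpoly_eval_scale[OF f(1)])
  qed
  moreover have "line_restrict \<alpha> \<beta> f \<noteq> 0" using deg f(2) by auto
  ultimately have "finite (\<tau> ` ?S)" using poly_roots_finite finite_subset by blast
  moreover have "inj_on \<tau> ?S"
  proof (rule inj_onI)
    fix P Q assume PQ: "P \<in> ?S" "Q \<in> ?S" "\<tau> P = \<tau> Q"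
    obtain s where s: "s \<noteq> 0" "pt P = (\<lambda>i. s * (\<alpha> i + \<tau> P * \<beta> i))" using \<tau>[OF PQ(1)] by blast
    obtain s' where s': "s' \<noteq> 0" "pt Q = (\<lambda>i. s' * (\<alpha> i + \<tau> P * \<beta> i))"
      using \<tau>[OF PQ(2)] PQ(3) by auto
    have "pt P = (\<lambda>i. (s / s') * pt Q i)"
      unfolding s(2) s'(2) using s'(1) by (intro ext) simp
    then show "P = Q" by (rule pt_eqI)
  qed
  ultimately show ?thesis by (rule finite_imageD)
qed

lemma finite_common_points:
  assumes f: "f \<in> forms d" "0 < d" "prime_elem f" and g: "g \<in> forms e" "\<not> f dvd g"
  shows "finite {P. mpoly_eval (pt P) f = 0 \<and> mpoly_eval (pt P) g = 0}"
proof -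
  obtain Ls a b where Ls: "\<And>L. L \<in> set Ls \<Longrightarrow> L \<in> forms 1 \<and> \<not> f dvd L"
    and ab: "b * g = prod_list Ls + a * f"
    using lines_in_ideal[OF f g] by metis
  have zero: "mpoly_eval p (prod_list Ls) = 0 \<Longrightarrow> \<exists>L\<in>set Ls. mpoly_eval p L = 0" for p
    by (induction Ls) auto
  have "{P. mpoly_eval (pt P) f = 0 \<and> mpoly_eval (pt P) g = 0}
      \<subseteq> (\<Union>L\<in>set Ls. {P. mpoly_eval (pt P) f = 0 \<and> mpoly_eval (pt P) L = 0})"
  proof
    fix P assume P: "P \<in> {P. mpoly_eval (pt P) f = 0 \<and> mpoly_eval (pt P) g = 0}"
    from arg_cong[OF ab, of "mpoly_eval (pt P)"] P have "mpoly_eval (pt P) (prod_list Ls) = 0" by simp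
    from zero[OF this] P show "P \<in> (\<Union>L\<in>set Ls. {P. mpoly_eval (pt P) f = 0 \<and> mpoly_eval (pt P) L = 0})" by auto
  qed
  then show ?thesis
    by (rule finite_subset) (use Ls finite_line_points[OF f] in auto)
qed

section \<open>Orders of vanishing along a smooth curve\<close>

text \<open>Modulo \<open>y i\<close> and \<open>y j\<close> every variable \<open>x\<close> becomes
  \<open>p x / p l\<close> times \<open>mvar l\<close>. Hence \<open>G\<close> becomes a power of
  \<open>mvar l\<close> times its value at \<open>p / p l\<close>, which is zero.\<close>

lemma point_ideal:
  assumes p: "p l \<noteq> 0" and lij: "i \<noteq> l" "j \<noteq> l" "i \<noteq> j" "UNIV = {l, i, j}"
    and G: "G \<in> forms m" "mpoly_eval p G = 0"
  defines "y \<equiv> \<lambda>x. mpoly_const (p l) * mvar x - mpoly_const (p x) * (mvar l :: 3 mpoly)"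
  obtains G1 G2 where "G = G1 * y i + G2 * y j" "G1 \<in> forms (m - 1)" "G2 \<in> forms (m - 1)"
proof -
  have y_forms: "y x \<in> forms 1" for x
    unfolding y_def by (intro forms_diff forms_const_mult forms_mvar)
  define a where "a = (\<lambda>x. mpoly_const (p x / p l) :: 3 mpoly)"
  have red: "\<exists>H1 H2. H - self.subst (\<lambda>x. mvar l * a x) H = H1 * y i + H2 * y j" for H
  proof (induction H rule: mpoly_induct)
    case (const z)
    have "mpoly_const z - self.subst (\<lambda>x. mvar l * a x) (mpoly_const z) = 0 * y i + 0 * y j" by simp
    then show ?case by blast
  next
    case (add H H')
    then obtain H1 H2 H1' H2' where
      "H - self.subst (\<lambda>x. mvar l * a x) H = H1 * y i + H2 * y j"
      "H' - self.subst (\<lambda>x. mvar l * a x) H' = H1' * y i + H2' * y j" by blast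
    then have "H + H' - self.subst (\<lambda>x. mvar l * a x) (H + H') = (H1 + H1') * y i + (H2 + H2') * y j"
      by (simp only: self.subst_add add_diff_add distrib_right) (simp add: algebra_simps)
    then show ?case by blast
  next
    case (mult_var H x)
    then obtain H1 H2 where H: "H - self.subst (\<lambda>x. mvar l * a x) H = H1 * y i + H2 * y j" by blast
    let ?S = "self.subst (\<lambda>x. mvar l * a x) H"
    have var: "mvar x - mvar l * a x = mpoly_const (1 / p l) * y x"
    proof -
      have "mpoly_const (1 / p l) * y x =
          mpoly_const (1 / p l * p l) * mvar x - mpoly_const (1 / p l * p x) * mvar l"
        by (simp only: y_def mpoly_const_mult right_diff_distrib mult.assoc)
      then show ?thesis using p by (simp add: a_def mult.commute)
    qed
    have "x = l \<or> x = i \<or> x = j" using lij(4) by blast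
    moreover have "y l = 0" by (simp add: y_def)
    ultimately obtain K1 K2 where "mvar x - mvar l * a x = K1 * y i + K2 * y j"
      unfolding var by (metis add.right_neutral add_0 mult_zero_left mult_zero_right)
    then have "H * mvar x - self.subst (\<lambda>x. mvar l * a x) (H * mvar x)
        = (H1 * y i + H2 * y j) * mvar x + ?S * (K1 * y i + K2 * y j)"
      by (simp only: H[symmetric] self.subst_mult self.subst_mvar flip: \<open>mvar x - mvar l * a x = K1 * y i + K2 * y j\<close>)
        (simp add: algebra_simps)
    also have "\<dots> = (H1 * mvar x + ?S * K1) * y i + (H2 * mvar x + ?S * K2) * y j"
      by (simp add: algebra_simps)
    finally show ?case by blast
  qed
  have "mpoly_eval (\<lambda>x. p x / p l) G = 0"
    using mpoly_eval_scale[OF G(1), of "1 / p l" p] G(2) by (simp add: mult.commute)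
  moreover have "self.subst (\<lambda>x. mpoly_const (r x) :: 3 mpoly) H = mpoly_const (mpoly_eval r H)" for r and H :: "3 mpoly"
    by (induction H rule: mpoly_induct) (simp_all add: mpoly_const_add mpoly_const_mult)
  ultimately have "self.subst a G = 0" unfolding a_def by simp
  then have "self.subst (\<lambda>x. mvar l * a x) G = 0"
    using self.subst_scale[OF G(1), of "mvar l" a] by simp
  then obtain H1 H2 where "G = H1 * y i + H2 * y j" using red[of G] by auto
  from ideal2_homogeneous[OF y_forms y_forms G(1) this] that show thesis by blast
qed

text \<open>A linear form that generates the maximal ideal of the local ring of the curve at
  \<open>p\<close>, stated for forms and with denominators cleared. As \<open>f\<close> will be
  prime, non-divisibility of \<open>u\<close> lets powers of \<open>u\<close> be cancelled modulo
  \<open>f\<close>.\<close>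

definition local_parameter :: "3 mpoly \<Rightarrow> (3 \<Rightarrow> complex) \<Rightarrow> 3 mpoly \<Rightarrow> bool" where
  "local_parameter f p u \<longleftrightarrow> u \<in> forms 1 \<and> mpoly_eval p u = 0 \<and> \<not> f dvd u \<and>
    (\<forall>m G. G \<in> forms m \<longrightarrow> mpoly_eval p G = 0 \<longrightarrow> (\<exists>b a c. mpoly_eval p b \<noteq> 0 \<and> b * G = a * f + c * u))"

text \<open>With \<open>y i\<close>, \<open>y j\<close> generating the ideal of the point, write
  \<open>f = f1 * y i + f2 * y j\<close>. Smoothness makes one cofactor nonzero at \<open>p\<close>.
  If it is \<open>f2\<close>, then \<open>y j\<close> can be eliminated near \<open>p\<close> modulo
  \<open>f\<close>, and \<open>y i\<close> is a parameter.\<close>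

lemma local_parameter_exists:
  assumes f: "f \<in> forms d" and p: "p \<noteq> (\<lambda>_. 0)" "mpoly_eval p f = 0"
    and smooth: "\<exists>i. mpoly_eval p (mpoly_pderiv i f) \<noteq> 0"
  shows "\<exists>u. local_parameter f p u"
proof -
  obtain l where l: "p l \<noteq> 0" using p(1) by auto
  define y where "y = (\<lambda>x. mpoly_const (p l) * mvar x - mpoly_const (p x) * (mvar l :: 3 mpoly))"
  have y_forms: "y x \<in> forms 1" for x
    unfolding y_def by (intro forms_diff forms_const_mult forms_mvar)
  have ev_y: "mpoly_eval p (y x) = 0" for x by (simp add: y_def)
  have pd_y: "mpoly_pderiv z (y x) = mpoly_const (p l * (if z = x then 1 else 0) - p x * (if z = l then 1 else 0))" for x z
    by (simp add: y_def mpoly_pderiv_diff mpoly_pderiv_mult mpoly_pderiv_mvar mpoly_const_diff)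
  have main: "local_parameter f p (y i)"
    if lij: "i \<noteq> l" "j \<noteq> l" "i \<noteq> j" "UNIV = {l, i, j}"
      and f12: "f = f1 * y i + f2 * y j" "mpoly_eval p f2 \<noteq> 0" for i j f1 f2
    unfolding local_parameter_def
  proof (intro conjI allI impI)
    show "y i \<in> forms 1" "mpoly_eval p (y i) = 0" by (rule y_forms ev_y)+
    \<comment> \<open>If \<open>y i = f * e\<close>, the derivative in direction \<open>j\<close>,
      zero for \<open>y i\<close> but not for \<open>f\<close> at \<open>p\<close>, forces
      \<open>e\<close> to vanish at \<open>p\<close>. Then all derivatives of \<open>y i\<close> at
      \<open>p\<close> vanish, which fails in direction \<open>i\<close>.\<close>
    show "\<not> f dvd y i"
    proof
      assume "f dvd y i"
      then obtain e where e: "y i = f * e" by blast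
      have pd: "mpoly_eval p (mpoly_pderiv z (y i)) = mpoly_eval p (mpoly_pderiv z f) * mpoly_eval p e" for z
        unfolding e mpoly_pderiv_mult using p(2) by simp
      have "mpoly_eval p (mpoly_pderiv j f) = p l * mpoly_eval p f2"
        unfolding f12(1) using lij by (simp add: mpoly_pderiv_add mpoly_pderiv_mult pd_y ev_y)
      then have "mpoly_eval p e = 0" using pd[of j] lij l f12(2) by (simp add: pd_y)
      then show False using pd[of i] lij l by (simp add: pd_y)
    qed
    fix m G assume "G \<in> forms m" "mpoly_eval p G = 0"
    from point_ideal[where l=l and p=p, OF l lij this]
    obtain G1 G2 where G: "G = G1 * y i + G2 * y j" unfolding y_def by blast
    have "f2 * G = G2 * f + (f2 * G1 - G2 * f1) * y i"
      unfolding G f12(1) by (simp add: algebra_simps)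
    with f12(2) show "\<exists>b a c. mpoly_eval p b \<noteq> 0 \<and> b * G = a * f + c * y i" by blast
  qed
  obtain i j where lij: "i \<noteq> l" "j \<noteq> l" "i \<noteq> j" "UNIV = {l, i, j}" by (rule UNIV_3_other)
  from point_ideal[where l=l and p=p, OF l lij f p(2)]
  obtain f1 f2 where f12: "f = f1 * y i + f2 * y j" unfolding y_def by blast
  have "mpoly_eval p f1 \<noteq> 0 \<or> mpoly_eval p f2 \<noteq> 0"
  proof (rule ccontr)
    assume "\<not> ?thesis"
    then have "mpoly_eval p (mpoly_pderiv x f) = 0" for x
      unfolding f12 by (simp add: mpoly_pderiv_add mpoly_pderiv_mult ev_y)
    with smooth show False by blast
  qed
  then show ?thesis
  proof
    assume "mpoly_eval p f1 \<noteq> 0"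
    moreover have "UNIV = {l, j, i}" "f = f2 * y j + f1 * y i" using lij(4) f12 by (auto simp: add.commute)
    ultimately have "local_parameter f p (y j)" using main[of j i f2 f1] lij by blast
    then show ?thesis by blast
  next
    assume "mpoly_eval p f2 \<noteq> 0"
    then have "local_parameter f p (y i)" using main[OF lij f12] by blast
    then show ?thesis by blast
  qed
qed

section \<open>The valuation at a point of a smooth curve\<close>

locale smooth_form =
  fixes f :: "3 mpoly" and d :: nat
  assumes smooth: "smooth_curve d f" and d_pos: "0 < d"
begin

lemma form: "f \<in> forms d" using smooth by (simp add: smooth_curve_iff)
lemma prime: "prime_elem f" by (rule smooth_curve_prime_elem[OF smooth d_pos])
lemma nonzero: "f \<noteq> 0" by (rule smooth_curve_nonzero[OF smooth])

end

locale curve_point = smooth_form +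
  fixes p u :: _
  assumes p: "p \<noteq> (\<lambda>_. 0)" "mpoly_eval p f = 0" and u: "local_parameter f p u"
begin

lemma u_form: "u \<in> forms 1" and u_zero: "mpoly_eval p u = 0" and u_ndvd: "\<not> f dvd u"
  and u_gen: "G \<in> forms m \<Longrightarrow> mpoly_eval p G = 0 \<Longrightarrow> \<exists>b a c. mpoly_eval p b \<noteq> 0 \<and> b * G = a * f + c * u"
  using u unfolding local_parameter_def by blast+

text \<open>The valuation as relations: \<open>b\<close> is a cleared denominator and
  \<open>u\<close> a parameter, and in \<open>ord_eq\<close> the cofactor \<open>c\<close> is also a
  unit at \<open>p\<close>. Multiples of \<open>f\<close>, which have no finite order, satisfy
  \<open>ord_ge j\<close> for every \<open>j\<close>.\<close>

definition ord_ge :: "nat \<Rightarrow> 3 mpoly \<Rightarrow> bool" where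
  "ord_ge j G \<longleftrightarrow> (\<exists>b a c. mpoly_eval p b \<noteq> 0 \<and> b * G = a * f + c * u ^ j)"

definition ord_eq :: "nat \<Rightarrow> 3 mpoly \<Rightarrow> bool" where
  "ord_eq j G \<longleftrightarrow> (\<exists>b a c. mpoly_eval p b \<noteq> 0 \<and> mpoly_eval p c \<noteq> 0 \<and> b * G = a * f + c * u ^ j)"

lemma ord_ge_0: "ord_ge 0 G"
  unfolding ord_ge_def by (rule exI[of _ 1], rule exI[of _ 0], rule exI[of _ G]) simp

lemma ord_eq_imp_ge: "ord_eq j G \<Longrightarrow> i \<le> j \<Longrightarrow> ord_ge i G"
proof -
  assume "ord_eq j G" "i \<le> j"
  then obtain b a c where b: "mpoly_eval p b \<noteq> 0" "b * G = a * f + c * u ^ j"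
    unfolding ord_eq_def by blast
  have "u ^ j = u ^ (j - i) * u ^ i" using \<open>i \<le> j\<close> by (simp flip: power_add)
  then have "b * G = a * f + (c * u ^ (j - i)) * u ^ i" using b(2) by (simp only: mult.assoc)
  with b(1) show "ord_ge i G" unfolding ord_ge_def by blast
qed

text \<open>If \<open>j\<close> exceeded \<open>i\<close>, the power \<open>u ^ i\<close> could be
  cancelled modulo the prime \<open>f\<close>, leaving a unit at \<open>p\<close> equal to a
  multiple of \<open>u\<close>, which vanishes at \<open>p\<close>.\<close>

lemma ord_eq_ge_le:
  assumes "ord_eq i G" "ord_ge j G"
  shows "j \<le> i"
proof (rule ccontr)
  assume "\<not> j \<le> i"
  then have ij: "u ^ j = u ^ i * u ^ (j - i)" "0 < j - i" by (simp_all flip: power_add)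
  obtain b a c where b: "mpoly_eval p b \<noteq> 0" "mpoly_eval p c \<noteq> 0" "b * G = a * f + c * u ^ i"
    using assms(1) unfolding ord_eq_def by blast
  obtain b' a' c' where b': "mpoly_eval p b' \<noteq> 0" "b' * G = a' * f + c' * u ^ j"
    using assms(2) unfolding ord_ge_def by blast
  have "b' * (a * f + c * u ^ i) = b * (a' * f + c' * u ^ j)"
    unfolding b(3)[symmetric] b'(2)[symmetric] by (rule mult.left_commute)
  then have "u ^ i * (b' * c - b * c' * u ^ (j - i)) = f * (b * a' - b' * a)"
    unfolding ij(1) by (simp add: algebra_simps)
  then have "f dvd u ^ i * (b' * c - b * c' * u ^ (j - i))" by simp
  then have "f dvd b' * c - b * c' * u ^ (j - i)"
    using prime u_ndvd by (meson prime_elem_dvd_mult_iff prime_elem_dvd_power)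
  then obtain k where "b' * c - b * c' * u ^ (j - i) = f * k" by blast
  from arg_cong[OF this, of "mpoly_eval p"] show False
    using b(1,2) b'(1) p(2) u_zero ij(2) by (simp add: power_0_left)
qed

lemma ord_eq_unique: "ord_eq i G \<Longrightarrow> ord_eq j G \<Longrightarrow> i = j"
  by (meson le_antisym order_refl ord_eq_ge_le ord_eq_imp_ge)

lemma ord_eq_mult:
  assumes "ord_eq i G" "ord_eq j H"
  shows "ord_eq (i + j) (G * H)"
proof -
  obtain b a c where b: "mpoly_eval p b \<noteq> 0" "mpoly_eval p c \<noteq> 0" "b * G = a * f + c * u ^ i"
    using assms(1) unfolding ord_eq_def by blast
  obtain b' a' c' where b': "mpoly_eval p b' \<noteq> 0" "mpoly_eval p c' \<noteq> 0" "b' * H = a' * f + c' * u ^ j"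
    using assms(2) unfolding ord_eq_def by blast
  have "(b * b') * (G * H) = (b * G) * (b' * H)" by (simp add: algebra_simps)
  also have "\<dots> = (a * f + c * u ^ i) * (a' * f + c' * u ^ j)" by (simp only: b(3) b'(3))
  also have "\<dots> = (a * (a' * f + c' * u ^ j) + c * u ^ i * a') * f + (c * c') * u ^ (i + j)"
    by (simp add: power_add algebra_simps)
  finally show ?thesis
    unfolding ord_eq_def using b(1,2) b'(1,2) by (intro exI[of _ "b * b'"] exI[of _ "a * (a' * f + c' * u ^ j) + c * u ^ i * a'"] exI[of _ "c * c'"]) simp
qed

lemma ord_eq_0_iff: "ord_eq 0 G \<longleftrightarrow> mpoly_eval p G \<noteq> 0"
proof
  assume "ord_eq 0 G"
  then obtain b a c where b: "mpoly_eval p b \<noteq> 0" "mpoly_eval p c \<noteq> 0" "b * G = a * f + c * u ^ 0"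
    unfolding ord_eq_def by blast
  from arg_cong[OF b(3), of "mpoly_eval p"] b(1,2) p(2) show "mpoly_eval p G \<noteq> 0" by auto
next
  assume "mpoly_eval p G \<noteq> 0"
  then show "ord_eq 0 G"
    unfolding ord_eq_def by (intro exI[of _ 1] exI[of _ 0] exI[of _ G]) simp
qed

lemma ord_ge_add:
  assumes "ord_ge j G" "ord_ge j H"
  shows "ord_ge j (x * G + y * H)"
proof -
  obtain b a c where b: "mpoly_eval p b \<noteq> 0" "b * G = a * f + c * u ^ j"
    using assms(1) unfolding ord_ge_def by blast
  obtain b' a' c' where b': "mpoly_eval p b' \<noteq> 0" "b' * H = a' * f + c' * u ^ j"
    using assms(2) unfolding ord_ge_def by blast
  have "(b * b') * (x * G + y * H) = b' * x * (b * G) + b * y * (b' * H)" by (simp add: algebra_simps)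
  also have "\<dots> = b' * x * (a * f + c * u ^ j) + b * y * (a' * f + c' * u ^ j)" by (simp only: b(2) b'(2))
  also have "\<dots> = (b' * x * a + b * y * a') * f + (b' * x * c + b * y * c') * u ^ j" by (simp add: algebra_simps)
  finally show ?thesis
    unfolding ord_ge_def using b(1) b'(1)
    by (intro exI[of _ "b * b'"] exI[of _ "b' * x * a + b * y * a'"] exI[of _ "b' * x * c + b * y * c'"]) simp
qed

lemma ord_ge_curve: "ord_ge j f"
  unfolding ord_ge_def by (rule exI[of _ 1], rule exI[of _ 1], rule exI[of _ 0]) simp

lemma ord_ge_cancel:
  assumes "mpoly_eval p b \<noteq> 0" "ord_ge j (b * G)"
  shows "ord_ge j G"
proof -
  obtain b' a c where b': "mpoly_eval p b' \<noteq> 0" "b' * (b * G) = a * f + c * u ^ j"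
    using assms(2) unfolding ord_ge_def by blast
  then have "(b' * b) * G = a * f + c * u ^ j" by (simp only: mult.assoc)
  then show ?thesis
    unfolding ord_ge_def using assms(1) b'(1) by (intro exI[of _ "b' * b"] exI[of _ a] exI[of _ c]) simp
qed

lemma ord_ge_homogeneous:
  assumes "ord_ge j G" "G \<in> forms m"
  obtains b k a c where "b \<in> forms k" "mpoly_eval p b \<noteq> 0" "b * G = a * f + c * u ^ j" "c \<in> forms (k + m - j)"
proof -
  obtain b a c where b: "mpoly_eval p b \<noteq> 0" "b * G = a * f + c * u ^ j"
    using assms(1) unfolding ord_ge_def by blast
  obtain k where k: "mpoly_eval p (hc k b) \<noteq> 0" using mpoly_eval_hc_nonzero[OF b(1)] by blast
  have uj: "u ^ j \<in> forms j" using forms_power[OF u_form, of j] by simp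
  have "hc (k + m) (b * G) = hc k b * G" by (simp add: hc_mult_form[OF assms(2)])
  then have "hc k b * G = (if d \<le> k + m then hc (k + m - d) a else 0) * f + (if j \<le> k + m then hc (k + m - j) c else 0) * u ^ j"
    unfolding b(2) hc_add hc_mult_form[OF form] hc_mult_form[OF uj] by (simp split: if_splits)
  then obtain a' c' where "hc k b * G = a' * f + c' * u ^ j" "c' \<in> forms (k + m - j)"
    by (rule ideal2_homogeneous[OF form uj forms_mult[OF hc_forms assms(2)]])
  with hc_forms[of k b] k show thesis by (rule that)
qed

text \<open>If the cofactor of \<open>u ^ j\<close> vanishes at \<open>p\<close>, the parameter
  property extracts one more factor \<open>u\<close>; otherwise the order is exactly
  \<open>j\<close>. Homogeneous cofactors are needed because that property speaks of forms.\<close>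

lemma ord_dichotomy:
  assumes "G \<in> forms m"
  shows "(\<exists>i<j. ord_eq i G) \<or> ord_ge j G"
proof (induction j)
  case (Suc j)
  show ?case
  proof (cases "\<exists>i<j. ord_eq i G")
    case False
    then have "ord_ge j G" using Suc by blast
    then obtain b k a c where "b \<in> forms k"
      and b: "mpoly_eval p b \<noteq> 0" "b * G = a * f + c * u ^ j" "c \<in> forms (k + m - j)"
      by (rule ord_ge_homogeneous[OF _ assms])
    show ?thesis
    proof (cases "mpoly_eval p c = 0")
      case True
      then obtain b' a' c' where b': "mpoly_eval p b' \<noteq> 0" "b' * c = a' * f + c' * u"
        using u_gen[OF b(3)] by blast
      have "(b' * b) * G = b' * (a * f + c * u ^ j)" by (simp only: mult.assoc b(2))
      also have "\<dots> = b' * a * f + (b' * c) * u ^ j" by (simp add: algebra_simps)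
      also have "\<dots> = (b' * a + a' * u ^ j) * f + c' * u ^ Suc j"
        unfolding b'(2) by (simp add: algebra_simps)
      finally have "ord_ge (Suc j) G"
        unfolding ord_ge_def using b(1) b'(1)
        by (intro exI[of _ "b' * b"] exI[of _ "b' * a + a' * u ^ j"] exI[of _ c']) simp
      then show ?thesis by blast
    next
      case False
      then have "ord_eq j G" unfolding ord_eq_def using b by blast
      then show ?thesis by blast
    qed
  qed (use less_SucI in blast)
qed (simp add: ord_ge_0)

text \<open>Restricting \<open>b * L = a * f + c * u ^ j\<close> to the line kills the left side,
  and \<open>u\<close> restricts to a multiple of the linear factor of \<open>p\<close>. As
  \<open>a\<close> is a unit at \<open>p\<close>, the whole power divides \<open>f\<close> on the
  line.\<close>

lemma tangency_bound:
  assumes L: "L \<in> forms 1" "L \<noteq> 0" "ord_ge j L"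
    and restr: "line_restrict \<alpha> \<beta> L = 0" and p_eq: "p = (\<lambda>i. s * (\<alpha> i + t * \<beta> i))" "s \<noteq> 0"
  shows "[:- t, 1:] ^ j dvd line_restrict \<alpha> \<beta> f"
proof -
  \<comment> \<open>The cofactors are not homogeneous, so the parametrization is scaled by
    \<open>s\<close> to pass through the vector \<open>p\<close> itself at parameter
    \<open>t\<close>.\<close>
  define r where "r = line_restrict (\<lambda>i. s * \<alpha> i) (\<lambda>i. s * \<beta> i)"
  have poly_r: "poly (r F) x = mpoly_eval (\<lambda>i. s * (\<alpha> i + x * \<beta> i)) F" for F x
    by (simp add: r_def poly_line_restrict algebra_simps)
  have r_form: "r F = Polynomial.smult (s ^ k) (line_restrict \<alpha> \<beta> F)" if "F \<in> forms k" for F k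
  proof -
    have "poly (r F) x = poly (Polynomial.smult (s ^ k) (line_restrict \<alpha> \<beta> F)) x" for x
      unfolding poly_r mpoly_eval_scale[OF that] by (simp add: poly_line_restrict)
    then show ?thesis by (simp add: poly_eq_poly_eq_iff[symmetric] fun_eq_iff)
  qed
  have at_p: "poly (r F) t = mpoly_eval p F" for F unfolding poly_r p_eq(1) ..
  have "[:- t, 1:] ^ j dvd r f"
  \<comment> \<open>For \<open>j \<ge> 2\<close> the gradient of \<open>u ^ j\<close> vanishes at
    \<open>p\<close>, which the argument for \<open>a\<close> uses; for \<open>j \<le> 1\<close> it
    is enough that \<open>f\<close> vanishes at \<open>p\<close>.\<close>
  proof (cases "j \<le> 1")
    case True
    have "[:- t, 1:] dvd r f" using at_p[of f] p(2) by (simp add: poly_eq_0_iff_dvd)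
    moreover have "j = 0 \<or> j = 1" using True by linarith
    ultimately show ?thesis by auto
  next
    case False
    obtain b a c where b: "mpoly_eval p b \<noteq> 0" "b * L = a * f + c * u ^ j"
      using L(3) unfolding ord_ge_def by blast
    have Lp: "mpoly_eval p L = 0" using at_p[of L] by (simp add: r_form[OF L(1)] restr)
    \<comment> \<open>If \<open>a\<close> vanished at \<open>p\<close>, differentiating the identity
      at \<open>p\<close> would make the gradient of \<open>L\<close> zero, hence
      \<open>L = 0\<close>.\<close>
    have ap: "mpoly_eval p a \<noteq> 0"
    proof
      assume a0: "mpoly_eval p a = 0"
      have "mpoly_eval p (mpoly_pderiv x (b * L)) = mpoly_eval p (mpoly_pderiv x (a * f + c * u ^ j))" for x
        unfolding b(2) ..
      then have "mpoly_eval p b * mpoly_eval p (mpoly_pderiv x L) = 0" for x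
        using False a0 Lp p(2) u_zero
        by (simp add: mpoly_pderiv_add mpoly_pderiv_mult mpoly_pderiv_power power_0_left)
      then have pd: "mpoly_eval p (mpoly_pderiv x L) = 0" for x using b(1) by simp
      obtain l where l: "L = (\<Sum>i\<in>UNIV. mpoly_const (l i) * mvar i)" by (rule linear_form_expand[OF L(1)])
      have "mpoly_eval p (mpoly_pderiv x L) = l x" for x
        by (simp add: l mpoly_pderiv_sum mpoly_pderiv_mult mpoly_pderiv_mvar if_distrib[of "mpoly_eval p"] if_distrib[of "(*) _"] cong: if_cong)
      then have "L = 0" using pd l by simp
      with L(2) show False by blast
    qed
    have "r (a * f) = - r (c * u ^ j)"
    proof -
      have "r (b * L) = r (a * f + c * u ^ j)" unfolding b(2) ..
      moreover have "r (b * L) = 0" by (simp add: r_def) (simp add: r_form[OF L(1), unfolded r_def] restr)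
      ultimately show ?thesis by (simp add: r_def eq_neg_iff_add_eq_0)
    qed
    moreover have "[:- t, 1:] dvd r u" using at_p[of u] u_zero by (simp add: poly_eq_0_iff_dvd)
    then have "[:- t, 1:] ^ j dvd r c * r u ^ j" by (intro dvd_mult dvd_power_same)
    ultimately have dvd: "[:- t, 1:] ^ j dvd r a * r f" by (simp add: r_def)
    show ?thesis
    proof (cases "r f = 0")
      case False
      have "r a \<noteq> 0" using at_p[of a] ap by auto
      then have "j \<le> Polynomial.order t (r a) + Polynomial.order t (r f)"
        using dvd False by (simp add: order_divides order_mult)
      moreover have "Polynomial.order t (r a) = 0" using at_p[of a] ap by (simp add: order_0I)
      ultimately show ?thesis by (simp add: order_divides)
    qed simp
  qed
  then show ?thesis using p_eq(2) by (simp add: r_form[OF form] dvd_smult_iff)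
qed

lemma line_point:
  assumes coord: "\<forall>p. mpoly_eval p L = 0 \<longrightarrow> p = (\<lambda>i. mpoly_eval p \<kappa>\<^sub>1 * \<alpha> i + mpoly_eval p \<kappa>\<^sub>2 * \<beta> i)"
    and \<beta>: "mpoly_eval \<beta> f \<noteq> 0" and L: "mpoly_eval p L = 0"
  obtains s t where "s \<noteq> 0" "p = (\<lambda>i. s * (\<alpha> i + t * \<beta> i))"
proof -
  let ?s = "mpoly_eval p \<kappa>\<^sub>1" and ?t = "mpoly_eval p \<kappa>\<^sub>2"
  have p_eq: "p = (\<lambda>i. ?s * \<alpha> i + ?t * \<beta> i)" using coord L by blast
  have s: "?s \<noteq> 0"
  proof
    assume "?s = 0"
    then have p': "p = (\<lambda>i. ?t * \<beta> i)" using p_eq by simp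
    have "mpoly_eval (\<lambda>i. ?t * \<beta> i) f = 0" unfolding p'[symmetric] by (rule p(2))
    then have "?t = 0" using \<beta> by (simp add: mpoly_eval_scale[OF form])
    with p' p(1) show False by simp
  qed
  have "p = (\<lambda>i. ?s * (\<alpha> i + (?t / ?s) * \<beta> i))"
    by (rule trans[OF p_eq]) (use s in \<open>simp add: algebra_simps\<close>)
  with s show thesis by (rule that)
qed

lemma line_ord_exists:
  assumes L: "L \<in> forms 1" "\<not> f dvd L"
  shows "\<exists>j. ord_eq j L"
proof (cases "mpoly_eval p L = 0")
  case True
  obtain \<alpha> \<beta> \<kappa>\<^sub>1 \<kappa>\<^sub>2 where \<beta>: "mpoly_eval \<beta> f \<noteq> 0" and restr: "line_restrict \<alpha> \<beta> L = 0"
    and deg: "degree (line_restrict \<alpha> \<beta> f) = d"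
    and coord: "\<forall>p. mpoly_eval p L = 0 \<longrightarrow> p = (\<lambda>i. mpoly_eval p \<kappa>\<^sub>1 * \<alpha> i + mpoly_eval p \<kappa>\<^sub>2 * \<beta> i)"
    by (rule line_parametrization[OF form d_pos prime L])
  obtain s t where st: "s \<noteq> 0" "p = (\<lambda>i. s * (\<alpha> i + t * \<beta> i))" by (rule line_point[OF coord \<beta> True])
  have "\<not> ord_ge (Suc d) L"
  proof
    assume "ord_ge (Suc d) L"
    then have "[:- t, 1:] ^ Suc d dvd line_restrict \<alpha> \<beta> f"
      by (rule tangency_bound[OF L(1) _ _ restr st(2,1), rotated]) (use L(2) in auto)
    moreover have "line_restrict \<alpha> \<beta> f \<noteq> 0" using deg d_pos by auto
    ultimately have "degree ([:- t, 1:] ^ Suc d) \<le> d" using deg dvd_imp_degree_le by metis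
    then show False by (simp only: degree_linear_power)
  qed
  then show ?thesis using ord_dichotomy[OF L(1)] by blast
qed (use ord_eq_0_iff in blast)

text \<open>Modulo \<open>f\<close> some multiple of \<open>G\<close> is a product of lines. Each
  line has a finite order, bounded by the degree of \<open>f\<close> restricted to it, and the order
  of the product bounds that of \<open>G\<close>.\<close>

lemma ord_exists:
  assumes G: "G \<in> forms m" "\<not> f dvd G"
  shows "\<exists>j. ord_eq j G"
proof -
  obtain Ls a b where Ls: "\<And>L. L \<in> set Ls \<Longrightarrow> L \<in> forms 1 \<and> \<not> f dvd L"
    and ab: "b * G = prod_list Ls + a * f"
    using lines_in_ideal[OF form d_pos prime G] by metis
  have "\<exists>j. ord_eq j (prod_list Ls)" using Ls
  proof (induction Ls)
    case Nil
    have "ord_eq 0 (prod_list [])" by (simp add: ord_eq_0_iff)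
    then show ?case by blast
  next
    case (Cons L Ls)
    then obtain i j where "ord_eq i L" "ord_eq j (prod_list Ls)" using line_ord_exists[of L] by force
    then have "ord_eq (i + j) (prod_list (L # Ls))" using ord_eq_mult by simp
    then show ?case by blast
  qed
  then obtain j where j: "ord_eq j (prod_list Ls)" by blast
  have "\<not> ord_ge (Suc j) G"
  proof
    assume "ord_ge (Suc j) G"
    then have "ord_ge (Suc j) (b * G + (- a) * f)" by (rule ord_ge_add[OF _ ord_ge_curve])
    then have "ord_ge (Suc j) (prod_list Ls)" by (simp add: ab)
    then show False using ord_eq_ge_le[OF j] by fastforce
  qed
  then show ?thesis using ord_dichotomy[OF G(1)] by blast
qed

text \<open>Locally \<open>g\<close> is a unit times \<open>u ^ j\<close> modulo \<open>f\<close>,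
  so \<open>g\<close> and \<open>u ^ j\<close> generate the same ideal. This links orders with the
  hypothesis of Noether's theorem.\<close>

lemma ord_ge_iff_local:
  assumes "ord_eq j g"
  shows "ord_ge j G \<longleftrightarrow> (\<exists>b a c. mpoly_eval p b \<noteq> 0 \<and> b * G = a * f + c * g)"
proof
  obtain b1 a1 c1 where b1: "mpoly_eval p b1 \<noteq> 0" "mpoly_eval p c1 \<noteq> 0" "b1 * g = a1 * f + c1 * u ^ j"
    using assms unfolding ord_eq_def by blast
  assume "ord_ge j G"
  then obtain b2 a2 c2 where b2: "mpoly_eval p b2 \<noteq> 0" "b2 * G = a2 * f + c2 * u ^ j"
    unfolding ord_ge_def by blast
  have "(c1 * b2) * G = c1 * (a2 * f + c2 * u ^ j)" by (simp only: mult.assoc b2(2))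
  also have "\<dots> = (c1 * a2 - c2 * a1) * f + c2 * (a1 * f + c1 * u ^ j)" by (simp add: algebra_simps)
  also have "\<dots> = (c1 * a2 - c2 * a1) * f + (c2 * b1) * g" by (simp only: b1(3)[symmetric] mult.assoc)
  finally show "\<exists>b a c. mpoly_eval p b \<noteq> 0 \<and> b * G = a * f + c * g"
    using b1(2) b2(1) by (intro exI[of _ "c1 * b2"] exI[of _ "c1 * a2 - c2 * a1"] exI[of _ "c2 * b1"]) simp
next
  assume "\<exists>b a c. mpoly_eval p b \<noteq> 0 \<and> b * G = a * f + c * g"
  then obtain b a c where b: "mpoly_eval p b \<noteq> 0" "b * G = a * f + c * g" by blast
  have "ord_ge j (a * f + c * g)" by (rule ord_ge_add[OF ord_ge_curve ord_eq_imp_ge[OF assms order_refl]])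
  then show "ord_ge j G" unfolding b(2)[symmetric] by (rule ord_ge_cancel[OF b(1)])
qed

end

lemma ideal2_homogeneous_terms:
  assumes "f \<in> forms d" "g \<in> forms e" "G \<in> forms m" "G = a * f + c * g"
  obtains a' c' where "G = a' * f + c' * g" "a' * f \<in> forms m" "c' * g \<in> forms m"
proof
  let ?a = "if d \<le> m then hc (m - d) a else 0" and ?c = "if e \<le> m then hc (m - e) c else 0"
  have mult: "hc k x * F \<in> forms m" if "F \<in> forms n" "k + n = m" for k x F n
    using forms_mult[OF hc_forms that(1), of k x] that(2) by simp
  show "G = ?a * f + ?c * g"
    using hc_form[OF assms(3), of m]
    by (simp add: assms(4) hc_add hc_mult_form[OF assms(1)] hc_mult_form[OF assms(2)] split: if_splits)
  show "?a * f \<in> forms m" "?c * g \<in> forms m"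
    using mult[OF assms(1)] mult[OF assms(2)] by auto
qed

section \<open>Intersection numbers as orders of vanishing\<close>

definition loc_param :: "3 mpoly \<Rightarrow> proj_plane \<Rightarrow> 3 mpoly" where
  "loc_param f P = (SOME u. local_parameter f (pt P) u)"

text \<open>The value \<open>0\<close> off the curve keeps all supports on the curve. For a multiple
  of \<open>f\<close> at a point of the curve no \<open>j\<close> fits, and the value is
  unspecified.\<close>

definition curve_ord :: "3 mpoly \<Rightarrow> proj_plane \<Rightarrow> 3 mpoly \<Rightarrow> nat" where
  "curve_ord f P G = (if mpoly_eval (pt P) f = 0
    then (THE j. curve_point.ord_eq f (pt P) (loc_param f P) j G) else 0)"

context curve_point
begin

lemma ord_ge_sum: "(\<And>x. x \<in> A \<Longrightarrow> ord_ge j (g x)) \<Longrightarrow> ord_ge j (\<Sum>x\<in>A. mpoly_const (z x) * g x)"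
proof (induction A rule: infinite_finite_induct)
  case (insert x F)
  then show ?case using ord_ge_add[of j "g x" "\<Sum>x\<in>F. mpoly_const (z x) * g x" "mpoly_const (z x)" 1] by simp
qed (auto simp: ord_ge_def intro: exI[of _ 1] exI[of _ 0])

lemma ord_ge_mult: "ord_ge j G \<Longrightarrow> ord_ge j (x * G)"
  using ord_ge_add[of j G G x 0] by simp

text \<open>The Taylor expansion of \<open>A / B\<close> in the local coordinate \<open>u / X\<close>, with denominators cleared.\<close>

lemma expansion:
  assumes A: "A \<in> forms m" and B: "B \<in> forms m" "mpoly_eval p B \<noteq> 0"
    and X: "X \<in> forms 1" "mpoly_eval p X \<noteq> 0"
  shows "\<exists>c. ord_ge j (A * X ^ j - B * (\<Sum>k<j. mpoly_const (c k) * (u ^ k * X ^ (j - k))))"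
proof (induction j)
  case (Suc j)
  then obtain c where c: "ord_ge j (A * X ^ j - B * (\<Sum>k<j. mpoly_const (c k) * (u ^ k * X ^ (j - k))))"
    (is "ord_ge j ?H") by blast
  have Xk: "X ^ k \<in> forms k" "u ^ k \<in> forms k" for k
    using forms_power[OF X(1), of k] forms_power[OF u_form, of k] by simp_all
  have "u ^ k * X ^ (j - k) \<in> forms j" if "k < j" for k
    using forms_mult[OF Xk(2)[of k] Xk(1)[of "j - k"]] that by simp
  then have H: "?H \<in> forms (m + j)"
    by (intro forms_diff forms_mult A B Xk forms_sum forms_const_mult) auto
  obtain b n a e where b: "b \<in> forms n" "mpoly_eval p b \<noteq> 0" "b * ?H = a * f + e * u ^ j" "e \<in> forms (n + (m + j) - j)"
    by (rule ord_ge_homogeneous[OF c H])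
  \<comment> \<open>The next Taylor coefficient: with this constant the cofactor
    \<open>e - z * b * B\<close> vanishes at \<open>p\<close>, so it yields another factor
    \<open>u\<close>.\<close>
  define z where "z = mpoly_eval p e / (mpoly_eval p b * mpoly_eval p B)"
  define c' where "c' = c(j := z)"
  let ?E = "e - mpoly_const z * (b * B)"
  have "?E \<in> forms (n + m)" using b(4) by (intro forms_diff forms_const_mult forms_mult b(1) B(1)) simp
  moreover have "mpoly_eval p ?E = 0" using b(2) B(2) by (simp add: z_def)
  ultimately obtain b' a' e' where b': "mpoly_eval p b' \<noteq> 0" "b' * ?E = a' * f + e' * u" using u_gen by blast
  have "(\<Sum>k<j. mpoly_const (c' k) * (u ^ k * X ^ (Suc j - k))) =
      (\<Sum>k<j. mpoly_const (c k) * (u ^ k * X ^ (j - k))) * X"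
    unfolding sum_distrib_right
    by (rule sum.cong) (simp_all add: c'_def Suc_diff_le algebra_simps)
  then have sum: "(\<Sum>k<Suc j. mpoly_const (c' k) * (u ^ k * X ^ (Suc j - k))) =
      (\<Sum>k<j. mpoly_const (c k) * (u ^ k * X ^ (j - k))) * X + mpoly_const z * (u ^ j * X)"
    by (simp add: c'_def)
  let ?H' = "A * X ^ Suc j - B * (\<Sum>k<Suc j. mpoly_const (c' k) * (u ^ k * X ^ (Suc j - k)))"
  have H': "?H' = ?H * X - B * mpoly_const z * u ^ j * X"
    unfolding sum by (simp add: algebra_simps)
  have "(b' * b) * ?H' = b' * X * (b * ?H) - b' * b * B * mpoly_const z * u ^ j * X"
    unfolding H' by (simp add: algebra_simps)
  also have "\<dots> = b' * X * (a * f + e * u ^ j) - b' * b * B * mpoly_const z * u ^ j * X"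
    by (simp only: b(3))
  also have "\<dots> = b' * X * a * f + (b' * ?E) * (X * u ^ j)"
    by (simp add: algebra_simps)
  also have "\<dots> = b' * X * a * f + (a' * f + e' * u) * (X * u ^ j)"
    by (simp only: b'(2))
  also have "\<dots> = (b' * X * a + a' * X * u ^ j) * f + (e' * X) * u ^ Suc j"
    by (simp add: algebra_simps)
  finally have "ord_ge (Suc j) ?H'"
    unfolding ord_ge_def using b(2) b'(1)
    by (intro exI[of _ "b' * b"] exI[of _ "b' * X * a + a' * X * u ^ j"] exI[of _ "e' * X"]) simp
  then show ?case by blast
qed (simp add: ord_ge_0)

text \<open>The first nonzero term of the sum determines its order exactly, and that order is below
  \<open>j\<close>.\<close>

lemma expansion_unique:
  assumes X: "mpoly_eval p X \<noteq> 0" and ge: "ord_ge j (\<Sum>k<j. mpoly_const (c k) * (u ^ k * X ^ (j - k)))"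
  shows "\<forall>k<j. c k = 0"
proof (rule ccontr)
  assume "\<not> ?thesis"
  then have ex: "\<exists>k. k < j \<and> c k \<noteq> 0" by blast
  define k0 where "k0 = (LEAST k. k < j \<and> c k \<noteq> 0)"
  have k0: "k0 < j" "c k0 \<noteq> 0" using LeastI_ex[OF ex] by (auto simp: k0_def)
  have min: "c k = 0" if "k < k0" for k
    using not_less_Least[of k "\<lambda>k. k < j \<and> c k \<noteq> 0"] that k0(1) by (auto simp: k0_def)
  let ?g = "\<lambda>k. mpoly_const (c k) * (u ^ k * X ^ (j - k))"
  define R where "R = (\<Sum>k\<in>{k0<..<j}. mpoly_const (c k) * (u ^ (k - Suc k0) * X ^ (j - k)))"
  have split: "{..<j} = {..<k0} \<union> ({k0} \<union> {k0<..<j})" using k0(1) by auto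
  have "(\<Sum>k<j. ?g k) = (\<Sum>k<k0. ?g k) + (?g k0 + (\<Sum>k\<in>{k0<..<j}. ?g k))"
    unfolding split by (subst sum.union_disjoint) (auto simp: sum.union_disjoint)
  also have "(\<Sum>k<k0. ?g k) = 0" using min by (intro sum.neutral) auto
  also have "(\<Sum>k\<in>{k0<..<j}. ?g k) = u ^ Suc k0 * R"
    unfolding R_def sum_distrib_left
  proof (rule sum.cong[OF refl])
    fix k assume "k \<in> {k0<..<j}"
    then have "u ^ k = u ^ Suc k0 * u ^ (k - Suc k0)" by (simp del: power_Suc flip: power_add)
    then show "?g k = u ^ Suc k0 * (mpoly_const (c k) * (u ^ (k - Suc k0) * X ^ (j - k)))"
      by (simp only: mult.left_commute mult.assoc)
  qed
  finally have eq: "1 * (\<Sum>k<j. ?g k) = 0 * f + (mpoly_const (c k0) * X ^ (j - k0) + u * R) * u ^ k0"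
    by (simp add: algebra_simps)
  have "ord_eq k0 (\<Sum>k<j. ?g k)"
    unfolding ord_eq_def
    by (rule exI[of _ 1], rule exI[of _ 0], rule exI[of _ "mpoly_const (c k0) * X ^ (j - k0) + u * R"], intro conjI eq)
      (use k0(2) X u_zero in simp_all)
  from ord_eq_ge_le[OF this ge] k0(1) show False by simp
qed

text \<open>In the local ring of the plane, the ideal of \<open>f\<close> and \<open>g\<close>
  consists of the fractions whose numerator has order at least \<open>j\<close> along
  \<open>f\<close>. Passing to a homogeneous component of \<open>b\<close> that is nonzero at
  \<open>p\<close> makes the new denominators forms.\<close>

lemma Fract_in_local_sum_iff:
  assumes P: "p = pt P" and g: "g \<in> forms e" "ord_eq j g"
  shows "{x + y | x y. x \<in> local_ideal_at P f \<and> y \<in> local_ideal_at P g} =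
    {Fract A B | A B. \<exists>m. A \<in> forms m \<and> B \<in> forms m \<and> mpoly_eval p B \<noteq> 0 \<and> ord_ge j A}" (is "?W = ?W'")
proof (intro Set.set_eqI iffI)
  fix w assume "w \<in> ?W"
  then obtain a b c b' m m' where w: "w = Fract (a * f) b + Fract (c * g) b'"
    "a * f \<in> forms m" "b \<in> forms m" "\<not> vanishes_at b P" "c * g \<in> forms m'" "b' \<in> forms m'" "\<not> vanishes_at b' P"
    unfolding local_ideal_at_def by blast
  then have bb: "mpoly_eval p b \<noteq> 0" "mpoly_eval p b' \<noteq> 0" by (simp_all add: P vanishes_at_iff)
  then have "b \<noteq> 0" "b' \<noteq> 0" by auto
  then have "w = Fract (a * f * b' + c * g * b) (b * b')" using w(1) by simp
  moreover have "a * f * b' + c * g * b \<in> forms (m + m')"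
    using forms_mult[OF w(2,6)] forms_mult[OF w(5,3)] by (intro forms_add) (simp_all add: add.commute)
  moreover have "b * b' \<in> forms (m + m')" using forms_mult[OF w(3,6)] .
  moreover have "ord_ge j ((a * b') * f + (c * b) * g)"
    by (rule ord_ge_add[OF ord_ge_curve ord_eq_imp_ge[OF g(2) order_refl]])
  then have "ord_ge j (a * f * b' + c * g * b)" by (simp add: algebra_simps)
  moreover have "mpoly_eval p (b * b') \<noteq> 0" using bb by simp
  ultimately show "w \<in> ?W'" by blast
next
  fix w assume "w \<in> ?W'"
  then obtain A B m where w: "w = Fract A B" "A \<in> forms m" "B \<in> forms m" "mpoly_eval p B \<noteq> 0" "ord_ge j A" by blast
  then obtain b a c where b: "mpoly_eval p b \<noteq> 0" "b * A = a * f + c * g"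
    using ord_ge_iff_local[OF g(2)] by blast
  obtain k where k: "mpoly_eval p (hc k b) \<noteq> 0" using mpoly_eval_hc_nonzero[OF b(1)] by blast
  have "hc k b * A = hc (k + m) (b * A)" by (simp add: hc_mult_form[OF w(2)])
  also have "\<dots> = (if d \<le> k + m then hc (k + m - d) a else 0) * f + (if e \<le> k + m then hc (k + m - e) c else 0) * g"
    unfolding b(2) hc_add hc_mult_form[OF form] hc_mult_form[OF g(1)] by (simp split: if_splits)
  finally obtain a' c' where ac: "hc k b * A = a' * f + c' * g"
    and af: "a' * f \<in> forms (k + m)" and cg: "c' * g \<in> forms (k + m)"
    by (rule ideal2_homogeneous_terms[OF form g(1) forms_mult[OF hc_forms w(2)]])
  let ?B = "hc k b * B"
  have B: "?B \<in> forms (k + m)" "mpoly_eval p ?B \<noteq> 0" using forms_mult[OF hc_forms w(3)] k w(4) by simp_all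
  then have B0: "?B \<noteq> 0" by (metis mpoly_eval_simps(1))
  have "Fract (a' * f) ?B + Fract (c' * g) ?B = Fract (?B * (a' * f + c' * g)) (?B * ?B)"
    using B0 by (simp add: algebra_simps)
  also have "\<dots> = Fract (hc k b * A) ?B" unfolding ac by (rule mult_fract_cancel[OF B0])
  also have "\<dots> = w" unfolding w(1) by (rule mult_fract_cancel) (use k in auto)
  finally have "w = Fract (a' * f) ?B + Fract (c' * g) ?B" ..
  moreover have "\<not> vanishes_at ?B P" using B vanishes_at_iff[OF B(1)] P by simp
  ultimately show "w \<in> ?W" unfolding local_ideal_at_def using af cg B(1) by blast
qed

lemma sum_Fract_same_denominator:
  "B \<noteq> 0 \<Longrightarrow> (\<Sum>x\<in>S. Fract (g x) B) = Fract (\<Sum>x\<in>S. g x) (B :: 3 mpoly)"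
proof (induction S rule: infinite_finite_induct)
  case (insert x F)
  then have "(\<Sum>x\<in>insert x F. Fract (g x) B) = Fract (B * (g x + sum g F)) (B * B)"
    by (simp add: algebra_simps)
  also have "\<dots> = Fract (\<Sum>x\<in>insert x F. g x) B"
    using insert by (simp add: mult_fract_cancel del: mult_fract)
  finally show ?case .
qed (simp_all add: fract_collapse)

text \<open>The quotient of the local ring has the powers of the local coordinate
  \<open>u / X\<close> below \<open>j\<close> as a basis: Taylor expansion shows that they span,
  uniqueness of the expansion that they are independent.\<close>

lemma intersection_number_eq_ord:
  assumes P: "p = pt P" and g: "g \<in> forms e" "ord_eq j g"
  shows "intersection_number P f g = enat j"
proof -
  define W where "W = {Fract A B | A B. \<exists>m. A \<in> forms m \<and> B \<in> forms m \<and> mpoly_eval p B \<noteq> 0 \<and> ord_ge j A}"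
  have int: "intersection_number P f g = quotient_dim (local_ring_at P) W"
    unfolding intersection_number_def W_def Fract_in_local_sum_iff[OF P g] ..
  have V: "local_ring_at P = {Fract A B | A B. \<exists>m. A \<in> forms m \<and> B \<in> forms m \<and> mpoly_eval p B \<noteq> 0}"
    unfolding local_ring_at_def P by (intro Collect_cong iff_exI conj_cong refl) (simp add: vanishes_at_iff)
  have W_add: "x + y \<in> W" if xy: "x \<in> W" "y \<in> W" for x y
  proof -
    obtain A B m A' B' m' where x: "x = Fract A B" "A \<in> forms m" "B \<in> forms m" "mpoly_eval p B \<noteq> 0" "ord_ge j A"
      and y: "y = Fract A' B'" "A' \<in> forms m'" "B' \<in> forms m'" "mpoly_eval p B' \<noteq> 0" "ord_ge j A'"
      using xy unfolding W_def by blast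
    have "B \<noteq> 0" "B' \<noteq> 0" using x(4) y(4) by auto
    then have "x + y = Fract (B' * A + B * A') (B * B')" by (simp add: x(1) y(1) mult.commute)
    moreover have "B' * A + B * A' \<in> forms (m + m')"
      using forms_mult[OF y(3) x(2)] forms_mult[OF x(3) y(2)] by (intro forms_add) (simp_all add: add.commute)
    moreover have "B * B' \<in> forms (m + m')" by (rule forms_mult[OF x(3) y(3)])
    moreover have "ord_ge j (B' * A + B * A')" by (rule ord_ge_add[OF x(5) y(5)])
    moreover have "mpoly_eval p (B * B') \<noteq> 0" using x(4) y(4) by simp
    ultimately show ?thesis unfolding W_def by blast
  qed
  have W_scale: "Fract (mpoly_const z) 1 * x \<in> W" if xW: "x \<in> W" for x z
  proof -
    obtain A B m where x: "x = Fract A B" "A \<in> forms m" "B \<in> forms m" "mpoly_eval p B \<noteq> 0" "ord_ge j A"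
      using xW unfolding W_def by blast
    have "Fract (mpoly_const z) 1 * x = Fract (mpoly_const z * A) B" by (simp add: x(1))
    then show ?thesis unfolding W_def using x forms_const_mult[OF x(2), of z] ord_ge_mult[OF x(5)] by blast
  qed
  have W_0: "0 \<in> W"
  proof -
    have "ord_ge j 0" using ord_ge_mult[OF ord_ge_curve[of j], of 0] by simp
    moreover have "0 = Fract (0 :: 3 mpoly) 1" by (simp add: fract_expand)
    moreover have "mpoly_eval p 1 \<noteq> 0" by simp
    ultimately show ?thesis unfolding W_def using forms_0 forms_1 by blast
  qed
  have W_sum: "(\<Sum>x\<in>S. Fract (mpoly_const (z x)) 1 * h x) \<in> W" if "\<And>x. x \<in> S \<Longrightarrow> h x \<in> W"
    for S :: "'s set" and z h
    using that by (induction S rule: infinite_finite_induct) (auto intro: W_0 W_add W_scale)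
  obtain l where l: "p l \<noteq> 0" using p(1) by auto
  \<comment> \<open>A linear form nonzero at \<open>p\<close>, dividing \<open>u\<close> to give a
    rational function of degree zero.\<close>
  define X where "X = (mvar l :: 3 mpoly)"
  have X: "X \<in> forms 1" "mpoly_eval p X \<noteq> 0" unfolding X_def by (rule forms_mvar, simp add: l)
  then have X0: "X \<noteq> 0" by auto
  have Xk: "X ^ k \<in> forms k" "u ^ k \<in> forms k" "mpoly_eval p (X ^ k) \<noteq> 0" "X ^ k \<noteq> 0" for k
    using forms_power[OF X(1), of k] forms_power[OF u_form, of k] X X0 by simp_all
  define \<tau> where "\<tau> = (\<lambda>k. Fract (u ^ k) (X ^ k))"
  have uX: "u ^ k * X ^ (j - k) \<in> forms j" if "k < j" for k
    using forms_mult[OF Xk(2)[of k] Xk(1)[of "j - k"]] that by simp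
  have \<tau>_eq: "\<tau> k = Fract (u ^ k * X ^ (j - k)) (X ^ j)" if "k < j" for k
  proof -
    have "X ^ j = X ^ (j - k) * X ^ k" using that by (simp flip: power_add)
    moreover have "Fract (u ^ k) (X ^ k) = Fract (X ^ (j - k) * u ^ k) (X ^ (j - k) * X ^ k)"
      by (rule mult_fract_cancel[OF Xk(4), symmetric])
    ultimately show ?thesis unfolding \<tau>_def by (simp only: mult.commute[of "u ^ k"])
  qed
  have \<tau>_sum: "(\<Sum>k<j. Fract (mpoly_const (c k)) 1 * \<tau> k) =
      Fract (\<Sum>k<j. mpoly_const (c k) * (u ^ k * X ^ (j - k))) (X ^ j)" for c
  proof -
    have "(\<Sum>k<j. Fract (mpoly_const (c k)) 1 * \<tau> k) = (\<Sum>k<j. Fract (mpoly_const (c k) * (u ^ k * X ^ (j - k))) (X ^ j))"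
      by (rule sum.cong) (simp_all add: \<tau>_eq)
    then show ?thesis by (simp only: sum_Fract_same_denominator[OF Xk(4)])
  qed
  have sum_forms: "(\<Sum>k<j. mpoly_const (c k) * (u ^ k * X ^ (j - k))) \<in> forms j" for c
    using uX by (intro forms_sum forms_const_mult) auto
  have W_iff: "ord_ge j A" if A: "Fract A B \<in> W" "mpoly_eval p B \<noteq> 0" for A B
  proof -
    obtain A' B' where A': "Fract A B = Fract A' B'" "mpoly_eval p B' \<noteq> 0" "ord_ge j A'"
      using A(1) unfolding W_def by blast
    have "B \<noteq> 0" "B' \<noteq> 0" using A(2) A'(2) by auto
    then have "B' * A = B * A'" using A'(1) by (simp add: eq_fract mult.commute)
    then have "ord_ge j (B' * A)" using ord_ge_mult[OF A'(3), of B] by simp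
    then show ?thesis by (rule ord_ge_cancel[OF A'(2)])
  qed
  have expand: "\<exists>c. x - (\<Sum>k<j. Fract (mpoly_const (c k)) 1 * \<tau> k) \<in> W" if x: "x \<in> local_ring_at P" for x
  proof -
    obtain A B m where AB: "x = Fract A B" "A \<in> forms m" "B \<in> forms m" "mpoly_eval p B \<noteq> 0"
      using x unfolding V by blast
    obtain c where c: "ord_ge j (A * X ^ j - B * (\<Sum>k<j. mpoly_const (c k) * (u ^ k * X ^ (j - k))))"
      using expansion[OF AB(2,3,4) X(1,2)] by blast
    have "B \<noteq> 0" using AB(4) by auto
    then have "x - (\<Sum>k<j. Fract (mpoly_const (c k)) 1 * \<tau> k) =
        Fract (A * X ^ j - (\<Sum>k<j. mpoly_const (c k) * (u ^ k * X ^ (j - k))) * B) (B * X ^ j)"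
      unfolding \<tau>_sum AB(1) using Xk(4)[of j] by (simp only: diff_fract not_False_eq_True)
    also have "\<dots> \<in> W"
    proof -
      have "A * X ^ j - (\<Sum>k<j. mpoly_const (c k) * (u ^ k * X ^ (j - k))) * B \<in> forms (m + j)"
        using forms_mult[OF AB(2) Xk(1)[of j]] forms_mult[OF sum_forms AB(3)] by (intro forms_diff) (simp_all add: add.commute)
      moreover have "B * X ^ j \<in> forms (m + j)" by (rule forms_mult[OF AB(3) Xk(1)])
      moreover have "mpoly_eval p (B * X ^ j) \<noteq> 0" using AB(4) X(2) by simp
      moreover have "ord_ge j (A * X ^ j - (\<Sum>k<j. mpoly_const (c k) * (u ^ k * X ^ (j - k))) * B)"
        using c by (simp only: mult.commute)
      ultimately show ?thesis unfolding W_def by blast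
    qed
    finally show ?thesis by blast
  qed
  \<comment> \<open>More than \<open>j\<close> elements have linearly dependent vectors of Taylor
    coefficients, and the corresponding combination of the elements lies in
    \<open>W\<close>.\<close>
  have upper: "card S \<le> j"
    if S: "finite S" "S \<subseteq> local_ring_at P"
      "\<forall>c. (\<Sum>b\<in>S. Fract (mpoly_const (c b)) 1 * b) \<in> W \<longrightarrow> (\<forall>b\<in>S. c b = 0)" for S
  proof (rule ccontr)
    assume "\<not> card S \<le> j"
    then have card: "card {..<j} < card S" by simp
    have "\<forall>b\<in>S. \<exists>c. b - (\<Sum>k<j. Fract (mpoly_const (c k)) 1 * \<tau> k) \<in> W"
      using expand S(2) by blast
    then obtain c where c: "\<And>b. b \<in> S \<Longrightarrow> b - (\<Sum>k<j. Fract (mpoly_const (c b k)) 1 * \<tau> k) \<in> W"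
      using bchoice[of S "\<lambda>b c. b - (\<Sum>k<j. Fract (mpoly_const (c k)) 1 * \<tau> k) \<in> W"] by blast
    obtain z where z: "\<exists>b\<in>S. z b \<noteq> 0" "\<forall>k\<in>{..<j}. (\<Sum>b\<in>S. z b * c b k) = 0"
      using homogeneous_system_nontrivial[OF _ S(1) card] by blast
    have "(\<Sum>b\<in>S. Fract (mpoly_const (z b)) 1 * (\<Sum>k<j. Fract (mpoly_const (c b k)) 1 * \<tau> k)) = 0"
    proof -
      have summand: "Fract (mpoly_const (z b)) 1 * (\<Sum>k<j. Fract (mpoly_const (c b k)) 1 * \<tau> k) =
          Fract (\<Sum>k<j. mpoly_const (z b * c b k) * (u ^ k * X ^ (j - k))) (X ^ j)" for b
        unfolding \<tau>_sum mult_fract by (simp only: sum_distrib_left mpoly_const_mult mult.assoc mult_1_left)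
      have "(\<Sum>b\<in>S. \<Sum>k<j. mpoly_const (z b * c b k) * (u ^ k * X ^ (j - k))) =
          (\<Sum>k<j. mpoly_const (\<Sum>b\<in>S. z b * c b k) * (u ^ k * X ^ (j - k)))"
        unfolding mpoly_const_sum sum_distrib_right by (rule sum.swap)
      also have "\<dots> = 0" using z(2) by (intro sum.neutral) simp
      finally show ?thesis
        unfolding summand sum_Fract_same_denominator[OF Xk(4)] by (simp add: fract_collapse)
    qed
    moreover have "(\<Sum>b\<in>S. Fract (mpoly_const (z b)) 1 * (b - (\<Sum>k<j. Fract (mpoly_const (c b k)) 1 * \<tau> k))) \<in> W"
      using c by (rule W_sum)
    ultimately have "(\<Sum>b\<in>S. Fract (mpoly_const (z b)) 1 * b) \<in> W"
      by (simp only: right_diff_distrib sum_subtractf diff_zero)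
    with S(3) z(1) show False by blast
  qed
  have \<tau>_indep: "\<forall>k<j. c k = 0" if "(\<Sum>k<j. Fract (mpoly_const (c k)) 1 * \<tau> k) \<in> W" for c
    using W_iff[OF that[unfolded \<tau>_sum] Xk(3)] expansion_unique[OF X(2)] by blast
  have inj: "inj_on \<tau> {..<j}"
  proof (rule inj_onI, rule ccontr)
    fix k k' assume k: "k \<in> {..<j}" "k' \<in> {..<j}" "\<tau> k = \<tau> k'" "k \<noteq> k'"
    define c :: "nat \<Rightarrow> complex" where "c = (\<lambda>i. if i = k then 1 else if i = k' then - 1 else 0)"
    have "(\<Sum>i<j. Fract (mpoly_const (c i)) 1 * \<tau> i) = (\<Sum>i\<in>{k, k'}. Fract (mpoly_const (c i)) 1 * \<tau> i)"
      using k by (intro sum.mono_neutral_right) (auto simp: c_def fract_collapse)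
    also have "\<dots> = \<tau> k + Fract (mpoly_const (- 1)) 1 * \<tau> k'"
      using k(4) by (simp add: c_def fract_collapse)
    also have "\<dots> = 0"
    proof -
      have "Fract (mpoly_const (- 1)) 1 = - (1 :: 3 mpoly fract)"
        by (simp add: mpoly_const_uminus fract_expand)
      then show ?thesis using k(3) by simp
    qed
    finally have "\<forall>i<j. c i = 0" using W_0 by (intro \<tau>_indep) simp
    then show False using k(1) by (auto simp: c_def)
  qed
  let ?S = "{S. finite S \<and> S \<subseteq> local_ring_at P \<and>
        (\<forall>c. (\<Sum>b\<in>S. Fract (mpoly_const (c b)) 1 * b) \<in> W \<longrightarrow> (\<forall>b\<in>S. c b = 0))}"
  have "\<tau> ` {..<j} \<in> ?S"
  proof (intro CollectI conjI allI impI)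
    show "finite (\<tau> ` {..<j})" by simp
    show "\<tau> ` {..<j} \<subseteq> local_ring_at P" unfolding V \<tau>_def using Xk by blast
    fix c assume "(\<Sum>b\<in>\<tau> ` {..<j}. Fract (mpoly_const (c b)) 1 * b) \<in> W"
    then have "(\<Sum>k<j. Fract (mpoly_const (c (\<tau> k))) 1 * \<tau> k) \<in> W" by (simp add: sum.reindex[OF inj])
    then have "\<forall>k<j. c (\<tau> k) = 0" by (rule \<tau>_indep)
    then show "\<forall>b\<in>\<tau> ` {..<j}. c b = 0" by auto
  qed
  moreover have "enat (card (\<tau> ` {..<j})) = enat j" by (simp add: card_image[OF inj])
  ultimately have "enat j \<le> (SUP S\<in>?S. enat (card S))" by (metis (no_types, lifting) SUP_upper)
  moreover have "(SUP S\<in>?S. enat (card S)) \<le> enat j" using upper by (intro SUP_least) auto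
  ultimately show ?thesis unfolding int quotient_dim_def by (rule antisym[rotated])
qed

end

text \<open>Off the curve \<open>f\<close> is a unit, so its ideal is the whole local ring and only
  the empty set is independent modulo it.\<close>

lemma intersection_number_off_curve:
  assumes f: "f \<in> forms d" "mpoly_eval (pt P) f \<noteq> 0"
  shows "intersection_number P f g = 0"
proof -
  let ?W = "{x + y |x y. x \<in> local_ideal_at P f \<and> y \<in> local_ideal_at P g}"
  have f0: "f \<noteq> 0" using f(2) by auto
  have sub: "local_ring_at P \<subseteq> ?W"
  proof
    fix x assume "x \<in> local_ring_at P"
    then obtain A B m where x: "x = Fract A B" "A \<in> forms m" "B \<in> forms m" "\<not> vanishes_at B P"
      unfolding local_ring_at_def by blast
    have "x = Fract (A * f) (B * f)" using f0 mult_fract_cancel[of f A B] by (simp add: x(1) mult.commute)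
    moreover have "A * f \<in> forms (m + d)" and B: "B * f \<in> forms (m + d)" using x f(1) by (auto intro: forms_mult)
    moreover have "\<not> vanishes_at (B * f) P" using x(4) f(2) vanishes_at_iff[OF x(3)] vanishes_at_iff[OF B] by simp
    ultimately have "x \<in> local_ideal_at P f" unfolding local_ideal_at_def by blast
    moreover have "(0 :: 3 mpoly fract) \<in> local_ideal_at P g"
    proof -
      have "(0 :: 3 mpoly fract) = Fract (0 * g) 1" by (simp add: fract_expand)
      moreover have "0 * g \<in> forms 0" by simp
      moreover have "\<not> vanishes_at 1 P" by (simp add: vanishes_at_iff[OF forms_1])
      ultimately show ?thesis unfolding local_ideal_at_def using forms_1 by blast
    qed
    moreover have "x = x + 0" by simp
    ultimately show "x \<in> ?W" by blast
  qed
  have "S = {}" if S: "S \<subseteq> local_ring_at P" "finite S"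
    "\<forall>c. (\<Sum>b\<in>S. Fract (mpoly_const (c b)) 1 * b) \<in> ?W \<longrightarrow> (\<forall>b\<in>S. c b = 0)" for S
  proof (rule ccontr)
    assume "S \<noteq> {}"
    then obtain b where b: "b \<in> S" by blast
    have "(\<Sum>x\<in>S. Fract (mpoly_const (if x = b then 1 else 0)) 1 * x) =
        (\<Sum>x\<in>{b}. Fract (mpoly_const (if x = b then 1 else 0)) 1 * x)"
      using S(2) b by (intro sum.mono_neutral_right) (auto simp: fract_collapse)
    also have "\<dots> = b" by (simp add: fract_collapse)
    also have "b \<in> ?W" using b S(1) sub by blast
    finally have "\<forall>x\<in>S. (if x = b then 1 else (0 :: complex)) = 0"
      by (rule mp[OF spec[OF S(3), of "\<lambda>x. if x = b then 1 else 0"]])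
    with b show False by auto
  qed
  then have "quotient_dim (local_ring_at P) ?W \<le> 0"
    unfolding quotient_dim_def by (intro SUP_least) (auto simp: zero_enat_def)
  then show ?thesis by (simp add: intersection_number_def)
qed

section \<open>Orders at all points of the curve and Bezout's theorem\<close>

context smooth_form
begin

lemma curve_point_at: "mpoly_eval (pt P) f = 0 \<Longrightarrow> curve_point f d (pt P) (loc_param f P)"
proof -
  assume P: "mpoly_eval (pt P) f = 0"
  then have "\<exists>i. mpoly_eval (pt P) (mpoly_pderiv i f) \<noteq> 0"
    using smooth pt_nonzero[of P] unfolding smooth_curve_iff by blast
  then have "\<exists>u. local_parameter f (pt P) u"
    by (rule local_parameter_exists[OF form pt_nonzero P])
  then have "local_parameter f (pt P) (loc_param f P)"
    unfolding loc_param_def by (rule someI_ex)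
  then show ?thesis
    using P pt_nonzero by unfold_locales
qed

abbreviation "v \<equiv> curve_ord f"
abbreviation "ord_eq_at P \<equiv> curve_point.ord_eq f (pt P) (loc_param f P)"
abbreviation "ord_ge_at P \<equiv> curve_point.ord_ge f (pt P) (loc_param f P)"

lemma v_eqI: "mpoly_eval (pt P) f = 0 \<Longrightarrow> ord_eq_at P j G \<Longrightarrow> v P G = j"
  unfolding curve_ord_def using curve_point.ord_eq_unique[OF curve_point_at] by (auto intro!: the_equality)

lemma ord_eq_v:
  assumes "mpoly_eval (pt P) f = 0" "G \<in> forms m" "\<not> f dvd G"
  shows "ord_eq_at P (v P G) G"
proof -
  obtain j where "ord_eq_at P j G" using curve_point.ord_exists[OF curve_point_at[OF assms(1)] assms(2,3)] by blast
  then show ?thesis using v_eqI[OF assms(1)] by simp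
qed

lemma v_off_curve: "mpoly_eval (pt P) f \<noteq> 0 \<Longrightarrow> v P G = 0"
  by (simp add: curve_ord_def)

lemma v_on_curve: "v P G \<noteq> 0 \<Longrightarrow> mpoly_eval (pt P) f = 0"
  by (rule ccontr) (simp add: v_off_curve)

lemma not_dvd_mult: "\<not> f dvd G \<Longrightarrow> \<not> f dvd H \<Longrightarrow> \<not> f dvd G * H"
  using prime by (simp add: prime_elem_dvd_mult_iff)

lemma v_mult:
  assumes "G \<in> forms m" "\<not> f dvd G" "H \<in> forms n" "\<not> f dvd H"
  shows "v P (G * H) = v P G + v P H"
proof (cases "mpoly_eval (pt P) f = 0")
  case True
  show ?thesis
    by (rule v_eqI[OF True curve_point.ord_eq_mult[OF curve_point_at[OF True] ord_eq_v[OF True assms(1,2)] ord_eq_v[OF True assms(3,4)]]])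
qed (simp add: v_off_curve)

lemma v_1: "v P 1 = 0"
proof (cases "mpoly_eval (pt P) f = 0")
  case True
  then show ?thesis by (intro v_eqI) (simp_all add: curve_point.ord_eq_0_iff[OF curve_point_at])
qed (simp add: v_off_curve)

lemma v_power:
  assumes "G \<in> forms m" "\<not> f dvd G"
  shows "\<not> f dvd G ^ k \<and> v P (G ^ k) = k * v P G"
proof (induction k)
  case 0
  show ?case using prime by (simp add: v_1 prime_elem_not_unit)
next
  case (Suc k)
  then show ?case
    using v_mult[OF assms forms_power[OF assms(1), of k]] not_dvd_mult[OF assms(2), of "G ^ k"] by simp
qed

lemma v_eq_0_iff:
  assumes "mpoly_eval (pt P) f = 0" "G \<in> forms m" "\<not> f dvd G"
  shows "v P G = 0 \<longleftrightarrow> mpoly_eval (pt P) G \<noteq> 0"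
  using curve_point.ord_eq_0_iff[OF curve_point_at[OF assms(1)], of G] ord_eq_v[OF assms] v_eqI[OF assms(1)] by metis

lemma v_congr:
  assumes "G \<in> forms m" "\<not> f dvd G" "H = G + a * f"
  shows "v P H = v P G"
proof (cases "mpoly_eval (pt P) f = 0")
  case True
  note cp = curve_point_at[OF True]
  obtain b x c where b: "mpoly_eval (pt P) b \<noteq> 0" "mpoly_eval (pt P) c \<noteq> 0" "b * G = x * f + c * loc_param f P ^ v P G"
    using ord_eq_v[OF True assms(1,2)] unfolding curve_point.ord_eq_def[OF cp] by blast
  have "b * H = b * G + b * a * f" unfolding assms(3) by (simp add: algebra_simps)
  also have "\<dots> = (x + b * a) * f + c * loc_param f P ^ v P G" unfolding b(3) by (simp add: algebra_simps)
  finally have "ord_eq_at P (v P G) H" unfolding curve_point.ord_eq_def[OF cp] using b(1,2) by blast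
  then show ?thesis by (rule v_eqI[OF True])
qed (simp add: v_off_curve)

lemma finite_support:
  assumes "G \<in> forms m" "\<not> f dvd G"
  shows "finite {P. v P G \<noteq> 0}"
proof (rule finite_subset)
  show "{P. v P G \<noteq> 0} \<subseteq> {P. mpoly_eval (pt P) f = 0 \<and> mpoly_eval (pt P) G = 0}"
  proof
    fix P assume "P \<in> {P. v P G \<noteq> 0}"
    then have "v P G \<noteq> 0" by simp
    then have "mpoly_eval (pt P) f = 0" by (rule v_on_curve)
    moreover have "mpoly_eval (pt P) G = 0"
      using v_eq_0_iff[OF calculation assms] \<open>v P G \<noteq> 0\<close> by simp
    ultimately show "P \<in> {P. mpoly_eval (pt P) f = 0 \<and> mpoly_eval (pt P) G = 0}"
      by simp
  qed
qed (rule finite_common_points[OF form d_pos prime assms])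

lemma intersection_number_eq_v:
  assumes "g \<in> forms e" "\<not> f dvd g"
  shows "intersection_number P f g = enat (v P g)"
proof (cases "mpoly_eval (pt P) f = 0")
  case True
  show ?thesis
    by (rule curve_point.intersection_number_eq_ord[OF curve_point_at[OF True] refl assms(1) ord_eq_v[OF True assms]])
next
  case False
  then show ?thesis using intersection_number_off_curve[OF form] by (simp add: v_off_curve zero_enat_def)
qed

lemma cut_divisor_eq: "g \<in> forms e \<Longrightarrow> \<not> f dvd g \<Longrightarrow> cut_divisor f g = (\<lambda>P. int (v P g))"
  by (simp add: cut_divisor_def intersection_number_eq_v)

text \<open>Nonvanishing of \<open>b\<close> at the chosen representative of a point need not
  persist at its multiples. A homogeneous component of \<open>b\<close> that is nonzero at the
  representative repairs this.\<close>

lemma locally_in_ideal_points: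
  assumes g: "g \<in> forms e" and G: "G \<in> forms m"
    and loc: "\<And>P. mpoly_eval (pt P) f = 0 \<Longrightarrow> \<exists>b a c. mpoly_eval (pt P) b \<noteq> 0 \<and> b * G = a * f + c * g"
  shows "locally_in_ideal f g G"
  unfolding locally_in_ideal_def
proof (intro allI impI)
  fix p assume p: "p \<noteq> (\<lambda>_. 0)" "mpoly_eval p f = 0"
  obtain P s where s: "s \<noteq> 0" "p = (\<lambda>i. s * pt P i)" by (rule pt_exists[OF p(1)])
  have "mpoly_eval (pt P) f = 0" using p(2) s(1) unfolding s(2) by (simp add: mpoly_eval_scale[OF form])
  then obtain b a c where b: "mpoly_eval (pt P) b \<noteq> 0" "b * G = a * f + c * g" using loc by blast
  obtain k where k: "mpoly_eval (pt P) (hc k b) \<noteq> 0" using mpoly_eval_hc_nonzero[OF b(1)] by blast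
  have "hc k b * G = hc (k + m) (b * G)" by (simp add: hc_mult_form[OF G])
  also have "\<dots> = (if d \<le> k + m then hc (k + m - d) a else 0) * f + (if e \<le> k + m then hc (k + m - e) c else 0) * g"
    unfolding b(2) hc_add hc_mult_form[OF form] hc_mult_form[OF g] by (simp split: if_splits)
  finally have "hc k b * G = (if d \<le> k + m then hc (k + m - d) a else 0) * f + (if e \<le> k + m then hc (k + m - e) c else 0) * g" .
  moreover have "mpoly_eval p (hc k b) \<noteq> 0" unfolding s(2) using k s(1) by (simp add: mpoly_eval_scale[OF hc_forms])
  ultimately show "\<exists>b a c. mpoly_eval p b \<noteq> 0 \<and> b * G = a * f + c * g" by blast
qed

lemma Noether_ord_ge:
  assumes g: "g \<in> forms e" "\<not> f dvd g" and G: "G \<in> forms m"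
    and ge: "\<And>P. mpoly_eval (pt P) f = 0 \<Longrightarrow> mpoly_eval (pt P) g = 0 \<Longrightarrow> ord_ge_at P (v P g) G"
  shows "\<exists>a c. G = a * f + c * g"
proof (rule Max_Noether[OF form d_pos prime g G locally_in_ideal_points[OF g(1) G]])
  fix P assume P: "mpoly_eval (pt P) f = 0"
  show "\<exists>b a c. mpoly_eval (pt P) b \<noteq> 0 \<and> b * G = a * f + c * g"
  proof (cases "mpoly_eval (pt P) g = 0")
    case True
    then show ?thesis
      using ge[OF P] curve_point.ord_ge_iff_local[OF curve_point_at[OF P] ord_eq_v[OF P g]] by blast
  next
    case False
    moreover have "g * G = 0 * f + G * g" by (simp add: mult.commute)
    ultimately show ?thesis by blast
  qed
qed

lemma Noether_v:
  assumes g: "g \<in> forms e" "\<not> f dvd g" and G: "G \<in> forms m" "\<not> f dvd G"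
    and le: "\<And>P. v P g \<le> v P G"
  shows "\<exists>a c. G = a * f + c * g"
  using g G(1)
proof (rule Noether_ord_ge)
  fix P assume P: "mpoly_eval (pt P) f = 0"
  show "ord_ge_at P (v P g) G"
    by (rule curve_point.ord_eq_imp_ge[OF curve_point_at[OF P] ord_eq_v[OF P G] le])
qed

definition div_degree :: "3 mpoly \<Rightarrow> nat" where
  "div_degree G = (\<Sum>P | v P G \<noteq> 0. v P G)"

lemma div_degree_superset: "finite S \<Longrightarrow> {P. v P G \<noteq> 0} \<subseteq> S \<Longrightarrow> div_degree G = (\<Sum>P\<in>S. v P G)"
  unfolding div_degree_def by (rule sum.mono_neutral_left) auto

lemma div_degree_mult:
  assumes "G \<in> forms m" "\<not> f dvd G" "H \<in> forms n" "\<not> f dvd H"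
  shows "div_degree (G * H) = div_degree G + div_degree H"
proof -
  let ?S = "{P. v P G \<noteq> 0} \<union> {P. v P H \<noteq> 0}"
  have S: "finite ?S" using finite_support assms by blast
  have "div_degree (G * H) = (\<Sum>P\<in>?S. v P (G * H))"
    by (rule div_degree_superset[OF S]) (auto simp: v_mult[OF assms])
  also have "\<dots> = (\<Sum>P\<in>?S. v P G) + (\<Sum>P\<in>?S. v P H)" by (simp add: v_mult[OF assms] sum.distrib)
  also have "\<dots> = div_degree G + div_degree H" using div_degree_superset[OF S] by simp
  finally show ?thesis .
qed

text \<open>There are at least \<open>d * e\<close> forms independent modulo \<open>f\<close> and
  \<open>g\<close>. Were the orders of \<open>g\<close> to sum to less, some nontrivial combination
  of them would vanish to the order of \<open>g\<close> at every point, and Noether's theorem would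
  put it into the ideal.\<close>

lemma div_degree_ge:
  assumes g: "g \<in> forms e" "\<not> f dvd g"
  shows "d * e \<le> div_degree g"
proof (rule ccontr)
  assume less: "\<not> d * e \<le> div_degree g"
  let ?S = "{P. v P g \<noteq> 0}"
  have finS: "finite ?S" by (rule finite_support[OF g])
  define t where "t = d + e"
  obtain Q where Q: "Q \<subseteq> forms t" "finite Q" "d * e \<le> card Q"
    "\<And>c x y. (\<Sum>q\<in>Q. mpoly_const (c q) * q) = x * f + y * g \<Longrightarrow> \<forall>q\<in>Q. c q = 0"
    using codim_ideal2[OF form nonzero g(1), of t] unfolding t_def by blast
  \<comment> \<open>One linear condition for each Taylor coefficient below the order of
    \<open>g\<close>, at each zero of \<open>g\<close>.\<close>
  define K where "K = (SIGMA P:?S. {..<v P g})"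
  have "card K = div_degree g" unfolding K_def div_degree_def using finS by simp
  then have card: "card K < card Q" using less Q(3) by linarith
  have finK: "finite K" unfolding K_def using finS by simp
  have "\<exists>X. X \<in> forms 1 \<and> mpoly_eval (pt P) X \<noteq> 0" for P
  proof -
    obtain l where "pt P l \<noteq> 0" using pt_nonzero[of P] by auto
    then show ?thesis by (intro exI[of _ "mvar l"] conjI forms_mvar) simp
  qed
  then obtain X where X: "\<And>P. X P \<in> forms 1" "\<And>P. mpoly_eval (pt P) (X P) \<noteq> 0" by metis
  define w where "w = (\<lambda>P k. loc_param f P ^ k * X P ^ (v P g - k))"
  have on: "mpoly_eval (pt P) f = 0" if "P \<in> ?S" for P using that v_on_curve by blast
  have "\<forall>x\<in>?S \<times> Q. \<exists>c. ord_ge_at (fst x) (v (fst x) g)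
      (snd x * X (fst x) ^ v (fst x) g - X (fst x) ^ t * (\<Sum>k<v (fst x) g. mpoly_const (c k) * w (fst x) k))"
  proof
    fix x assume x: "x \<in> ?S \<times> Q"
    have q: "snd x \<in> forms t" using x Q(1) by auto
    have Xt: "X (fst x) ^ t \<in> forms t" using forms_power[OF X(1)[of "fst x"], of t] by simp
    have ev: "mpoly_eval (pt (fst x)) (X (fst x) ^ t) \<noteq> 0" using X(2)[of "fst x"] by simp
    have P: "mpoly_eval (pt (fst x)) f = 0" using x by (intro on) auto
    from curve_point.expansion[OF curve_point_at[OF P] q Xt ev X(1,2), of "v (fst x) g"]
    show "\<exists>c. ord_ge_at (fst x) (v (fst x) g)
      (snd x * X (fst x) ^ v (fst x) g - X (fst x) ^ t * (\<Sum>k<v (fst x) g. mpoly_const (c k) * w (fst x) k))"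
      unfolding w_def .
  qed
  from bchoice[OF this] obtain c where c0: "\<forall>x\<in>?S \<times> Q. ord_ge_at (fst x) (v (fst x) g)
      (snd x * X (fst x) ^ v (fst x) g - X (fst x) ^ t * (\<Sum>k<v (fst x) g. mpoly_const (c x k) * w (fst x) k))"
    by blast
  have c: "ord_ge_at P (v P g)
      (q * X P ^ v P g - X P ^ t * (\<Sum>k<v P g. mpoly_const (c (P, q) k) * w P k))"
    if "P \<in> ?S" "q \<in> Q" for P q
  proof -
    have "(P, q) \<in> ?S \<times> Q" using that by blast
    from bspec[OF c0 this] show ?thesis by (simp only: fst_conv snd_conv)
  qed
  obtain z where z: "\<exists>q\<in>Q. z q \<noteq> 0" "\<forall>x\<in>K. (\<Sum>q\<in>Q. z q * c (fst x, q) (snd x)) = 0"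
    using homogeneous_system_nontrivial[OF finK Q(2) card, of "\<lambda>q x. c (fst x, q) (snd x)"]
    by (elim exE conjE) (rule that)
  define G where "G = (\<Sum>q\<in>Q. mpoly_const (z q) * q)"
  have G: "G \<in> forms t" unfolding G_def using Q(1) by (intro forms_sum forms_const_mult) auto
  have "\<exists>a c. G = a * f + c * g"
  proof (rule Noether_ord_ge[OF g G])
    fix P assume P: "mpoly_eval (pt P) f = 0" "mpoly_eval (pt P) g = 0"
    then have PS: "P \<in> ?S" using v_eq_0_iff[OF P(1) g] by simp
    note cp = curve_point_at[OF P(1)]
    have "ord_ge_at P (v P g) (\<Sum>q\<in>Q. mpoly_const (z q) *
        (q * X P ^ v P g - X P ^ t * (\<Sum>k<v P g. mpoly_const (c (P, q) k) * w P k)))"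
      using c[OF PS] by (rule curve_point.ord_ge_sum[OF cp])
    also have "(\<Sum>q\<in>Q. mpoly_const (z q) *
        (q * X P ^ v P g - X P ^ t * (\<Sum>k<v P g. mpoly_const (c (P, q) k) * w P k))) =
      X P ^ v P g * G - X P ^ t * (\<Sum>q\<in>Q. \<Sum>k<v P g. mpoly_const (z q * c (P, q) k) * w P k)"
      unfolding G_def sum_distrib_left sum_subtractf[symmetric]
    proof (rule sum.cong[OF refl])
      fix q
      have "mpoly_const (z q) * (q * X P ^ v P g - S) = X P ^ v P g * (mpoly_const (z q) * q) - mpoly_const (z q) * S" for S
        by (simp add: algebra_simps)
      then show "mpoly_const (z q) * (q * X P ^ v P g - (\<Sum>k<v P g. X P ^ t * (mpoly_const (c (P, q) k) * w P k))) =
        X P ^ v P g * (mpoly_const (z q) * q) - (\<Sum>k<v P g. X P ^ t * (mpoly_const (z q * c (P, q) k) * w P k))"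
        by (simp only: sum_distrib_left mpoly_const_mult mult.assoc mult.left_commute)
    qed
    also have "(\<Sum>q\<in>Q. \<Sum>k<v P g. mpoly_const (z q * c (P, q) k) * w P k) =
        (\<Sum>k<v P g. mpoly_const (\<Sum>q\<in>Q. z q * c (P, q) k) * w P k)"
      unfolding mpoly_const_sum sum_distrib_right by (rule sum.swap)
    also have "\<dots> = 0"
    proof (rule sum.neutral, rule ballI)
      fix k assume "k \<in> {..<v P g}"
      then have "(P, k) \<in> K" using PS by (auto simp: K_def)
      with z(2) have "(\<Sum>q\<in>Q. z q * c (P, q) k) = 0" by force
      then show "mpoly_const (\<Sum>q\<in>Q. z q * c (P, q) k) * w P k = 0" by simp
    qed
    finally have "ord_ge_at P (v P g) (X P ^ v P g * G)" by simp
    then show "ord_ge_at P (v P g) G"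
      by (rule curve_point.ord_ge_cancel[OF cp, rotated]) (use X(2) in simp)
  qed
  then obtain x y where "G = x * f + y * g" by blast
  then have "\<forall>q\<in>Q. z q = 0" using Q(4) unfolding G_def by blast
  with z(1) show False by blast
qed

text \<open>The order of \<open>L\<close> at a point is at most the multiplicity of the
  corresponding root of \<open>f\<close> restricted to the line; distinct points give distinct
  roots, and the restriction has degree \<open>d\<close>.\<close>

lemma div_degree_line_le:
  assumes L: "L \<in> forms 1" "\<not> f dvd L"
  shows "div_degree L \<le> d"
proof -
  obtain \<alpha> \<beta> \<kappa>\<^sub>1 \<kappa>\<^sub>2 where \<beta>: "mpoly_eval \<beta> f \<noteq> 0" and restr: "line_restrict \<alpha> \<beta> L = 0"
    and deg: "degree (line_restrict \<alpha> \<beta> f) = d"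
    and coord: "\<forall>p. mpoly_eval p L = 0 \<longrightarrow> p = (\<lambda>i. mpoly_eval p \<kappa>\<^sub>1 * \<alpha> i + mpoly_eval p \<kappa>\<^sub>2 * \<beta> i)"
    by (rule line_parametrization[OF form d_pos prime L])
  let ?r = "line_restrict \<alpha> \<beta> f" and ?S = "{P. v P L \<noteq> 0}"
  have r0: "?r \<noteq> 0" using deg d_pos by auto
  have finS: "finite ?S" by (rule finite_support[OF L])
  have on: "mpoly_eval (pt P) f = 0" if "P \<in> ?S" for P using that v_on_curve by blast
  have "\<forall>P\<in>?S. \<exists>x. fst x \<noteq> 0 \<and> pt P = (\<lambda>i. fst x * (\<alpha> i + snd x * \<beta> i))"
  proof
    fix P assume P: "P \<in> ?S"
    have PL: "mpoly_eval (pt P) L = 0" using P v_eq_0_iff[OF on[OF P] L] by simp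
    obtain s t where "s \<noteq> 0" "pt P = (\<lambda>i. s * (\<alpha> i + t * \<beta> i))"
      by (rule curve_point.line_point[OF curve_point_at[OF on[OF P]] coord \<beta> PL])
    then show "\<exists>x. fst x \<noteq> 0 \<and> pt P = (\<lambda>i. fst x * (\<alpha> i + snd x * \<beta> i))"
      by (intro exI[of _ "(s, t)"]) simp
  qed
  from bchoice[OF this] obtain x where x: "\<And>P. P \<in> ?S \<Longrightarrow> fst (x P) \<noteq> 0"
    "\<And>P. P \<in> ?S \<Longrightarrow> pt P = (\<lambda>i. fst (x P) * (\<alpha> i + snd (x P) * \<beta> i))" by blast
  define \<tau> where "\<tau> = (\<lambda>P. snd (x P))"
  have le: "v P L \<le> Polynomial.order (\<tau> P) ?r" if P: "P \<in> ?S" for P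
  proof -
    note cp = curve_point_at[OF on[OF P]]
    have L0: "L \<noteq> 0" using L(2) by auto
    have "[:- \<tau> P, 1:] ^ v P L dvd ?r"
      unfolding \<tau>_def
      by (rule curve_point.tangency_bound[OF cp L(1) L0
          curve_point.ord_eq_imp_ge[OF cp ord_eq_v[OF on[OF P] L] order_refl] restr x(2,1)[OF P]])
    then show ?thesis using r0 by (simp add: order_divides)
  qed
  have inj: "inj_on \<tau> ?S"
  proof (rule inj_onI)
    fix P P' assume P: "P \<in> ?S" "P' \<in> ?S" "\<tau> P = \<tau> P'"
    have "pt P = (\<lambda>i. (fst (x P) / fst (x P')) * pt P' i)"
      unfolding x(2)[OF P(1)] x(2)[OF P(2)] using x(1)[OF P(2)] P(3) by (simp add: \<tau>_def)
    then show "P = P'" by (rule pt_eqI)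
  qed
  have "div_degree L \<le> (\<Sum>P\<in>?S. Polynomial.order (\<tau> P) ?r)"
    unfolding div_degree_def using le by (rule sum_mono)
  also have "\<dots> = (\<Sum>y\<in>\<tau> ` ?S. Polynomial.order y ?r)" by (simp only: sum.reindex[OF inj] o_def)
  also have "\<dots> \<le> (\<Sum>y | poly ?r y = 0. Polynomial.order y ?r)"
  proof (rule sum_mono2)
    show "finite {y. poly ?r y = 0}" by (rule poly_roots_finite[OF r0])
    show "\<tau> ` ?S \<subseteq> {y. poly ?r y = 0}"
    proof
      fix y assume "y \<in> \<tau> ` ?S"
      then obtain P where P: "P \<in> ?S" "y = \<tau> P" by (rule imageE) (rule that)
      then have "Polynomial.order y ?r \<noteq> 0" using le[OF P(1)] by simp
      then show "y \<in> {y. poly ?r y = 0}" using r0 by (simp add: order_root)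
    qed
  qed simp
  also have "\<dots> \<le> d" using sum_order_le_degree[OF r0] deg by simp
  finally show ?thesis .
qed

text \<open>Modulo \<open>f\<close>, \<open>b * g\<close> is a product of lines, so the degrees of
  \<open>b\<close> and \<open>g\<close> on the curve sum to at most \<open>d * length Ls\<close>.
  Their individual lower bounds sum to the same number, which forces equality in both.\<close>

theorem Bezout:
  assumes g: "g \<in> forms e" "\<not> f dvd g"
  shows "div_degree g = d * e"
proof -
  obtain Ls a b where Ls: "\<And>L. L \<in> set Ls \<Longrightarrow> L \<in> forms 1 \<and> \<not> f dvd L"
    and ab: "b * g = prod_list Ls + a * f" "b \<in> forms (length Ls - e)" "e \<le> length Ls" "\<not> f dvd b"
    using lines_in_ideal[OF form d_pos prime g] by metis
  have lines: "prod_list Ls \<in> forms (length Ls) \<and> \<not> f dvd prod_list Ls \<and> div_degree (prod_list Ls) \<le> d * length Ls"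
    using Ls
  proof (induction Ls)
    case Nil
    show ?case using prime by (simp add: div_degree_def v_1 prime_elem_not_unit)
  next
    case (Cons L Ls)
    have IH: "prod_list Ls \<in> forms (length Ls)" "\<not> f dvd prod_list Ls" "div_degree (prod_list Ls) \<le> d * length Ls"
      using Cons by auto
    have L: "L \<in> forms 1" "\<not> f dvd L" using Cons.prems by auto
    show ?case
      using div_degree_mult[OF L IH(1,2)] div_degree_line_le[OF L] IH(3) not_dvd_mult[OF L(2) IH(2)] forms_mult[OF L(1) IH(1)]
      by (simp add: algebra_simps)
  qed
  have "div_degree (b * g) = div_degree (prod_list Ls)"
    unfolding div_degree_def using v_congr[of "prod_list Ls" "length Ls" "b * g" a] lines ab(1) by simp
  then have "div_degree b + div_degree g \<le> d * length Ls"
    using div_degree_mult[OF ab(2,4) g] lines by simp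
  moreover have "d * (length Ls - e) \<le> div_degree b" by (rule div_degree_ge[OF ab(2,4)])
  moreover have "d * (length Ls - e) + d * e = d * length Ls" using ab(3) by (simp flip: distrib_left)
  ultimately show ?thesis using div_degree_ge[OF g] by linarith
qed

end

section \<open>The group of divisor classes of degree zero\<close>

lemma divisor_degree_superset:
  "finite S \<Longrightarrow> {P. \<delta> P \<noteq> 0} \<subseteq> S \<Longrightarrow> divisor_degree \<delta> = (\<Sum>P\<in>S. \<delta> P)"
  unfolding divisor_degree_def by (rule sum.mono_neutral_left) auto

lemma divisors_add:
  assumes "\<delta> \<in> divisors f" "\<epsilon> \<in> divisors f"
  shows "(\<lambda>P. \<delta> P + \<epsilon> P) \<in> divisors f"
    and "divisor_degree (\<lambda>P. \<delta> P + \<epsilon> P) = divisor_degree \<delta> + divisor_degree \<epsilon>"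
proof -
  let ?S = "{P. \<delta> P \<noteq> 0} \<union> {P. \<epsilon> P \<noteq> 0}"
  have S: "finite ?S" and sub: "{P. \<delta> P + \<epsilon> P \<noteq> 0} \<subseteq> ?S" using assms by (auto simp: divisors_def)
  show "(\<lambda>P. \<delta> P + \<epsilon> P) \<in> divisors f"
    using finite_subset[OF sub S] sub assms by (auto simp: divisors_def)
  show "divisor_degree (\<lambda>P. \<delta> P + \<epsilon> P) = divisor_degree \<delta> + divisor_degree \<epsilon>"
    using divisor_degree_superset[OF S sub] divisor_degree_superset[OF S, of \<delta>] divisor_degree_superset[OF S, of \<epsilon>]
    by (simp add: sum.distrib)
qed

lemma divisors_scale:
  assumes "\<delta> \<in> divisors f"
  shows "(\<lambda>P. n * \<delta> P) \<in> divisors f" and "divisor_degree (\<lambda>P. n * \<delta> P) = n * divisor_degree \<delta>"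
proof -
  have S: "finite {P. \<delta> P \<noteq> 0}" and sub: "{P. n * \<delta> P \<noteq> 0} \<subseteq> {P. \<delta> P \<noteq> 0}"
    using assms by (auto simp: divisors_def)
  show "(\<lambda>P. n * \<delta> P) \<in> divisors f"
    using finite_subset[OF sub S] sub assms by (auto simp: divisors_def)
  show "divisor_degree (\<lambda>P. n * \<delta> P) = n * divisor_degree \<delta>"
    unfolding divisor_degree_superset[OF S sub] divisor_degree_def by (simp add: sum_distrib_left)
qed

lemma comm_group_degree_zero_divisors: "comm_group (degree_zero_divisors f)"
proof (rule comm_groupI)
  fix x assume x: "x \<in> carrier (degree_zero_divisors f)"
  then have "(\<lambda>P. (- 1) * x P) \<in> carrier (degree_zero_divisors f)"
    using divisors_scale[of x f "- 1"] by (simp add: degree_zero_divisors_def)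
  moreover have "(\<lambda>P. (- 1) * x P) \<otimes>\<^bsub>degree_zero_divisors f\<^esub> x = \<one>\<^bsub>degree_zero_divisors f\<^esub>"
    by (simp add: degree_zero_divisors_def)
  ultimately show "\<exists>y\<in>carrier (degree_zero_divisors f).
      y \<otimes>\<^bsub>degree_zero_divisors f\<^esub> x = \<one>\<^bsub>degree_zero_divisors f\<^esub>" by blast
next
  show "\<one>\<^bsub>degree_zero_divisors f\<^esub> \<in> carrier (degree_zero_divisors f)"
    by (simp add: degree_zero_divisors_def divisors_def divisor_degree_def)
next
  fix x y assume "x \<in> carrier (degree_zero_divisors f)" "y \<in> carrier (degree_zero_divisors f)"
  then show "x \<otimes>\<^bsub>degree_zero_divisors f\<^esub> y \<in> carrier (degree_zero_divisors f)"
    using divisors_add[of x f y] by (simp add: degree_zero_divisors_def)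
qed (simp_all add: degree_zero_divisors_def fun_eq_iff)

context smooth_form
begin

lemma v_divisor:
  assumes "g \<in> forms e" "\<not> f dvd g"
  shows "(\<lambda>P. int (v P g)) \<in> divisors f" "divisor_degree (\<lambda>P. int (v P g)) = int (d * e)"
proof -
  show "(\<lambda>P. int (v P g)) \<in> divisors f"
    using finite_support[OF assms] v_on_curve
    by (auto simp: divisors_def curve_points_def vanishes_at_iff[OF form])
  show "divisor_degree (\<lambda>P. int (v P g)) = int (d * e)"
    using arg_cong[OF Bezout[OF assms], of int] by (simp add: divisor_degree_def div_degree_def)
qed

lemma principal_divisors_eq:
  "principal_divisors f = {(\<lambda>P. int (v P g) - int (v P h)) | g h.
      \<exists>m. g \<in> forms m \<and> h \<in> forms m \<and> \<not> f dvd g \<and> \<not> f dvd h}"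
  unfolding principal_divisors_def
  by (intro Collect_cong iff_exI) (auto simp: cut_divisor_eq)

lemma principal_divisorsI:
  "g \<in> forms m \<Longrightarrow> h \<in> forms m \<Longrightarrow> \<not> f dvd g \<Longrightarrow> \<not> f dvd h \<Longrightarrow>
    \<delta> = (\<lambda>P. int (v P g) - int (v P h)) \<Longrightarrow> \<delta> \<in> principal_divisors f"
  unfolding principal_divisors_eq by blast

lemma principal_divisorsE:
  assumes "\<delta> \<in> principal_divisors f"
  obtains g h m where "g \<in> forms m" "h \<in> forms m" "\<not> f dvd g" "\<not> f dvd h" "\<delta> = (\<lambda>P. int (v P g) - int (v P h))"
  using assms unfolding principal_divisors_eq by blast

lemma one_not_multiple: "\<not> f dvd 1"
  using prime by (rule prime_elem_not_unit)

lemma subgroup_principal_divisors: "subgroup (principal_divisors f) (degree_zero_divisors f)"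
proof -
  interpret D: comm_group "degree_zero_divisors f" by (rule comm_group_degree_zero_divisors)
  have car: "principal_divisors f \<subseteq> carrier (degree_zero_divisors f)"
  proof
    fix \<delta> assume "\<delta> \<in> principal_divisors f"
    then obtain g h m where gh: "g \<in> forms m" "h \<in> forms m" "\<not> f dvd g" "\<not> f dvd h"
      "\<delta> = (\<lambda>P. int (v P g) - int (v P h))" by (rule principal_divisorsE)
    note dg = v_divisor[OF gh(1,3)] and dh = v_divisor[OF gh(2,4)]
    have \<delta>: "\<delta> = (\<lambda>P. int (v P g) + (- 1) * int (v P h))" by (simp add: gh(5))
    show "\<delta> \<in> carrier (degree_zero_divisors f)"
      unfolding \<delta> degree_zero_divisors_def
      using divisors_add[OF dg(1) divisors_scale(1)[OF dh(1), of "- 1"]] divisors_scale(2)[OF dh(1), of "- 1"] dg(2) dh(2)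
      by simp
  qed
  show ?thesis
  proof (rule D.subgroupI[OF car])
    have "(\<lambda>P. int (v P 1) - int (v P 1)) \<in> principal_divisors f"
      by (rule principal_divisorsI[OF forms_1 forms_1 one_not_multiple one_not_multiple refl])
    then show "principal_divisors f \<noteq> {}" by blast
  next
    fix \<delta> assume \<delta>: "\<delta> \<in> principal_divisors f"
    then obtain g h m where gh: "g \<in> forms m" "h \<in> forms m" "\<not> f dvd g" "\<not> f dvd h"
      "\<delta> = (\<lambda>P. int (v P g) - int (v P h))" by (rule principal_divisorsE)
    have neg: "(\<lambda>P. int (v P h) - int (v P g)) \<in> principal_divisors f"
      by (rule principal_divisorsI[OF gh(2,1,4,3) refl])
    have "inv\<^bsub>degree_zero_divisors f\<^esub> \<delta> = (\<lambda>P. int (v P h) - int (v P g))"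
      by (rule D.inv_equality) (use neg \<delta> car gh(5) in \<open>auto simp: degree_zero_divisors_def\<close>)
    with neg show "inv\<^bsub>degree_zero_divisors f\<^esub> \<delta> \<in> principal_divisors f" by simp
  next
    fix \<delta> \<epsilon> assume "\<delta> \<in> principal_divisors f" "\<epsilon> \<in> principal_divisors f"
    then obtain g h m g' h' m' where gh: "g \<in> forms m" "h \<in> forms m" "\<not> f dvd g" "\<not> f dvd h"
      "\<delta> = (\<lambda>P. int (v P g) - int (v P h))"
      and gh': "g' \<in> forms m'" "h' \<in> forms m'" "\<not> f dvd g'" "\<not> f dvd h'"
      "\<epsilon> = (\<lambda>P. int (v P g') - int (v P h'))" by (elim principal_divisorsE)
    have "\<delta> \<otimes>\<^bsub>degree_zero_divisors f\<^esub> \<epsilon> = (\<lambda>P. int (v P (g * g')) - int (v P (h * h')))"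
      by (simp add: degree_zero_divisors_def gh(5) gh'(5) v_mult[OF gh(1,3) gh'(1,3)] v_mult[OF gh(2,4) gh'(2,4)] fun_eq_iff)
    then show "\<delta> \<otimes>\<^bsub>degree_zero_divisors f\<^esub> \<epsilon> \<in> principal_divisors f"
      by (rule principal_divisorsI[OF forms_mult[OF gh(1) gh'(1)] forms_mult[OF gh(2) gh'(2)]
          not_dvd_mult[OF gh(3) gh'(3)] not_dvd_mult[OF gh(4) gh'(4)]])
  qed
qed

text \<open>Divisibility is the convenient form because infinite order is encoded as
  \<open>0\<close>, which divides only \<open>0\<close>.\<close>

lemma ord_Pic0_dvd_iff:
  assumes \<delta>: "\<delta> \<in> divisors f" "divisor_degree \<delta> = 0"
  shows "group.ord (Pic0 f) (Pic0_class f \<delta>) dvd j \<longleftrightarrow> (\<lambda>P. int j * \<delta> P) \<in> principal_divisors f"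
proof -
  interpret D: comm_group "degree_zero_divisors f" by (rule comm_group_degree_zero_divisors)
  interpret H: normal "principal_divisors f" "degree_zero_divisors f"
    by (rule D.subgroup_imp_normal[OF subgroup_principal_divisors])
  interpret Q: group "Pic0 f" unfolding Pic0_def by (rule H.factorgroup_is_group)
  have car: "\<delta> \<in> carrier (degree_zero_divisors f)" using \<delta> by (simp add: degree_zero_divisors_def)
  have pow: "\<delta> [^]\<^bsub>degree_zero_divisors f\<^esub> k = (\<lambda>P. int k * \<delta> P)" for k :: nat
    by (induction k) (auto simp: degree_zero_divisors_def nat_pow_def algebra_simps)
  have pcar: "(\<lambda>P. int j * \<delta> P) \<in> carrier (degree_zero_divisors f)"
    using D.nat_pow_closed[OF car, of j] by (simp only: pow)
  have cls: "Pic0_class f \<delta> \<in> carrier (Pic0 f)"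
    unfolding Pic0_class_def Pic0_def carrier_FactGroup using car by blast
  have "group.ord (Pic0 f) (Pic0_class f \<delta>) dvd j \<longleftrightarrow> Pic0_class f \<delta> [^]\<^bsub>Pic0 f\<^esub> j = \<one>\<^bsub>Pic0 f\<^esub>"
    using Q.pow_eq_id[OF cls, of j] by simp
  also have "Pic0_class f \<delta> [^]\<^bsub>Pic0 f\<^esub> j = principal_divisors f #>\<^bsub>degree_zero_divisors f\<^esub> (\<lambda>P. int j * \<delta> P)"
    unfolding Pic0_class_def Pic0_def H.FactGroup_pow[OF car] pow ..
  also have "\<one>\<^bsub>Pic0 f\<^esub> = principal_divisors f" unfolding Pic0_def by simp
  also have "principal_divisors f #>\<^bsub>degree_zero_divisors f\<^esub> (\<lambda>P. int j * \<delta> P) = principal_divisors f \<longleftrightarrow>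
      (\<lambda>P. int j * \<delta> P) \<in> principal_divisors f"
    using D.coset_join1[OF _ pcar subgroup_principal_divisors] D.coset_join2[OF pcar subgroup_principal_divisors] by blast
  finally show ?thesis .
qed

end

section \<open>Two smooth curves with contact of constant order\<close>

context curve_point
begin

lemma ord_ge_times:
  assumes "ord_ge i G" "ord_ge j H"
  shows "ord_ge (i + j) (G * H)"
proof -
  obtain b a c where b: "mpoly_eval p b \<noteq> 0" "b * G = a * f + c * u ^ i"
    using assms(1) unfolding ord_ge_def by blast
  obtain b' a' c' where b': "mpoly_eval p b' \<noteq> 0" "b' * H = a' * f + c' * u ^ j"
    using assms(2) unfolding ord_ge_def by blast
  have "(b * b') * (G * H) = (b * G) * (b' * H)" by (simp add: algebra_simps)
  also have "\<dots> = (a * f + c * u ^ i) * (a' * f + c' * u ^ j)" by (simp only: b(2) b'(2))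
  also have "\<dots> = (a * (a' * f + c' * u ^ j) + c * u ^ i * a') * f + (c * c') * u ^ (i + j)"
    by (simp add: power_add algebra_simps)
  finally have "(b * b') * (G * H) = (a * (a' * f + c' * u ^ j) + c * u ^ i * a') * f + (c * c') * u ^ (i + j)" .
  moreover have "mpoly_eval p (b * b') \<noteq> 0" using b(1) b'(1) by simp
  ultimately show ?thesis unfolding ord_ge_def by blast
qed

lemma ord_ge_power: "ord_ge i G \<Longrightarrow> ord_ge (k * i) (G ^ k)"
proof (induction k)
  case (Suc k)
  then show ?case using ord_ge_times[of i G "k * i" "G ^ k"] by simp
qed (simp add: ord_ge_0)

lemma ord_ge_1: "G \<in> forms m \<Longrightarrow> mpoly_eval p G = 0 \<Longrightarrow> ord_ge 1 G"
  using u_gen[of G m] unfolding ord_ge_def by simp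

end

text \<open>In \<open>b * G = a * f\<^sub>1 + c * u\<^sub>1 ^ j\<close> both terms on the right have
  order at least \<open>j\<close> along \<open>f\<^sub>0\<close>: the first by contact, the second
  because \<open>u\<^sub>1\<close> vanishes at \<open>p\<close>.\<close>

lemma ord_ge_transfer:
  assumes 0: "curve_point f\<^sub>0 d\<^sub>0 p u\<^sub>0" and 1: "curve_point f\<^sub>1 d\<^sub>1 p u\<^sub>1"
    and contact: "curve_point.ord_ge f\<^sub>0 p u\<^sub>0 j f\<^sub>1" and G: "curve_point.ord_ge f\<^sub>1 p u\<^sub>1 j G"
  shows "curve_point.ord_ge f\<^sub>0 p u\<^sub>0 j G"
proof -
  obtain b a c where b: "mpoly_eval p b \<noteq> 0" "b * G = a * f\<^sub>1 + c * u\<^sub>1 ^ j"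
    using G unfolding curve_point.ord_ge_def[OF 1] by blast
  have "curve_point.ord_ge f\<^sub>0 p u\<^sub>0 1 u\<^sub>1"
    by (rule curve_point.ord_ge_1[OF 0 curve_point.u_form[OF 1] curve_point.u_zero[OF 1]])
  from curve_point.ord_ge_power[OF 0 this, of j] have "curve_point.ord_ge f\<^sub>0 p u\<^sub>0 j (u\<^sub>1 ^ j)" by simp
  from curve_point.ord_ge_add[OF 0 contact this, of a c] show ?thesis
    unfolding b(2)[symmetric] by (rule curve_point.ord_ge_cancel[OF 0 b(1)])
qed

lemma prime_dvd_prime:
  fixes f g :: "3 mpoly"
  assumes "prime_elem f" "prime_elem g" "f dvd g"
  shows "g dvd f"
proof -
  obtain k where k: "g = f * k" using assms(3) by blast
  then have "g dvd f \<or> g dvd k" using assms(2) by (metis dvd_refl prime_elem_dvd_mult_iff)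
  moreover have "\<not> g dvd k"
  proof
    assume "g dvd k"
    then obtain m where "k = g * m" by blast
    then have "g * (f * m) = g * 1" using k by (simp add: algebra_simps)
    then have "f * m = 1" using assms(2) by (simp add: prime_elem_def)
    then have "f dvd 1" by (metis dvd_triv_left)
    with assms(1) show False by (simp add: prime_elem_not_unit)
  qed
  ultimately show ?thesis by blast
qed

lemma intersection_number_commute: "intersection_number P f g = intersection_number P g f"
proof -
  have sub: "{x + y | x y. x \<in> A \<and> y \<in> B} \<subseteq> {x + y | x y. x \<in> B \<and> y \<in> A}" for A B :: "3 mpoly fract set"
  proof
    fix z assume "z \<in> {x + y | x y. x \<in> A \<and> y \<in> B}"
    then obtain x y where xy: "z = x + y" "x \<in> A" "y \<in> B" by blast
    from xy(1) have "z = y + x" by (rule trans) (rule add.commute)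
    with xy(2,3) show "z \<in> {x + y | x y. x \<in> B \<and> y \<in> A}" by blast
  qed
  show ?thesis
    unfolding intersection_number_def by (rule arg_cong[where f = "quotient_dim _"]) (rule equalityI[OF sub sub])
qed

text \<open>The degrees are not compared here, so the locale is symmetric in the two curves and
  everything proved in it is available with their roles exchanged.\<close>

locale contact_pair = D: smooth_form f\<^sub>0 d\<^sub>0 + C: smooth_form f\<^sub>1 d\<^sub>1
  for f\<^sub>0 f\<^sub>1 :: "3 mpoly" and d\<^sub>0 d\<^sub>1 :: nat +
  fixes n :: nat
  assumes nd: "\<not> f\<^sub>0 dvd f\<^sub>1" "\<not> f\<^sub>1 dvd f\<^sub>0"
    and contact: "\<And>P. mpoly_eval (pt P) f\<^sub>0 = 0 \<Longrightarrow> mpoly_eval (pt P) f\<^sub>1 = 0 \<Longrightarrow> curve_ord f\<^sub>0 P f\<^sub>1 = n"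
begin

definition S :: "proj_plane set" where
  "S = {P. mpoly_eval (pt P) f\<^sub>0 = 0 \<and> mpoly_eval (pt P) f\<^sub>1 = 0}"

lemma finite_S: "finite S"
  unfolding S_def by (rule finite_common_points[OF D.form D.d_pos D.prime C.form nd(1)])

lemma v0: "curve_ord f\<^sub>0 P f\<^sub>1 = (if P \<in> S then n else 0)"
  using contact D.v_eq_0_iff[OF _ C.form nd(1)] D.v_on_curve[of P f\<^sub>1] unfolding S_def by auto

text \<open>Contact is the same seen from either curve, since both orders equal the intersection
  number, whose definition is symmetric.\<close>

lemma v1: "curve_ord f\<^sub>1 P f\<^sub>0 = (if P \<in> S then n else 0)"
  using v0[of P] D.intersection_number_eq_v[OF C.form nd(1), of P] C.intersection_number_eq_v[OF D.form nd(2), of P]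
    intersection_number_commute[of P f\<^sub>0 f\<^sub>1] by simp

lemma swap: "contact_pair f\<^sub>1 f\<^sub>0 d\<^sub>1 d\<^sub>0 n"
  by unfold_locales (use nd v1 in \<open>auto simp: S_def\<close>)

lemma card_S: "n * card S = d\<^sub>0 * d\<^sub>1"
proof -
  have "D.div_degree f\<^sub>1 = (\<Sum>P\<in>S. curve_ord f\<^sub>0 P f\<^sub>1)"
    by (rule D.div_degree_superset[OF finite_S]) (auto simp: v0 split: if_splits)
  then show ?thesis using D.Bezout[OF C.form nd(1)] by (simp add: v0)
qed

text \<open>By Bezout \<open>n * card S\<close> is the positive number
  \<open>d\<^sub>0 * d\<^sub>1\<close>.\<close>

lemma n_pos: "0 < n" and S_nonempty: "S \<noteq> {}"
  using card_S D.d_pos C.d_pos by (auto intro: Nat.gr0I)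

lemma contact_divisor_eq: "contact_divisor f\<^sub>0 f\<^sub>1 P = (if P \<in> S then 1 else 0)"
  "contact_divisor f\<^sub>1 f\<^sub>0 P = (if P \<in> S then 1 else 0)"
  by (auto simp: contact_divisor_def S_def curve_points_def vanishes_at_iff[OF D.form] vanishes_at_iff[OF C.form])

text \<open>On the curve \<open>f\<^sub>1\<close>, the points of \<open>S\<close> minus
  \<open>d\<^sub>0 div n\<close> times the section by \<open>l\<close>. Its class is the one whose
  order enters the type of the new curve.\<close>

definition torsion_divisor :: "3 mpoly \<Rightarrow> proj_plane \<Rightarrow> int" where
  "torsion_divisor l P = (if P \<in> S then 1 else 0) - int (d\<^sub>0 div n) * int (curve_ord f\<^sub>1 P l)"

lemma torsion_divisor:
  assumes l: "l \<in> forms 1" "\<not> f\<^sub>1 dvd l" and n: "n dvd d\<^sub>0"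
  shows "torsion_divisor l \<in> divisors f\<^sub>1" "divisor_degree (torsion_divisor l) = 0"
proof -
  define \<delta> where "\<delta> = (\<lambda>P. if P \<in> S then 1 else 0 :: int)"
  have supp: "{P. \<delta> P \<noteq> 0} = S" by (auto simp: \<delta>_def)
  have \<delta>: "\<delta> \<in> divisors f\<^sub>1" unfolding divisors_def mem_Collect_eq supp
    using finite_S by (auto simp: S_def curve_points_def vanishes_at_iff[OF C.form])
  have deg: "divisor_degree \<delta> = int (card S)" unfolding divisor_degree_def supp by (simp add: \<delta>_def)
  note dl = C.v_divisor[OF l]
  have eq: "torsion_divisor l = (\<lambda>P. \<delta> P + (- int (d\<^sub>0 div n)) * int (curve_ord f\<^sub>1 P l))"
    by (auto simp: torsion_divisor_def \<delta>_def)
  show "torsion_divisor l \<in> divisors f\<^sub>1"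
    unfolding eq by (rule divisors_add(1)[OF \<delta> divisors_scale(1)[OF dl(1)]])
  have "d\<^sub>0 div n * d\<^sub>1 = card S"
  proof -
    have "n * (d\<^sub>0 div n * d\<^sub>1) = n * card S" using n by (simp add: card_S mult.assoc[symmetric])
    then show ?thesis using n_pos by simp
  qed
  then have "int (d\<^sub>0 div n) * int d\<^sub>1 = int (card S)" by (simp flip: of_nat_mult)
  then show "divisor_degree (torsion_divisor l) = 0"
    unfolding eq divisors_add(2)[OF \<delta> divisors_scale(1)[OF dl(1)]] divisors_scale(2)[OF dl(1)] deg dl(2) by simp
qed

text \<open>The rational function \<open>f\<^sub>0 / l ^ d\<^sub>0\<close> on
  \<open>f\<^sub>1\<close> has exactly this divisor.\<close>

lemma n_torsion:
  assumes l: "l \<in> forms 1" "\<not> f\<^sub>1 dvd l" and n: "n dvd d\<^sub>0"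
  shows "(\<lambda>P. int n * torsion_divisor l P) \<in> principal_divisors f\<^sub>1"
proof (rule C.principal_divisorsI[OF D.form _ nd(2)])
  show "l ^ d\<^sub>0 \<in> forms d\<^sub>0" using forms_power[OF l(1), of d\<^sub>0] by simp
  show "\<not> f\<^sub>1 dvd l ^ d\<^sub>0" using C.v_power[OF l] by blast
  show "(\<lambda>P. int n * torsion_divisor l P) = (\<lambda>P. int (curve_ord f\<^sub>1 P f\<^sub>0) - int (curve_ord f\<^sub>1 P (l ^ d\<^sub>0)))"
  proof
    fix P
    have "n * (d\<^sub>0 div n) = d\<^sub>0" using n by simp
    then have "int n * int (d\<^sub>0 div n) = int d\<^sub>0" by (simp flip: of_nat_mult)
    then have "int n * torsion_divisor l P = (if P \<in> S then int n else 0) - int d\<^sub>0 * int (curve_ord f\<^sub>1 P l)"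
      by (simp add: torsion_divisor_def right_diff_distrib mult.assoc[symmetric])
    also have "\<dots> = int (curve_ord f\<^sub>1 P f\<^sub>0) - int (curve_ord f\<^sub>1 P (l ^ d\<^sub>0))"
      using C.v_power[OF l, of d\<^sub>0 P] by (simp add: v1)
    finally show "int n * torsion_divisor l P = int (curve_ord f\<^sub>1 P f\<^sub>0) - int (curve_ord f\<^sub>1 P (l ^ d\<^sub>0))" .
  qed
qed

text \<open>Plane curves are linearly normal, so a multiple \<open>j \<delta>\<close> of the contact divisor linearly equivalent
  to a multiple of a line section is cut out by a form.\<close>

lemma principal_multiple_cut:
  assumes l: "l \<in> forms 1" "\<not> f\<^sub>1 dvd l"
    and princ: "(\<lambda>P. int j * torsion_divisor l P) \<in> principal_divisors f\<^sub>1"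
  obtains G where "G \<in> forms (j * (d\<^sub>0 div n))" "\<not> f\<^sub>1 dvd G" "\<forall>P. curve_ord f\<^sub>1 P G = (if P \<in> S then j else 0)"
proof -
  define e where "e = j * (d\<^sub>0 div n)"
  obtain A B m where AB: "A \<in> forms m" "B \<in> forms m" "\<not> f\<^sub>1 dvd A" "\<not> f\<^sub>1 dvd B"
    "(\<lambda>P. int j * torsion_divisor l P) = (\<lambda>P. int (curve_ord f\<^sub>1 P A) - int (curve_ord f\<^sub>1 P B))"
    by (rule C.principal_divisorsE[OF princ])
  have le: "l ^ e \<in> forms e" "\<not> f\<^sub>1 dvd l ^ e" "\<And>P. curve_ord f\<^sub>1 P (l ^ e) = e * curve_ord f\<^sub>1 P l"
    using forms_power[OF l(1), of e] C.v_power[OF l, of e] by auto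
  \<comment> \<open>If \<open>A / B\<close> has divisor \<open>j\<close> times the torsion divisor,
    then \<open>A * l ^ e\<close> vanishes to the order of \<open>B\<close> everywhere and to
    \<open>j\<close> more at the points of \<open>S\<close>. Noether's theorem then divides it by
    \<open>B\<close> modulo \<open>f\<^sub>1\<close>.\<close>
  let ?H = "A * l ^ e"
  have H: "?H \<in> forms (m + e)" "\<not> f\<^sub>1 dvd ?H" using forms_mult[OF AB(1) le(1)] C.not_dvd_mult[OF AB(3) le(2)] .
  have vH: "curve_ord f\<^sub>1 P ?H = (if P \<in> S then j else 0) + curve_ord f\<^sub>1 P B" for P
  proof -
    have "int j * torsion_divisor l P = int (curve_ord f\<^sub>1 P A) - int (curve_ord f\<^sub>1 P B)"
      using fun_cong[OF AB(5), of P] .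
    moreover have "int j * torsion_divisor l P = int (if P \<in> S then j else 0) - int e * int (curve_ord f\<^sub>1 P l)"
      by (simp add: torsion_divisor_def e_def right_diff_distrib mult.assoc)
    ultimately have "int (curve_ord f\<^sub>1 P A) + int (e * curve_ord f\<^sub>1 P l) = int (if P \<in> S then j else 0) + int (curve_ord f\<^sub>1 P B)"
      by simp
    then have "int (curve_ord f\<^sub>1 P A + e * curve_ord f\<^sub>1 P l) = int ((if P \<in> S then j else 0) + curve_ord f\<^sub>1 P B)"
      by (simp only: of_nat_add)
    then have "curve_ord f\<^sub>1 P A + e * curve_ord f\<^sub>1 P l = (if P \<in> S then j else 0) + curve_ord f\<^sub>1 P B"
      by (simp only: of_nat_eq_iff)
    then show ?thesis by (simp only: C.v_mult[OF AB(1,3) le(1,2)] le(3))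
  qed
  have "\<exists>a c. ?H = a * f\<^sub>1 + c * B"
    by (rule C.Noether_v[OF AB(2,4) H]) (simp add: vH)
  then obtain a0 c0 where "?H = a0 * f\<^sub>1 + c0 * B" by blast
  then obtain a G where G: "?H = a * f\<^sub>1 + G * B" "G \<in> forms (m + e - m)"
    by (rule ideal2_homogeneous[OF C.form AB(2) H(1)])
  have GB: "G * B = ?H + (- a) * f\<^sub>1" by (simp add: G(1))
  have Gf: "G \<in> forms e" using G(2) by simp
  have Gnd: "\<not> f\<^sub>1 dvd G"
  proof
    assume "f\<^sub>1 dvd G"
    then have "f\<^sub>1 dvd a * f\<^sub>1 + G * B" by simp
    with H(2) show False unfolding G(1) by blast
  qed
  have "\<forall>P. curve_ord f\<^sub>1 P G = (if P \<in> S then j else 0)"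
  proof
    fix P
    show "curve_ord f\<^sub>1 P G = (if P \<in> S then j else 0)"
      using C.v_congr[OF H GB, of P] C.v_mult[OF Gf Gnd AB(2,4), of P] vH[of P] by simp
  qed
  with Gf Gnd show thesis unfolding e_def by (intro that)
qed

section \<open>Comparing the classes on the two curves\<close>

lemma cut_transfer:
  assumes G: "G \<in> forms m" "\<not> f\<^sub>0 dvd G" "\<not> f\<^sub>1 dvd G" "\<forall>P. curve_ord f\<^sub>1 P G = (if P \<in> S then j else 0)"
    and j: "j \<le> n" and P: "P \<in> S"
  shows "j \<le> curve_ord f\<^sub>0 P G"
proof -
  have P01: "mpoly_eval (pt P) f\<^sub>0 = 0" "mpoly_eval (pt P) f\<^sub>1 = 0" using P by (auto simp: S_def)
  note cp0 = D.curve_point_at[OF P01(1)] and cp1 = C.curve_point_at[OF P01(2)]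
  have "C.ord_eq_at P j G" using C.ord_eq_v[OF P01(2) G(1,3)] G(4) P by simp
  then have "C.ord_ge_at P j G" by (rule curve_point.ord_eq_imp_ge[OF cp1 _ order_refl])
  moreover have "D.ord_eq_at P n f\<^sub>1" using D.ord_eq_v[OF P01(1) C.form nd(1)] v0 P by simp
  then have "D.ord_ge_at P j f\<^sub>1" by (rule curve_point.ord_eq_imp_ge[OF cp0 _ j])
  ultimately have "D.ord_ge_at P j G" by (rule ord_ge_transfer[OF cp0 cp1, rotated])
  then show ?thesis by (rule curve_point.ord_eq_ge_le[OF cp0 D.ord_eq_v[OF P01(1) G(1,2)]])
qed

lemma low_degree_not_multiple:
  assumes "G \<in> forms e" "e < d\<^sub>0" "G \<noteq> 0"
  shows "\<not> f\<^sub>0 dvd G"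
proof
  assume "f\<^sub>0 dvd G"
  then obtain k where k: "G = f\<^sub>0 * k" by blast
  then obtain i i' where "i + i' = e" "f\<^sub>0 \<in> forms i" using form_factor[of f\<^sub>0 k e] assms by auto
  then show False using forms_degree_unique[OF D.form _ D.nonzero, of i] assms(2) by simp
qed

text \<open>The form cutting out \<open>j \<delta>\<close> on \<open>f\<^sub>1\<close> has contact at least \<open>j\<close> with \<open>f\<^sub>0\<close>, so Bezout on \<open>f\<^sub>0\<close>
  bounds its degree from below.\<close>

lemma small_multiple:
  assumes l: "l \<in> forms 1" "\<not> f\<^sub>1 dvd l" and n: "n dvd d\<^sub>0" and j: "0 < j" "j < n"
    and princ: "(\<lambda>P. int j * torsion_divisor l P) \<in> principal_divisors f\<^sub>1"
  obtains G where "G \<in> forms (j * (d\<^sub>0 div n))" "\<not> f\<^sub>0 dvd G" "\<forall>P\<in>S. j \<le> curve_ord f\<^sub>0 P G"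
    "j * card S \<le> d\<^sub>0 * (j * (d\<^sub>0 div n))" "n * (d\<^sub>0 * (j * (d\<^sub>0 div n))) = j * (d\<^sub>0 * d\<^sub>0)"
proof -
  obtain G where G: "G \<in> forms (j * (d\<^sub>0 div n))" "\<not> f\<^sub>1 dvd G" "\<forall>P. curve_ord f\<^sub>1 P G = (if P \<in> S then j else 0)"
    by (rule principal_multiple_cut[OF l princ])
  have dn: "n * (d\<^sub>0 div n) = d\<^sub>0" using n by simp
  then have "0 < d\<^sub>0 div n" using D.d_pos by (metis mult_0_right neq0_conv)
  then have "j * (d\<^sub>0 div n) < n * (d\<^sub>0 div n)" using j by simp
  \<comment> \<open>For \<open>j < n\<close> the degree of \<open>G\<close> is below
    \<open>d\<^sub>0\<close>, so \<open>f\<^sub>0\<close> cannot divide it.\<close>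
  then have nd0: "\<not> f\<^sub>0 dvd G" using low_degree_not_multiple[OF G(1)] G(2) dn by auto
  have ge: "j \<le> curve_ord f\<^sub>0 P G" if "P \<in> S" for P
    using cut_transfer[OF G(1) nd0 G(2,3) _ that] j by simp
  have "j * card S = (\<Sum>P\<in>S. j)" by simp
  also have "\<dots> \<le> (\<Sum>P\<in>S. curve_ord f\<^sub>0 P G)" using ge by (rule sum_mono)
  also have "\<dots> \<le> (\<Sum>P\<in>S \<union> {P. curve_ord f\<^sub>0 P G \<noteq> 0}. curve_ord f\<^sub>0 P G)"
    by (rule sum_mono2) (use finite_S D.finite_support[OF G(1) nd0] in auto)
  also have "\<dots> = D.div_degree G"
    by (rule D.div_degree_superset[symmetric]) (use finite_S D.finite_support[OF G(1) nd0] in auto)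
  also have "\<dots> = d\<^sub>0 * (j * (d\<^sub>0 div n))" by (rule D.Bezout[OF G(1) nd0])
  finally have "j * card S \<le> d\<^sub>0 * (j * (d\<^sub>0 div n))" .
  moreover have "n * (d\<^sub>0 * (j * (d\<^sub>0 div n))) = j * (d\<^sub>0 * d\<^sub>0)"
  proof -
    have "n * (d\<^sub>0 * (j * (d\<^sub>0 div n))) = j * (d\<^sub>0 * (n * (d\<^sub>0 div n)))" by (simp only: mult_ac)
    then show ?thesis by (simp only: dn)
  qed
  moreover have "\<forall>P\<in>S. j \<le> curve_ord f\<^sub>0 P G" using ge by blast
  ultimately show thesis using G(1) nd0 by (intro that)
qed

lemma order_eq_n:
  assumes l: "l \<in> forms 1" "\<not> f\<^sub>1 dvd l" and n: "n dvd d\<^sub>0" and less: "d\<^sub>0 < d\<^sub>1"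
  shows "group.ord (Pic0 f\<^sub>1) (Pic0_class f\<^sub>1 (torsion_divisor l)) = n"
proof -
  let ?o = "group.ord (Pic0 f\<^sub>1) (Pic0_class f\<^sub>1 (torsion_divisor l))"
  note iff = C.ord_Pic0_dvd_iff[OF torsion_divisor[OF l n]]
  have on: "?o dvd n" by (rule iff[THEN iffD2, OF n_torsion[OF l n]])
  have princ: "(\<lambda>P. int ?o * torsion_divisor l P) \<in> principal_divisors f\<^sub>1" by (rule iff[of ?o, THEN iffD1, OF dvd_refl])
  show ?thesis
  proof (rule ccontr)
    assume "?o \<noteq> n"
    moreover have "0 < ?o" using on n_pos by (metis dvd_0_left_iff neq0_conv)
    moreover have "?o \<le> n" using on n_pos by (rule dvd_imp_le)
    ultimately have j: "0 < ?o" "?o < n" by simp_all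
    obtain G where "?o * card S \<le> d\<^sub>0 * (?o * (d\<^sub>0 div n))" "n * (d\<^sub>0 * (?o * (d\<^sub>0 div n))) = ?o * (d\<^sub>0 * d\<^sub>0)"
      by (rule small_multiple[OF l n j princ])
    then have "n * (?o * card S) \<le> ?o * (d\<^sub>0 * d\<^sub>0)" by (metis mult_le_mono2)
    moreover have "n * (?o * card S) = ?o * (d\<^sub>0 * d\<^sub>1)" by (simp only: mult.left_commute[of n] card_S)
    ultimately have "d\<^sub>0 * d\<^sub>1 \<le> d\<^sub>0 * d\<^sub>0" using j(1) by simp
    then show False using D.d_pos less by simp
  qed
qed

lemma principal_transfer:
  assumes l: "l \<in> forms 1" "\<not> f\<^sub>1 dvd l" and l': "l' \<in> forms 1" "\<not> f\<^sub>0 dvd l'"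
    and n: "n dvd d\<^sub>0" and eq: "d\<^sub>0 = d\<^sub>1" and j: "0 < j" "j \<le> n"
    and princ: "(\<lambda>P. int j * torsion_divisor l P) \<in> principal_divisors f\<^sub>1"
  shows "(\<lambda>P. int j * contact_pair.torsion_divisor f\<^sub>1 f\<^sub>0 d\<^sub>1 n l' P) \<in> principal_divisors f\<^sub>0"
proof -
  interpret s: contact_pair f\<^sub>1 f\<^sub>0 d\<^sub>1 d\<^sub>0 n by (rule swap)
  have S: "s.S = S" by (auto simp: S_def s.S_def)
  show ?thesis
  \<comment> \<open>For \<open>j = n\<close> the degree of \<open>G\<close> would no longer be below
    \<open>d\<^sub>0\<close>, but here \<open>f\<^sub>1\<close> itself cuts out \<open>n\<close>
    times the points of \<open>S\<close> on \<open>f\<^sub>0\<close>.\<close>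
  proof (cases "j = n")
    case True
    then show ?thesis using s.n_torsion[OF l'] n eq by simp
  next
    case False
    then have jn: "j < n" using j(2) by simp
    obtain G where G: "G \<in> forms (j * (d\<^sub>0 div n))" "\<not> f\<^sub>0 dvd G" "\<forall>P\<in>S. j \<le> curve_ord f\<^sub>0 P G"
      "n * (d\<^sub>0 * (j * (d\<^sub>0 div n))) = j * (d\<^sub>0 * d\<^sub>0)"
      by (rule small_multiple[OF l n j(1) jn princ])
    let ?e = "j * (d\<^sub>0 div n)" and ?T = "S \<union> {P. curve_ord f\<^sub>0 P G \<noteq> 0}"
    have T: "finite ?T" using finite_S D.finite_support[OF G(1,2)] by simp
    have "n * (d\<^sub>0 * ?e) = n * (j * card S)"
      using G(4) card_S eq by (simp only: mult.left_commute[of n])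
    then have "d\<^sub>0 * ?e = j * card S" using n_pos by simp
    then have "(\<Sum>P\<in>?T. curve_ord f\<^sub>0 P G) = j * card S"
      using D.Bezout[OF G(1,2)] D.div_degree_superset[OF T, of G] by simp
    also have "j * card S = (\<Sum>P\<in>?T. if P \<in> S then j else 0)"
    proof -
      have "?T \<inter> S = S" by blast
      then show ?thesis using T by (simp add: sum.If_cases)
    qed
    finally have sum_eq: "(\<Sum>P\<in>?T. curve_ord f\<^sub>0 P G) = (\<Sum>P\<in>?T. if P \<in> S then j else 0)" .
    \<comment> \<open>A pointwise inequality between functions with equal sums is an
      equality.\<close>
    have vG: "curve_ord f\<^sub>0 P G = (if P \<in> S then j else 0)" for P
    proof (cases "P \<in> ?T")
      case True
      show ?thesis
      proof (rule ccontr)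
        assume ne: "curve_ord f\<^sub>0 P G \<noteq> (if P \<in> S then j else 0)"
        have le: "(if Q \<in> S then j else 0) \<le> curve_ord f\<^sub>0 Q G" for Q using G(3) by simp
        have "(\<Sum>P\<in>?T. if P \<in> S then j else 0) < (\<Sum>P\<in>?T. curve_ord f\<^sub>0 P G)"
        proof (rule sum_strict_mono_ex1[OF T])
          show "\<forall>Q\<in>?T. (if Q \<in> S then j else 0) \<le> curve_ord f\<^sub>0 Q G" using le by blast
          show "\<exists>Q\<in>?T. (if Q \<in> S then j else 0) < curve_ord f\<^sub>0 Q G"
            using True le[of P] ne by (intro bexI[of _ P]) simp_all
        qed
        with sum_eq show False by simp
      qed
    qed auto
    have le: "l' ^ ?e \<in> forms ?e" "\<not> f\<^sub>0 dvd l' ^ ?e" "\<And>P. curve_ord f\<^sub>0 P (l' ^ ?e) = ?e * curve_ord f\<^sub>0 P l'"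
      using forms_power[OF l'(1), of ?e] D.v_power[OF l', of ?e] by auto
    show ?thesis
    proof (rule D.principal_divisorsI[OF G(1) le(1) G(2) le(2)])
      show "(\<lambda>P. int j * s.torsion_divisor l' P) = (\<lambda>P. int (curve_ord f\<^sub>0 P G) - int (curve_ord f\<^sub>0 P (l' ^ ?e)))"
        unfolding s.torsion_divisor_def S
        by (rule ext) (simp add: vG le(3) eq[symmetric] right_diff_distrib mult.assoc)
    qed
  qed
qed

lemma order_dvd_swap:
  assumes l: "l \<in> forms 1" "\<not> f\<^sub>1 dvd l" and l': "l' \<in> forms 1" "\<not> f\<^sub>0 dvd l'"
    and n: "n dvd d\<^sub>0" and eq: "d\<^sub>0 = d\<^sub>1"
  shows "group.ord (Pic0 f\<^sub>0) (Pic0_class f\<^sub>0 (contact_pair.torsion_divisor f\<^sub>1 f\<^sub>0 d\<^sub>1 n l')) dvd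
    group.ord (Pic0 f\<^sub>1) (Pic0_class f\<^sub>1 (torsion_divisor l))" (is "?o' dvd ?o")
proof -
  interpret s: contact_pair f\<^sub>1 f\<^sub>0 d\<^sub>1 d\<^sub>0 n by (rule swap)
  note iff = C.ord_Pic0_dvd_iff[OF torsion_divisor[OF l n]]
  have n': "n dvd d\<^sub>1" using n eq by simp
  note iff' = D.ord_Pic0_dvd_iff[OF s.torsion_divisor[OF l' n']]
  have on: "?o dvd n" by (rule iff[THEN iffD2, OF n_torsion[OF l n]])
  have "0 < ?o" using on n_pos by (metis dvd_0_left_iff neq0_conv)
  moreover have "?o \<le> n" using on n_pos by (rule dvd_imp_le)
  moreover have "(\<lambda>P. int ?o * torsion_divisor l P) \<in> principal_divisors f\<^sub>1" by (rule iff[of ?o, THEN iffD1, OF dvd_refl])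
  ultimately have "(\<lambda>P. int ?o * s.torsion_divisor l' P) \<in> principal_divisors f\<^sub>0"
    by (rule principal_transfer[OF l l' n eq])
  then show ?thesis by (rule iff'[of ?o, THEN iffD2])
qed

end

section \<open>Smoothness is an open condition\<close>

text \<open>Two rings are meant: functions of one complex parameter continuous at \<open>0\<close>,
  and polynomial functions of the coefficients of a form. One openness argument serves both.\<close>

definition fun_subring :: "('x \<Rightarrow> complex) set \<Rightarrow> bool" where
  "fun_subring \<F> \<longleftrightarrow> (\<lambda>_. 1) \<in> \<F> \<and>
    (\<forall>F\<in>\<F>. \<forall>G\<in>\<F>. (\<lambda>x. F x * G x) \<in> \<F> \<and> (\<lambda>x. F x - G x) \<in> \<F>)"

lemma fun_subring_mult: "fun_subring \<F> \<Longrightarrow> F \<in> \<F> \<Longrightarrow> G \<in> \<F> \<Longrightarrow> (\<lambda>x. F x * G x) \<in> \<F>"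
  and fun_subring_diff: "fun_subring \<F> \<Longrightarrow> F \<in> \<F> \<Longrightarrow> G \<in> \<F> \<Longrightarrow> (\<lambda>x. F x - G x) \<in> \<F>"
  unfolding fun_subring_def by blast+

text \<open>Fraction-free Gaussian elimination, which replaces a maximal minor.\<close>

lemma trivial_kernel_open:
  fixes A :: "'s \<Rightarrow> 'q \<Rightarrow> 'x \<Rightarrow> complex"
  assumes \<F>: "fun_subring \<F>" and Q: "finite Q"
    and A: "\<And>s q. s \<in> R \<Longrightarrow> q \<in> Q \<Longrightarrow> A s q \<in> \<F>"
    and x0: "\<And>w. (\<And>s. s \<in> R \<Longrightarrow> (\<Sum>q\<in>Q. A s q x0 * w q) = 0) \<Longrightarrow> \<forall>q\<in>Q. w q = 0"
  shows "\<exists>D\<in>\<F>. D x0 \<noteq> 0 \<and> (\<forall>x. D x \<noteq> 0 \<longrightarrow>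
    (\<forall>w. (\<forall>s\<in>R. (\<Sum>q\<in>Q. A s q x * w q) = 0) \<longrightarrow> (\<forall>q\<in>Q. w q = 0)))"
  using Q A x0
proof (induction Q arbitrary: A rule: finite_induct)
  case empty
  show ?case using \<F> by (intro bexI[of _ "\<lambda>_. 1"]) (auto simp: fun_subring_def)
next
  case (insert q0 Q)
  have "\<exists>s\<in>R. A s q0 x0 \<noteq> 0"
  proof (rule ccontr)
    assume no: "\<not> ?thesis"
    have "\<forall>q\<in>insert q0 Q. (if q = q0 then 1 else 0 :: complex) = 0"
    proof (rule insert.prems(2))
      fix s assume "s \<in> R"
      then show "(\<Sum>q\<in>insert q0 Q. A s q x0 * (if q = q0 then 1 else 0)) = 0"
        using no insert.hyps by (auto intro!: sum.neutral)
    qed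
    then show False by simp
  qed
  then obtain s0 where s0: "s0 \<in> R" "A s0 q0 x0 \<noteq> 0" by blast
  define A' where "A' = (\<lambda>s q x. A s0 q0 x * A s q x - A s q0 x * A s0 q x)"
  have A'F: "A' s q \<in> \<F>" if "s \<in> R" "q \<in> Q" for s q
  proof -
    have "A s0 q0 \<in> \<F>" "A s q \<in> \<F>" "A s q0 \<in> \<F>" "A s0 q \<in> \<F>" using insert.prems(1) s0(1) that by auto
    then show ?thesis unfolding A'_def by (intro fun_subring_diff[OF \<F>] fun_subring_mult[OF \<F>])
  qed
  have A'_sum: "(\<Sum>q\<in>Q. A' s q x * w q) = A s0 q0 x * (\<Sum>q\<in>Q. A s q x * w q) - A s q0 x * (\<Sum>q\<in>Q. A s0 q x * w q)" for s x w
    by (simp add: A'_def sum_distrib_left sum_subtractf left_diff_distrib mult.assoc)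
  have "\<forall>q\<in>Q. w q = 0" if w: "\<And>s. s \<in> R \<Longrightarrow> (\<Sum>q\<in>Q. A' s q x0 * w q) = 0" for w
  proof -
    define w' where "w' = w(q0 := - (\<Sum>q\<in>Q. A s0 q x0 * w q) / A s0 q0 x0)"
    have sum_w': "(\<Sum>q\<in>insert q0 Q. A s q x0 * w' q) = A s q0 x0 * w' q0 + (\<Sum>q\<in>Q. A s q x0 * w q)" for s
    proof -
      have "(\<Sum>q\<in>Q. A s q x0 * w' q) = (\<Sum>q\<in>Q. A s q x0 * w q)"
        using insert.hyps by (intro sum.cong) (auto simp: w'_def)
      then show ?thesis using insert.hyps by simp
    qed
    have "\<forall>q\<in>insert q0 Q. w' q = 0"
    proof (rule insert.prems(2))
      fix s assume "s \<in> R"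
      then have "A s0 q0 x0 * (\<Sum>q\<in>Q. A s q x0 * w q) = A s q0 x0 * (\<Sum>q\<in>Q. A s0 q x0 * w q)"
        using w[of s] by (simp add: A'_sum)
      then show "(\<Sum>q\<in>insert q0 Q. A s q x0 * w' q) = 0"
        unfolding sum_w' using s0(2) by (simp add: w'_def field_simps)
    qed
    then show ?thesis using insert.hyps by (auto simp: w'_def split: if_splits)
  qed
  then obtain D where D: "D \<in> \<F>" "D x0 \<noteq> 0" "\<And>x w. D x \<noteq> 0 \<Longrightarrow>
      (\<And>s. s \<in> R \<Longrightarrow> (\<Sum>q\<in>Q. A' s q x * w q) = 0) \<Longrightarrow> \<forall>q\<in>Q. w q = 0"
    using insert.IH[of A', OF A'F] by blast
  have D': "(\<lambda>x. A s0 q0 x * D x) \<in> \<F>"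
    by (rule fun_subring_mult[OF \<F> insert.prems(1)[OF s0(1)] D(1)]) simp
  show ?case
  proof (rule bexI[OF _ D'], intro conjI allI impI)
    show "A s0 q0 x0 * D x0 \<noteq> 0" using s0(2) D(2) by simp
    fix x w assume x: "A s0 q0 x * D x \<noteq> 0" and w: "\<forall>s\<in>R. (\<Sum>q\<in>insert q0 Q. A s q x * w q) = 0"
    have w': "A s q0 x * w q0 = - (\<Sum>q\<in>Q. A s q x * w q)" if "s \<in> R" for s
      using bspec[OF w that] insert.hyps by (simp add: eq_neg_iff_add_eq_0)
    have Q0: "\<forall>q\<in>Q. w q = 0"
    proof (rule D(3))
      show "D x \<noteq> 0" using x by simp
      fix s assume s: "s \<in> R"
      have "A s0 q0 x * (A s q0 x * w q0) = A s q0 x * (A s0 q0 x * w q0)" by (rule mult.left_commute)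
      then show "(\<Sum>q\<in>Q. A' s q x * w q) = 0"
        unfolding A'_sum w'[OF s] w'[OF s0(1)] by simp
    qed
    then have "A s0 q0 x * w q0 = 0" using w'[OF s0(1)] by simp
    with Q0 x show "\<forall>q\<in>insert q0 Q. w q = 0" by simp
  qed
qed

text \<open>The partial derivatives of \<open>F\<close>, of degree \<open>b\<close>, multiplied by
  monomials of degree \<open>a\<close>, span all forms of degree \<open>a + b\<close>. It is stated
  dually, that no nonzero functional \<open>w\<close> kills them, so that it becomes a trivial
  kernel condition.\<close>

definition spans_by_partials :: "nat \<Rightarrow> nat \<Rightarrow> 3 mpoly \<Rightarrow> bool" where
  "spans_by_partials a b F \<longleftrightarrow> (\<forall>w. (\<forall>s\<in>mdegs a \<times> UNIV.
      (\<Sum>m\<in>mdegs (a + b). Poly_Mapping.lookup (Poly_Mapping.single (fst s) 1 * mpoly_pderiv (snd s) F) m * w m) = 0)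
    \<longrightarrow> (\<forall>m\<in>mdegs (a + b). w m = 0))"

lemma Euler_formula:
  assumes "F \<in> forms e"
  shows "(\<Sum>i\<in>UNIV. mvar i * mpoly_pderiv i F) = mpoly_const (of_nat e) * F"
proof -
  have mono: "mvar i * mpoly_pderiv i (Poly_Mapping.single m z) = Poly_Mapping.single m (of_nat (Poly_Mapping.lookup m i) * z)"
    for i m z
  proof (cases "Poly_Mapping.lookup m i = 0")
    case False
    then have "Poly_Mapping.single i 1 + (m - Poly_Mapping.single i 1) = m"
      by (intro poly_mapping_eqI) (auto simp: lookup_add lookup_minus lookup_single when_def)
    then show ?thesis by (simp add: mpoly_pderiv_single mvar_def mult_single)
  qed (simp add: mpoly_pderiv_single)
  let ?s = "\<lambda>m. Poly_Mapping.single m (Poly_Mapping.lookup F m)"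
  have "(\<Sum>i\<in>UNIV. mvar i * mpoly_pderiv i F) = (\<Sum>i\<in>UNIV. \<Sum>m\<in>Poly_Mapping.keys F. mvar i * mpoly_pderiv i (?s m))"
    by (subst poly_mapping_sum_singles[of F]) (simp add: mpoly_pderiv_sum sum_distrib_left)
  also have "\<dots> = (\<Sum>m\<in>Poly_Mapping.keys F. \<Sum>i\<in>UNIV. Poly_Mapping.single m (of_nat (Poly_Mapping.lookup m i) * Poly_Mapping.lookup F m))"
    unfolding mono by (rule sum.swap)
  also have "\<dots> = (\<Sum>m\<in>Poly_Mapping.keys F. mpoly_const (of_nat e) * ?s m)"
  proof (rule sum.cong[OF refl])
    fix m assume "m \<in> Poly_Mapping.keys F"
    then have e: "e = (\<Sum>i\<in>UNIV. Poly_Mapping.lookup m i)" using assms by (simp add: forms_iff mdeg_def)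
    have "(\<Sum>i\<in>I. Poly_Mapping.single m (of_nat (Poly_Mapping.lookup m i) * z)) =
        Poly_Mapping.single m (of_nat (\<Sum>i\<in>I. Poly_Mapping.lookup m i) * z)" for I :: "3 set" and z :: complex
      by (induction I rule: infinite_finite_induct) (simp_all add: distrib_right flip: single_add)
    then show "(\<Sum>i\<in>UNIV. Poly_Mapping.single m (of_nat (Poly_Mapping.lookup m i) * Poly_Mapping.lookup F m)) =
        mpoly_const (of_nat e) * ?s m"
      by (simp add: e mpoly_const_def mult_single)
  qed
  also have "\<dots> = mpoly_const (of_nat e) * F"
    by (simp only: sum_distrib_left[symmetric] poly_mapping_sum_singles[symmetric])
  finally show ?thesis .
qed

lemma lookup_sum_eval:
  assumes "h \<in> forms t"
  shows "(\<Sum>m\<in>mdegs t. Poly_Mapping.lookup h m * monom_eval p m) = mpoly_eval p h"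
proof -
  have "Poly_Mapping.keys h \<subseteq> mdegs t" using assms by (auto simp: forms_iff mdegs_def)
  then show ?thesis using ev.subst_superset[of "mdegs t" h p] by (simp add: mpoly_eval_conv_subst)
qed

lemma form_sum_monomials:
  assumes "h \<in> forms t"
  shows "h = (\<Sum>m\<in>mdegs t. mpoly_const (Poly_Mapping.lookup h m) * Poly_Mapping.single m 1)"
proof -
  have "Poly_Mapping.keys h \<subseteq> mdegs t" using assms by (auto simp: forms_iff mdegs_def)
  then have "(\<Sum>m\<in>Poly_Mapping.keys h. Poly_Mapping.single m (Poly_Mapping.lookup h m)) =
      (\<Sum>m\<in>mdegs t. Poly_Mapping.single m (Poly_Mapping.lookup h m))"
    by (intro sum.mono_neutral_left) (auto simp: in_keys_iff)
  then show ?thesis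
    using poly_mapping_sum_singles[of h] by (simp add: mpoly_const_def mult_single)
qed

text \<open>At a singular point \<open>p\<close>, evaluation at \<open>p\<close> would be a nonzero
  functional killing all multiples of the partial derivatives.\<close>

lemma smooth_if_spans:
  assumes F: "F \<in> forms e" and sp: "spans_by_partials a (e - 1) F"
  shows "smooth_curve e F"
  unfolding smooth_curve_iff
proof (intro conjI allI impI F, rule ccontr)
  fix p assume p: "p \<noteq> (\<lambda>_. 0)" and no: "\<nexists>i. mpoly_eval p (mpoly_pderiv i F) \<noteq> 0"
  obtain i where i: "p i \<noteq> 0" using p by auto
  have "\<forall>m\<in>mdegs (a + (e - 1)). monom_eval p m = 0"
    using sp unfolding spans_by_partials_def
  proof (rule allE[where x = "monom_eval p"], elim mp, intro ballI)
    fix s :: "(3 \<Rightarrow>\<^sub>0 nat) \<times> 3" assume s: "s \<in> mdegs a \<times> UNIV"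
    have "Poly_Mapping.single (fst s) 1 * mpoly_pderiv (snd s) F \<in> forms (a + (e - 1))"
      using s by (intro forms_mult forms_single forms_mpoly_pderiv F) (auto simp: mdegs_def)
    then show "(\<Sum>m\<in>mdegs (a + (e - 1)). Poly_Mapping.lookup (Poly_Mapping.single (fst s) 1 * mpoly_pderiv (snd s) F) m * monom_eval p m) = 0"
      using no by (simp add: lookup_sum_eval)
  qed
  moreover have "Poly_Mapping.single i (a + (e - 1)) \<in> mdegs (a + (e - 1))" by (simp add: mdegs_def)
  ultimately have "monom_eval p (Poly_Mapping.single i (a + (e - 1))) = 0" by (rule bspec)
  then show False using i by simp
qed

text \<open>By Euler's formula with \<open>e > 0\<close>, a common zero of the partial derivatives
  lies on the curve, hence is singular. So there is none, and the Nullstellensatz puts all forms of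
  large degree into the ideal of the partial derivatives.\<close>

lemma spans_if_smooth:
  assumes F: "smooth_curve e F" and e: "0 < e"
  shows "\<exists>a. spans_by_partials a (e - 1) F"
proof -
  have Ff: "F \<in> forms e" using F by (simp add: smooth_curve_iff)
  have pd: "mpoly_pderiv i F \<in> forms (e - 1)" for i by (rule forms_mpoly_pderiv[OF Ff])
  define I where "I = {\<Sum>i\<in>UNIV. x i * mpoly_pderiv i F | x. True}"
  have memI: "(\<Sum>i\<in>UNIV. x i * mpoly_pderiv i F) \<in> I" for x unfolding I_def by blast
  have I: "is_ideal I"
    unfolding is_ideal_def
  proof (intro conjI ballI allI)
    show "0 \<in> I" using memI[of "\<lambda>_. 0"] by simp
  next
    fix h h' assume "h \<in> I" "h' \<in> I"
    then obtain x x' where "h = (\<Sum>i\<in>UNIV. x i * mpoly_pderiv i F)" "h' = (\<Sum>i\<in>UNIV. x' i * mpoly_pderiv i F)"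
      unfolding I_def by blast
    then have "h + h' = (\<Sum>i\<in>UNIV. (x i + x' i) * mpoly_pderiv i F)"
      by (simp add: distrib_right sum.distrib)
    then show "h + h' \<in> I" by (simp only: memI)
  next
    fix h r assume "h \<in> I"
    then obtain x where "h = (\<Sum>i\<in>UNIV. x i * mpoly_pderiv i F)" unfolding I_def by blast
    then have "r * h = (\<Sum>i\<in>UNIV. (r * x i) * mpoly_pderiv i F)" by (simp add: sum_distrib_left mult.assoc)
    then show "r * h \<in> I" by (simp only: memI)
  qed
  have hcI: "hc k h = (\<Sum>i\<in>UNIV. (if e - 1 \<le> k then hc (k - (e - 1)) (x i) else 0) * mpoly_pderiv i F)"
    if "h = (\<Sum>i\<in>UNIV. x i * mpoly_pderiv i F)" for h x k
    unfolding that hc_sum by (rule sum.cong) (auto simp: hc_mult_form[OF pd])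
  have "\<exists>N0. \<forall>N\<ge>N0. forms N \<subseteq> I"
  proof (rule projective_Nullstellensatz[OF I])
    fix h k assume "h \<in> I"
    then obtain x where "h = (\<Sum>i\<in>UNIV. x i * mpoly_pderiv i F)" unfolding I_def by blast
    from hcI[OF this, of k] show "hc k h \<in> I" by (simp only: memI)
  next
    fix p :: "3 \<Rightarrow> complex" assume p: "p \<noteq> (\<lambda>_. 0)"
    have "\<exists>i. mpoly_eval p (mpoly_pderiv i F) \<noteq> 0"
    proof (rule ccontr)
      assume no: "\<nexists>i. mpoly_eval p (mpoly_pderiv i F) \<noteq> 0"
      have "mpoly_eval p (mpoly_const (of_nat e) * F) = 0"
        unfolding Euler_formula[OF Ff, symmetric] using no by simp
      then have "mpoly_eval p F = 0" using e by simp
      with F p no show False unfolding smooth_curve_iff by blast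
    qed
    then obtain i where i: "mpoly_eval p (mpoly_pderiv i F) \<noteq> 0" by blast
    have "mpoly_pderiv i F = (\<Sum>j\<in>UNIV. (if j = i then 1 else 0) * mpoly_pderiv j F)"
    proof -
      have "(\<Sum>j\<in>UNIV. (if j = i then 1 else 0) * mpoly_pderiv j F) = (\<Sum>j\<in>{i}. (if j = i then 1 else 0) * mpoly_pderiv j F)"
        by (rule sum.mono_neutral_right) auto
      then show ?thesis by simp
    qed
    then have "mpoly_pderiv i F \<in> I" using memI[of "\<lambda>j. if j = i then 1 else 0"] by (simp only:)
    with i show "\<exists>q\<in>I. mpoly_eval p q \<noteq> 0" by blast
  qed
  then obtain a where a: "\<And>N. N \<ge> a \<Longrightarrow> forms N \<subseteq> I" by blast
  let ?N = "a + (e - 1)"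
  have "spans_by_partials a (e - 1) F"
    unfolding spans_by_partials_def
  proof (intro allI impI ballI)
    fix w m0 assume w: "\<forall>s\<in>mdegs a \<times> UNIV. (\<Sum>m\<in>mdegs ?N.
        Poly_Mapping.lookup (Poly_Mapping.single (fst s) 1 * mpoly_pderiv (snd s) F) m * w m) = 0" and m0: "m0 \<in> mdegs ?N"
    define \<Lambda> where "\<Lambda> = (\<lambda>h. \<Sum>m\<in>mdegs ?N. Poly_Mapping.lookup h m * w m)"
    have \<Lambda>_sum: "\<Lambda> (sum h J) = (\<Sum>j\<in>J. \<Lambda> (h j))" for h :: "'j \<Rightarrow> 3 mpoly" and J
      unfolding \<Lambda>_def lookup_sum sum_distrib_right by (rule sum.swap)
    have \<Lambda>_const: "\<Lambda> (mpoly_const z * h) = z * \<Lambda> h" for z h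
      unfolding \<Lambda>_def by (simp add: sum_distrib_left mult.assoc)
    have \<Lambda>0: "\<Lambda> (x * mpoly_pderiv i F) = 0" if "x \<in> forms a" for x i
    proof -
      have "x * mpoly_pderiv i F = (\<Sum>m\<in>mdegs a. mpoly_const (Poly_Mapping.lookup x m) * (Poly_Mapping.single m 1 * mpoly_pderiv i F))"
        by (subst form_sum_monomials[OF that]) (simp only: sum_distrib_right mult.assoc)
      also have "\<Lambda> \<dots> = (\<Sum>m\<in>mdegs a. Poly_Mapping.lookup x m * \<Lambda> (Poly_Mapping.single m 1 * mpoly_pderiv i F))"
        unfolding \<Lambda>_sum \<Lambda>_const ..
      also have "\<dots> = 0"
      proof (rule sum.neutral, rule ballI)
        fix m assume "m \<in> mdegs a"
        then have "(m, i) \<in> mdegs a \<times> UNIV" by simp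
        from bspec[OF w this] show "Poly_Mapping.lookup x m * \<Lambda> (Poly_Mapping.single m 1 * mpoly_pderiv i F) = 0"
          unfolding \<Lambda>_def by simp
      qed
      finally show ?thesis .
    qed
    let ?h = "Poly_Mapping.single m0 1 :: 3 mpoly"
    have h: "?h \<in> forms ?N" using m0 by (intro forms_single) (simp add: mdegs_def)
    moreover have "forms ?N \<subseteq> I" by (rule a) simp
    ultimately obtain x where x: "?h = (\<Sum>i\<in>UNIV. x i * mpoly_pderiv i F)" unfolding I_def by blast
    have "hc ?N ?h = (\<Sum>i\<in>UNIV. hc a (x i) * mpoly_pderiv i F)"
      using hcI[OF x, of ?N] by simp
    then have "?h = (\<Sum>i\<in>UNIV. hc a (x i) * mpoly_pderiv i F)" using hc_form[OF h, of ?N] by simp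
    then have "\<Lambda> ?h = (\<Sum>i\<in>UNIV. \<Lambda> (hc a (x i) * mpoly_pderiv i F))" by (simp only: \<Lambda>_sum)
    then have "\<Lambda> ?h = 0" by (simp add: \<Lambda>0)
    moreover have "\<Lambda> ?h = w m0"
      using m0 by (simp add: \<Lambda>_def lookup_single when_def if_distrib[of "\<lambda>z. z * _"] cong: if_cong)
    ultimately show "w m0 = 0" by simp
  qed
  then show ?thesis by blast
qed

lemma smooth_family_open:
  assumes \<F>: "fun_subring \<F>" and e: "0 < e"
    and entries: "\<And>m i m'. (\<lambda>x. Poly_Mapping.lookup (Poly_Mapping.single m 1 * mpoly_pderiv i (F x)) m') \<in> \<F>"
    and x0: "smooth_curve e (F x0)"
  shows "\<exists>D\<in>\<F>. D x0 \<noteq> 0 \<and> (\<forall>x. F x \<in> forms e \<longrightarrow> D x \<noteq> 0 \<longrightarrow> smooth_curve e (F x))"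
proof -
  obtain a where a: "spans_by_partials a (e - 1) (F x0)" using spans_if_smooth[OF x0 e] by blast
  define A where "A = (\<lambda>s m x. Poly_Mapping.lookup (Poly_Mapping.single (fst s) 1 * mpoly_pderiv (snd s) (F x)) m)"
  have "\<exists>D\<in>\<F>. D x0 \<noteq> 0 \<and> (\<forall>x. D x \<noteq> 0 \<longrightarrow> (\<forall>w. (\<forall>s\<in>mdegs a \<times> UNIV.
      (\<Sum>q\<in>mdegs (a + (e - 1)). A s q x * w q) = 0) \<longrightarrow> (\<forall>q\<in>mdegs (a + (e - 1)). w q = 0)))"
  proof (rule trivial_kernel_open[OF \<F> finite_mdegs])
    show "A s q \<in> \<F>" for s q unfolding A_def by (rule entries)
    show "\<forall>q\<in>mdegs (a + (e - 1)). w q = 0"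
      if "\<And>s. s \<in> mdegs a \<times> UNIV \<Longrightarrow> (\<Sum>q\<in>mdegs (a + (e - 1)). A s q x0 * w q) = 0" for w
      using a that unfolding spans_by_partials_def A_def by blast
  qed
  then obtain D where D: "D \<in> \<F>" "D x0 \<noteq> 0" "\<And>x. D x \<noteq> 0 \<Longrightarrow> spans_by_partials a (e - 1) (F x)"
    unfolding spans_by_partials_def A_def by blast
  then show ?thesis using smooth_if_spans by blast
qed

section \<open>Polynomial functions of the coefficients of a form\<close>

text \<open>Agreement with a polynomial is demanded only on \<open>forms t\<close>; elsewhere the
  values are arbitrary.\<close>

definition coeff_functions :: "nat \<Rightarrow> (3 mpoly \<Rightarrow> complex) set" where
  "coeff_functions t = {F. \<exists>p. \<forall>g\<in>forms t. mpoly_eval (Poly_Mapping.lookup g) p = F g}"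

lemma coeff_functions_affine:
  assumes "\<And>g. g \<in> forms t \<Longrightarrow> F g = z + (\<Sum>m\<in>mdegs t. Poly_Mapping.lookup g m * c m)"
  shows "F \<in> coeff_functions t"
  unfolding coeff_functions_def
  by (rule CollectI, rule exI[of _ "mpoly_const z + (\<Sum>m\<in>mdegs t. mvar m * mpoly_const (c m))"])
    (simp add: assms)

lemma fun_subring_coeff_functions: "fun_subring (coeff_functions t)"
  unfolding fun_subring_def
proof (intro conjI ballI)
  show "(\<lambda>_. 1) \<in> coeff_functions t"
    unfolding coeff_functions_def by (rule CollectI, rule exI[of _ 1]) simp
  fix F G assume "F \<in> coeff_functions t" "G \<in> coeff_functions t"
  then obtain p q where pq: "\<forall>g\<in>forms t. mpoly_eval (Poly_Mapping.lookup g) p = F g"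
    "\<forall>g\<in>forms t. mpoly_eval (Poly_Mapping.lookup g) q = G g" unfolding coeff_functions_def by blast
  show "(\<lambda>x. F x * G x) \<in> coeff_functions t"
    unfolding coeff_functions_def by (rule CollectI, rule exI[of _ "p * q"]) (simp add: pq)
  show "(\<lambda>x. F x - G x) \<in> coeff_functions t"
    unfolding coeff_functions_def by (rule CollectI, rule exI[of _ "p - q"]) (simp add: pq)
qed

lemma for_general_formI:
  assumes "D \<in> coeff_functions t" "g\<^sub>0 \<in> forms t" "D g\<^sub>0 \<noteq> 0"
    and "\<And>g. g \<in> forms t \<Longrightarrow> D g \<noteq> 0 \<Longrightarrow> Q g"
  shows "for_general_form t Q"
proof -
  obtain p where p: "\<forall>g\<in>forms t. mpoly_eval (Poly_Mapping.lookup g) p = D g"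
    using assms(1) unfolding coeff_functions_def by blast
  define U where "U = {g \<in> forms t. \<exists>q\<in>{p}. mpoly_eval (Poly_Mapping.lookup g) q \<noteq> 0}"
  have U: "g \<in> U \<longleftrightarrow> g \<in> forms t \<and> D g \<noteq> 0" for g unfolding U_def using p by auto
  have "zariski_open_in_forms t U" unfolding zariski_open_in_forms_def U_def by blast
  moreover have "U \<noteq> {}" using U assms(2,3) by blast
  moreover have "\<forall>g\<in>U. Q g" using U assms(4) by blast
  ultimately show ?thesis unfolding for_general_form_def by blast
qed

lemma eval_coeff_function: "mpoly_eval p \<in> coeff_functions t"
  by (rule coeff_functions_affine[where z = 0 and c = "monom_eval p"]) (simp add: lookup_sum_eval)

lemma isCont_mpoly_eval:
  fixes a b :: "'v \<Rightarrow> complex"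
  shows "isCont (\<lambda>s. mpoly_eval (\<lambda>m. a m + s * b m) q) x"
  by (induction q rule: mpoly_induct) (auto intro!: continuous_intros)

text \<open>Nonempty Zariski open sets are dense: along a line through a point of the open set, only
  isolated parameters are excluded.\<close>

lemma for_general_form_meets:
  assumes "for_general_form 1 Q"
  shows "\<exists>l\<in>forms 1. mpoly_eval (pt P) l \<noteq> 0 \<and> Q l"
proof -
  obtain U where U: "zariski_open_in_forms 1 U" "U \<noteq> {}" "\<forall>g\<in>U. Q g"
    using assms unfolding for_general_form_def by blast
  then obtain Sp where Sp: "U = {g \<in> forms 1. \<exists>p\<in>Sp. mpoly_eval (Poly_Mapping.lookup g) p \<noteq> 0}"
    unfolding zariski_open_in_forms_def by blast
  then obtain l q where l: "l \<in> forms 1" "q \<in> Sp" "mpoly_eval (Poly_Mapping.lookup l) q \<noteq> 0" using U(2) by blast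
  obtain i where i: "pt P i \<noteq> 0" using pt_nonzero[of P] by auto
  define L where "L = (\<lambda>s. l + mpoly_const s * mvar i)"
  have L: "L s \<in> forms 1" for s unfolding L_def by (intro forms_add l(1) forms_const_mult forms_mvar)
  have lookup_L: "Poly_Mapping.lookup (L s) = (\<lambda>m. Poly_Mapping.lookup l m + s * Poly_Mapping.lookup (mvar i) m)" for s
    by (simp add: L_def lookup_add fun_eq_iff)
  have "isCont (\<lambda>s. mpoly_eval (Poly_Mapping.lookup (L s)) q) 0"
    unfolding lookup_L by (rule isCont_mpoly_eval)
  moreover have "mpoly_eval (Poly_Mapping.lookup (L 0)) q \<noteq> 0" using l(3) by (simp add: L_def)
  ultimately have ev1: "\<forall>\<^sub>F s in at 0. mpoly_eval (Poly_Mapping.lookup (L s)) q \<noteq> 0"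
    unfolding isCont_def by (rule tendsto_imp_eventually_ne)
  have "\<forall>\<^sub>F s in at 0. s \<noteq> - mpoly_eval (pt P) l / pt P i"
    by (rule eventually_neq_at_within)
  with ev1 have "\<forall>\<^sub>F s in at 0. mpoly_eval (Poly_Mapping.lookup (L s)) q \<noteq> 0 \<and> s \<noteq> - mpoly_eval (pt P) l / pt P i"
    by (rule eventually_conj)
  then obtain s where s: "mpoly_eval (Poly_Mapping.lookup (L s)) q \<noteq> 0" "s \<noteq> - mpoly_eval (pt P) l / pt P i"
    using eventually_happens'[OF at_neq_bot] by blast
  have "L s \<in> U" unfolding Sp using L s(1) l(2) by blast
  moreover have "mpoly_eval (pt P) (L s) \<noteq> 0"
  proof
    assume "mpoly_eval (pt P) (L s) = 0"
    then have "s * pt P i = - mpoly_eval (pt P) l" by (simp add: L_def eq_neg_iff_add_eq_0 add.commute)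
    then have "s = - mpoly_eval (pt P) l / pt P i" by (simp only: nonzero_eq_divide_eq[OF i])
    with s(2) show False by blast
  qed
  ultimately show ?thesis using U(3) L by blast
qed

section \<open>A smooth member of the linear system\<close>

lemma differentiable_vecI:
  fixes F :: "'a::real_normed_vector \<Rightarrow> 'b::euclidean_space ^ 'n::finite"
  assumes "\<And>i. (\<lambda>x. F x $ i) differentiable (at a within T)"
  shows "F differentiable (at a within T)"
  unfolding differentiable_componentwise_within[of F]
proof
  fix b :: "'b ^ 'n" assume "b \<in> Basis"
  then obtain i u where b: "b = axis i u" "u \<in> Basis" by (auto simp: Basis_vec_def)
  have "(\<lambda>x. (F x $ i) \<bullet> u) differentiable (at a within T)"
    using assms[of i] b(2) unfolding differentiable_componentwise_within[of "\<lambda>x. F x $ i"] by blast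
  then show "(\<lambda>x. F x \<bullet> b) differentiable (at a within T)"
    by (simp add: b(1) inner_axis)
qed

lemma differentiable_entry: "(\<lambda>M :: complex ^ 'n ^ 'm. M $ i $ j) differentiable F"
  by (rule bounded_linear_imp_differentiable)
    (rule bounded_linear_compose[OF bounded_linear_vec_nth bounded_linear_vec_nth])

lemma differentiable_mpoly_eval_row:
  "(\<lambda>M :: complex ^ 3 ^ 3. mpoly_eval (\<lambda>j. M $ l $ j) q) differentiable (at a within T)"
proof (induction q rule: mpoly_induct)
  case (mult_var p i)
  then show ?case
    by (simp only: mpoly_eval_simps) (intro differentiable_mult differentiable_entry)
qed auto

text \<open>A nine-parameter family of forms of degree \<open>s + 1\<close>. At a point with
  \<open>p l = 1\<close>, suitable entries in row \<open>l\<close> give any prescribed value and any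
  prescribed derivatives in the two directions other than \<open>l\<close>.\<close>

definition matrix_form :: "nat \<Rightarrow> complex ^ 3 ^ 3 \<Rightarrow> 3 mpoly" where
  "matrix_form s A = (\<Sum>i\<in>UNIV. \<Sum>j\<in>UNIV. mpoly_const (A $ i $ j) * (mvar i ^ s * mvar j))"

lemma matrix_form_forms: "matrix_form s A \<in> forms (s + 1)"
proof -
  have "mvar i ^ s * mvar j \<in> forms (s + 1)" for i j :: 3
    using forms_mult[OF forms_power[OF forms_mvar, of i s] forms_mvar[of j]] by simp
  then show ?thesis unfolding matrix_form_def by (intro forms_sum forms_const_mult)
qed

text \<open>Vanishing at \<open>q\<close> is a linear condition on the matrix, nontrivial because
  \<open>q i ^ s * q i\<close> is nonzero for some \<open>i\<close>; so the solutions form a proper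
  subspace.\<close>

lemma negligible_hyperplane_forms:
  assumes "q \<noteq> (\<lambda>_. 0)"
  shows "negligible {A. mpoly_eval q (matrix_form s A) = 0}" (is "negligible ?N")
proof (rule negligible_lowdim)
  have ev: "mpoly_eval q (matrix_form s A) = (\<Sum>i\<in>UNIV. \<Sum>j\<in>UNIV. A $ i $ j * (q i ^ s * q j))" for A
    by (simp add: matrix_form_def)
  have sub: "subspace ?N"
    unfolding ev
    by (auto simp: subspace_def distrib_right sum.distrib simp flip: scaleR_sum_right)
  obtain i where i: "q i \<noteq> 0" using assms by auto
  have "(axis i (axis i 1) :: complex ^ 3 ^ 3) \<notin> ?N"
  proof -
    have "mpoly_eval q (matrix_form s (axis i (axis i 1))) =
        (\<Sum>i'\<in>UNIV. \<Sum>j\<in>UNIV. if j = i then if i' = i then q i ^ s * q i else 0 else 0)"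
      unfolding ev by (intro sum.cong) (auto simp: axis_def)
    also have "\<dots> = q i ^ s * q i" by simp
    finally show ?thesis using i by simp
  qed
  then have "span ?N \<noteq> UNIV" unfolding span_eq_iff[THEN iffD2, OF sub] by blast
  then have "dim ?N \<noteq> DIM(complex ^ 3 ^ 3)" using dim_eq_full by blast
  then show "dim ?N < DIM(complex ^ 3 ^ 3)" using dim_subset_UNIV[of ?N] by linarith
qed

text \<open>A dimension count in place of Bertini's theorem: in the chart \<open>p l = 1\<close>, the row \<open>l\<close> of \<open>A\<close> is
  determined by the singular point \<open>p\<close> and the other rows, so the bad matrices are the image under a
  differentiable map of a set where row \<open>l\<close> stores \<open>p\<close>, which lies in a hyperplane.\<close>

lemma negligible_singular:
  fixes f\<^sub>0 f\<^sub>1 :: "3 mpoly" and k s :: nat and l :: 3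
  defines "F \<equiv> \<lambda>A. f\<^sub>0 ^ k + f\<^sub>1 * matrix_form s A"
  shows "negligible {A. \<exists>p. p l = 1 \<and> mpoly_eval p f\<^sub>1 \<noteq> 0 \<and> mpoly_eval p (F A) = 0 \<and>
    (\<forall>x. mpoly_eval p (mpoly_pderiv x (F A)) = 0)}" (is "negligible ?B")
proof -
  define E :: "3 \<Rightarrow> 3 \<Rightarrow> 3 mpoly" where "E = (\<lambda>i j. mvar i ^ s * mvar j)"
  \<comment> \<open>If the member \<open>F A\<close> is singular at \<open>p\<close>, then
    \<open>matrix_form s A\<close> has value \<open>r p\<close> there, and
    \<open>\<sigma> x p\<close> below is its derivative in direction \<open>x\<close>.\<close>
  define r where "r = (\<lambda>p. - (mpoly_eval p f\<^sub>0 ^ k) / mpoly_eval p f\<^sub>1)"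
  define \<sigma> where "\<sigma> = (\<lambda>x p. - (mpoly_eval p (mpoly_pderiv x (f\<^sub>0 ^ k)) + r p * mpoly_eval p (mpoly_pderiv x f\<^sub>1)) / mpoly_eval p f\<^sub>1)"
  define rw where "rw = (\<lambda>(M :: complex ^ 3 ^ 3) j. M $ l $ j)"
  define R where "R = (\<lambda>M. \<Sum>i\<in>UNIV - {l}. \<Sum>j\<in>UNIV. M $ i $ j * mpoly_eval (rw M) (E i j))"
  define R' where "R' = (\<lambda>x M. \<Sum>i\<in>UNIV - {l}. \<Sum>j\<in>UNIV. M $ i $ j * mpoly_eval (rw M) (mpoly_pderiv x (E i j)))"
  \<comment> \<open>Row \<open>l\<close> is recovered triangularly: the derivative in a direction
    \<open>x\<close> other than \<open>l\<close> gives the entry at \<open>x\<close>, and then the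
    value gives the diagonal entry \<open>w\<^sub>l\<close>.\<close>
  define w where "w = (\<lambda>x M. \<sigma> x (rw M) - R' x M)"
  define w\<^sub>l where "w\<^sub>l = (\<lambda>M. r (rw M) - R M - (\<Sum>j\<in>UNIV - {l}. w j M * rw M j))"
  \<comment> \<open>The map rebuilding the matrix \<open>A\<close> from \<open>M\<close>, whose row
    \<open>l\<close> is the point \<open>p\<close> and whose other rows are those of
    \<open>A\<close>.\<close>
  define \<Phi> :: "complex ^ 3 ^ 3 \<Rightarrow> complex ^ 3 ^ 3" where
    "\<Phi> = (\<lambda>M. \<chi> i j. if i = l then if j = l then w\<^sub>l M else w j M else M $ i $ j)"
  define Z where "Z = {M :: complex ^ 3 ^ 3. M $ l $ l = 1 \<and> mpoly_eval (rw M) f\<^sub>1 \<noteq> 0}"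
  have "Z \<subseteq> {M. axis l (axis l 1) \<bullet> M = 1}"
    by (auto simp: Z_def inner_axis')
  moreover have "negligible {M :: complex ^ 3 ^ 3. axis l (axis l 1) \<bullet> M = 1}"
    by (rule negligible_hyperplane) simp
  ultimately have negZ: "negligible Z" by (rule negligible_subset[rotated])
  have diff_ev: "(\<lambda>M. mpoly_eval (rw M) q) differentiable (at M within Z)" for q M
    unfolding rw_def by (rule differentiable_mpoly_eval_row)
  have diff_rw: "(\<lambda>M. rw M j) differentiable (at M within Z)" for j M
    unfolding rw_def by (rule differentiable_entry)
  have "\<Phi> differentiable_on Z"
    unfolding differentiable_on_def
  proof
    fix M assume "M \<in> Z"
    then have f1: "mpoly_eval (rw M) f\<^sub>1 \<noteq> 0" by (simp add: Z_def)
    have dr: "(\<lambda>M. r (rw M)) differentiable (at M within Z)"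
      unfolding r_def using f1 diff_ev by (intro derivative_intros) auto
    have dR: "R differentiable (at M within Z)" "R' x differentiable (at M within Z)" for x
      unfolding R_def R'_def using diff_ev by (intro differentiable_sum ballI differentiable_mult differentiable_entry; simp)+
    have dw: "w x differentiable (at M within Z)" for x
      unfolding w_def \<sigma>_def using f1 diff_ev dr dR
      by (intro differentiable_diff differentiable_divide differentiable_minus differentiable_add differentiable_mult; simp)
    have dwl: "w\<^sub>l differentiable (at M within Z)"
      unfolding w\<^sub>l_def using dr dR dw diff_rw
      by (intro differentiable_diff differentiable_sum ballI differentiable_mult; simp)
    show "\<Phi> differentiable (at M within Z)"
    proof (rule differentiable_vecI, rule differentiable_vecI)
      fix i j
      show "(\<lambda>M. \<Phi> M $ i $ j) differentiable (at M within Z)"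
        using dw dwl differentiable_entry[of i j "at M within Z"]
        by (cases "i = l"; cases "j = l") (simp_all add: \<Phi>_def)
    qed
  qed
  then have neg: "negligible (\<Phi> ` Z)" by (rule negligible_differentiable_image_negligible[OF order_refl negZ])
  show ?thesis
  proof (rule negligible_subset[OF neg], rule subsetI)
    fix A assume "A \<in> ?B"
    then obtain p where p: "p l = 1" "mpoly_eval p f\<^sub>1 \<noteq> 0" "mpoly_eval p (F A) = 0"
      "\<And>x. mpoly_eval p (mpoly_pderiv x (F A)) = 0" by blast
    define M :: "complex ^ 3 ^ 3" where "M = (\<chi> i j. if i = l then p j else A $ i $ j)"
    have rw: "rw M = p" by (auto simp: rw_def M_def)
    let ?g = "matrix_form s A"
    have g: "mpoly_eval p ?g = r p"
    proof -
      have "mpoly_eval p f\<^sub>0 ^ k + mpoly_eval p f\<^sub>1 * mpoly_eval p ?g = 0"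
        using p(3) by (simp add: F_def)
      then have "mpoly_eval p ?g * mpoly_eval p f\<^sub>1 = - (mpoly_eval p f\<^sub>0 ^ k)"
        by (simp only: eq_neg_iff_add_eq_0 mult.commute add.commute)
      then show ?thesis unfolding r_def using p(2) by (simp only: nonzero_eq_divide_eq not_False_eq_True)
    qed
    have pg: "mpoly_eval p (mpoly_pderiv x ?g) = \<sigma> x p" for x
    proof -
      have "mpoly_eval p (mpoly_pderiv x (f\<^sub>0 ^ k)) + (mpoly_eval p (mpoly_pderiv x f\<^sub>1) * r p
          + mpoly_eval p f\<^sub>1 * mpoly_eval p (mpoly_pderiv x ?g)) = 0"
        using p(4)[of x] unfolding F_def mpoly_pderiv_add mpoly_pderiv_mult[of x f\<^sub>1] by (simp only: mpoly_eval_simps g)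
      then have "mpoly_eval p (mpoly_pderiv x ?g) * mpoly_eval p f\<^sub>1 =
          - (mpoly_eval p (mpoly_pderiv x (f\<^sub>0 ^ k)) + r p * mpoly_eval p (mpoly_pderiv x f\<^sub>1))"
        by (simp only: eq_neg_iff_add_eq_0) (simp add: algebra_simps)
      then show ?thesis unfolding \<sigma>_def using p(2) by (simp only: nonzero_eq_divide_eq not_False_eq_True)
    qed
    have evE: "mpoly_eval p (E l j) = p j" for j by (simp add: E_def p(1))
    \<comment> \<open>In a direction other than \<open>l\<close> the factor
      \<open>mvar l ^ s\<close> is constant, and it equals \<open>1\<close> at
      \<open>p\<close>.\<close>
    have pdE: "mpoly_eval p (mpoly_pderiv x (E l j)) = (if j = x then 1 else 0)" if "x \<noteq> l" for x j
      using that by (simp add: E_def mpoly_pderiv_mult mpoly_pderiv_power mpoly_pderiv_mvar p(1))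
    have MA: "M $ i $ j = A $ i $ j" if "i \<noteq> l" for i j using that by (simp add: M_def)
    have g_split: "mpoly_eval p ?g = (\<Sum>j\<in>UNIV. A $ l $ j * p j) + R M"
    proof -
      have "mpoly_eval p ?g = (\<Sum>i\<in>UNIV. \<Sum>j\<in>UNIV. A $ i $ j * mpoly_eval p (E i j))"
        by (simp add: matrix_form_def E_def)
      also have "\<dots> = (\<Sum>j\<in>UNIV. A $ l $ j * mpoly_eval p (E l j)) + (\<Sum>i\<in>UNIV - {l}. \<Sum>j\<in>UNIV. A $ i $ j * mpoly_eval p (E i j))"
        by (rule sum.remove) auto
      finally show ?thesis by (simp add: evE R_def rw MA)
    qed
    have pg_split: "mpoly_eval p (mpoly_pderiv x ?g) = A $ l $ x + R' x M" if x: "x \<noteq> l" for x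
    proof -
      have "mpoly_eval p (mpoly_pderiv x ?g) = (\<Sum>i\<in>UNIV. \<Sum>j\<in>UNIV. A $ i $ j * mpoly_eval p (mpoly_pderiv x (E i j)))"
        by (simp add: matrix_form_def E_def mpoly_pderiv_sum mpoly_pderiv_mult[of x "mpoly_const _"])
      also have "\<dots> = (\<Sum>j\<in>UNIV. A $ l $ j * mpoly_eval p (mpoly_pderiv x (E l j)))
          + (\<Sum>i\<in>UNIV - {l}. \<Sum>j\<in>UNIV. A $ i $ j * mpoly_eval p (mpoly_pderiv x (E i j)))"
        by (rule sum.remove) auto
      also have "(\<Sum>j\<in>UNIV. A $ l $ j * mpoly_eval p (mpoly_pderiv x (E l j))) = A $ l $ x"
        by (simp add: pdE[OF x] if_distrib[of "(*) _"] cong: if_cong)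
      finally show ?thesis by (simp add: R'_def rw MA)
    qed
    have w: "w x M = A $ l $ x" if "x \<noteq> l" for x
      using pg_split[OF that] pg[of x] by (simp add: w_def rw)
    have "(\<Sum>j\<in>UNIV. A $ l $ j * p j) = A $ l $ l * p l + (\<Sum>j\<in>UNIV - {l}. A $ l $ j * p j)"
      by (rule sum.remove) auto
    also have "(\<Sum>j\<in>UNIV - {l}. A $ l $ j * p j) = (\<Sum>j\<in>UNIV - {l}. w j M * rw M j)"
      by (rule sum.cong) (auto simp: w rw)
    finally have wl: "w\<^sub>l M = A $ l $ l"
      using g_split g by (simp add: w\<^sub>l_def rw p(1))
    have "A = \<Phi> M"
      by (simp add: vec_eq_iff \<Phi>_def w wl MA)
    moreover have "M \<in> Z" using p(1,2) by (simp add: Z_def rw) (simp add: M_def)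
    ultimately show "A \<in> \<Phi> ` Z" by blast
  qed
qed

lemma smooth_curve_scale:
  assumes "smooth_curve e F" "z \<noteq> 0"
  shows "smooth_curve e (mpoly_const z * F)"
  using assms forms_const_mult[of F e z] unfolding smooth_curve_iff by (simp add: mpoly_pderiv_mult)

section \<open>Smooth members of the family\<close>

context contact_pair
begin

text \<open>Here \<open>g\<close> is a constant \<open>1 / z\<close>. Scaled by \<open>z\<close>,
  the member is \<open>f\<^sub>1 + z * f\<^sub>0 ^ k\<close>, which for small \<open>z\<close> is
  smooth because \<open>f\<^sub>1\<close> is.\<close>

lemma smooth_member_constant:
  assumes k: "k * d\<^sub>0 = d\<^sub>1"
  shows "\<exists>g\<in>forms 0. smooth_curve (k * d\<^sub>0) (f\<^sub>0 ^ k + f\<^sub>1 * g)"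
proof -
  let ?F = "\<lambda>z. f\<^sub>1 + mpoly_const z * f\<^sub>0 ^ k"
  have sub: "fun_subring {D :: complex \<Rightarrow> complex. isCont D 0}"
    unfolding fun_subring_def by (auto intro!: continuous_intros)
  have "\<exists>D\<in>{D :: complex \<Rightarrow> complex. isCont D 0}. D 0 \<noteq> 0 \<and> (\<forall>z. ?F z \<in> forms d\<^sub>1 \<longrightarrow> D z \<noteq> 0 \<longrightarrow> smooth_curve d\<^sub>1 (?F z))"
  proof (rule smooth_family_open[OF sub C.d_pos, where F = ?F and ?x0.0 = 0])
    fix m :: "3 \<Rightarrow>\<^sub>0 nat" and i :: 3 and m'
    have "Poly_Mapping.lookup (Poly_Mapping.single m 1 * mpoly_pderiv i (?F z)) m' =
        Poly_Mapping.lookup (Poly_Mapping.single m 1 * mpoly_pderiv i f\<^sub>1) m' +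
        z * Poly_Mapping.lookup (Poly_Mapping.single m 1 * mpoly_pderiv i (f\<^sub>0 ^ k)) m'" for z
      by (simp add: mpoly_pderiv_add mpoly_pderiv_mult[of i "mpoly_const z"] distrib_left lookup_add mult.left_commute[of _ "mpoly_const z"])
    then show "(\<lambda>z. Poly_Mapping.lookup (Poly_Mapping.single m 1 * mpoly_pderiv i (?F z)) m') \<in> {D. isCont D 0}"
      by (auto intro!: continuous_intros)
    show "smooth_curve d\<^sub>1 (?F 0)" using C.smooth by simp
  qed
  then obtain D :: "complex \<Rightarrow> complex" where D: "isCont D 0" "D 0 \<noteq> 0" "\<And>z. ?F z \<in> forms d\<^sub>1 \<Longrightarrow> D z \<noteq> 0 \<Longrightarrow> smooth_curve d\<^sub>1 (?F z)"
    by blast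
  have "\<forall>\<^sub>F z in at 0. D z \<noteq> 0" using D(1,2) unfolding isCont_def by (rule tendsto_imp_eventually_ne)
  moreover have "\<forall>\<^sub>F z in at (0 :: complex). z \<noteq> 0" by (rule eventually_neq_at_within)
  ultimately have "\<forall>\<^sub>F z in at 0. D z \<noteq> 0 \<and> z \<noteq> 0" by (rule eventually_conj)
  then obtain z where z: "D z \<noteq> 0" "z \<noteq> 0" using eventually_happens'[OF at_neq_bot] by blast
  have "f\<^sub>0 ^ k \<in> forms d\<^sub>1" using forms_power[OF D.form, of k] k by simp
  then have "smooth_curve d\<^sub>1 (?F z)" by (intro D(3) forms_add C.form forms_const_mult z(1))
  then have "smooth_curve d\<^sub>1 (mpoly_const (1 / z) * ?F z)" by (rule smooth_curve_scale) (use z in simp)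
  also have "mpoly_const (1 / z) * ?F z = mpoly_const (1 / z * z) * f\<^sub>0 ^ k + f\<^sub>1 * mpoly_const (1 / z)"
    by (simp only: mpoly_const_mult) (simp add: algebra_simps)
  also have "\<dots> = f\<^sub>0 ^ k + f\<^sub>1 * mpoly_const (1 / z)" using z(2) by simp
  finally show ?thesis using k forms_mpoly_const by blast
qed

text \<open>Matrices giving a singular point off \<open>f\<^sub>1\<close> are negligible. A point of
  the member on \<open>f\<^sub>1\<close> lies over \<open>S\<close>, where the gradient is that of
  \<open>f\<^sub>1\<close> times the value of \<open>g\<close>; vanishing of \<open>g\<close> at one
  of these finitely many points is negligible too.\<close>

lemma smooth_member_nonconstant:
  assumes k: "d\<^sub>1 < k * d\<^sub>0" and le: "d\<^sub>0 \<le> d\<^sub>1"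
  shows "\<exists>g\<in>forms (k * d\<^sub>0 - d\<^sub>1). smooth_curve (k * d\<^sub>0) (f\<^sub>0 ^ k + f\<^sub>1 * g)"
proof -
  define s where "s = k * d\<^sub>0 - d\<^sub>1 - 1"
  have s: "s + 1 = k * d\<^sub>0 - d\<^sub>1" using k by (simp add: s_def)
  \<comment> \<open>This makes the gradient of \<open>f\<^sub>0 ^ k\<close> vanish on
    \<open>D\<close>, so that at points of \<open>S\<close> only \<open>f\<^sub>1 * g\<close>
    contributes.\<close>
  have k2: "2 \<le> k"
  proof (rule ccontr)
    assume "\<not> 2 \<le> k"
    then have "k * d\<^sub>0 \<le> 1 * d\<^sub>0" by (intro mult_right_mono) simp_all
    with k le show False by simp
  qed
  define F where "F = (\<lambda>A. f\<^sub>0 ^ k + f\<^sub>1 * matrix_form s A)"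
  define B where "B = (\<lambda>l. {A. \<exists>p. p l = 1 \<and> mpoly_eval p f\<^sub>1 \<noteq> 0 \<and> mpoly_eval p (F A) = 0 \<and>
    (\<forall>x. mpoly_eval p (mpoly_pderiv x (F A)) = 0)})"
  define N where "N = (\<lambda>P. {A. mpoly_eval (pt P) (matrix_form s A) = 0})"
  have "negligible (\<Union>(range B \<union> N ` S))"
  proof (rule negligible_Union)
    show "finite (range B \<union> N ` S)" using finite_S by simp
    fix T assume "T \<in> range B \<union> N ` S"
    then show "negligible T"
      using negligible_singular[of _ f\<^sub>1 f\<^sub>0 k s] negligible_hyperplane_forms[OF pt_nonzero]
      unfolding B_def N_def F_def by blast
  qed
  then have "\<Union>(range B \<union> N ` S) \<noteq> UNIV" using non_negligible_UNIV by metis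
  then obtain A where A: "\<And>l. A \<notin> B l" "\<And>P. P \<in> S \<Longrightarrow> A \<notin> N P" by blast
  let ?g = "matrix_form s A"
  have g: "?g \<in> forms (k * d\<^sub>0 - d\<^sub>1)" using matrix_form_forms[of s A] s by simp
  have Ff: "F A \<in> forms (k * d\<^sub>0)"
    unfolding F_def using forms_mult[OF C.form g] k by (intro forms_add forms_power D.form) simp
  have "smooth_curve (k * d\<^sub>0) (F A)"
    unfolding smooth_curve_iff
  proof (intro conjI allI impI Ff)
    fix p assume p: "p \<noteq> (\<lambda>_. 0)" "mpoly_eval p (F A) = 0"
    show "\<exists>i. mpoly_eval p (mpoly_pderiv i (F A)) \<noteq> 0"
    proof (cases "mpoly_eval p f\<^sub>1 = 0")
      case True
      then have f0: "mpoly_eval p f\<^sub>0 = 0" using p(2) k2 by (simp add: F_def)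
      obtain P c where P: "c \<noteq> 0" "p = (\<lambda>i. c * pt P i)" by (rule pt_exists[OF p(1)])
      have "P \<in> S" using True f0 P(1) unfolding S_def P(2) by (simp add: mpoly_eval_scale[OF D.form] mpoly_eval_scale[OF C.form])
      then have gp: "mpoly_eval p ?g \<noteq> 0"
        using A(2)[of P] P(1) unfolding N_def P(2) by (simp add: mpoly_eval_scale[OF g])
      obtain i where i: "mpoly_eval p (mpoly_pderiv i f\<^sub>1) \<noteq> 0"
        using C.smooth p(1) True unfolding smooth_curve_iff by blast
      have "mpoly_eval p (mpoly_pderiv i (F A)) = mpoly_eval p (mpoly_pderiv i f\<^sub>1) * mpoly_eval p ?g"
        using True f0 k2 by (simp add: F_def mpoly_pderiv_add mpoly_pderiv_mult mpoly_pderiv_power power_0_left)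
      with i gp have "mpoly_eval p (mpoly_pderiv i (F A)) \<noteq> 0" by simp
      then show ?thesis by blast
    next
      case False
      obtain l where l: "p l \<noteq> 0" using p(1) by auto
      define q where "q = (\<lambda>i. (1 / p l) * p i)"
      have "q l = 1" using l by (simp add: q_def)
      moreover have "mpoly_eval q f\<^sub>1 \<noteq> 0" "mpoly_eval q (F A) = 0"
        unfolding q_def using False p(2) l by (simp_all only: mpoly_eval_scale[OF C.form] mpoly_eval_scale[OF Ff]) simp_all
      ultimately have "\<exists>i. mpoly_eval q (mpoly_pderiv i (F A)) \<noteq> 0" using A(1)[of l] unfolding B_def by blast
      then show ?thesis unfolding q_def mpoly_eval_scale[OF forms_mpoly_pderiv[OF Ff]] by auto
    qed
  qed
  then show ?thesis using g unfolding F_def by blast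
qed

lemma general_member_smooth:
  assumes k: "d\<^sub>1 \<le> k * d\<^sub>0" and le: "d\<^sub>0 \<le> d\<^sub>1"
    and Q: "\<And>g. g \<in> forms (k * d\<^sub>0 - d\<^sub>1) \<Longrightarrow> smooth_curve (k * d\<^sub>0) (f\<^sub>0 ^ k + f\<^sub>1 * g) \<Longrightarrow> Q g"
  shows "for_general_form (k * d\<^sub>0 - d\<^sub>1) Q"
proof -
  let ?t = "k * d\<^sub>0 - d\<^sub>1" and ?F = "\<lambda>g. f\<^sub>0 ^ k + f\<^sub>1 * g"
  have pos: "0 < k * d\<^sub>0" using k C.d_pos by linarith
  obtain g\<^sub>0 where g0: "g\<^sub>0 \<in> forms ?t" "smooth_curve (k * d\<^sub>0) (?F g\<^sub>0)"
  proof (cases "d\<^sub>1 = k * d\<^sub>0")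
    case True
    then show ?thesis using smooth_member_constant[of k] that by auto
  next
    case False
    then show ?thesis using smooth_member_nonconstant[of k] k le that by auto
  qed
  have Ff: "?F g \<in> forms (k * d\<^sub>0)" if "g \<in> forms ?t" for g
    using forms_mult[OF C.form that] k by (intro forms_add forms_power D.form) simp
  have "\<exists>D\<in>coeff_functions ?t. D g\<^sub>0 \<noteq> 0 \<and> (\<forall>g. ?F g \<in> forms (k * d\<^sub>0) \<longrightarrow> D g \<noteq> 0 \<longrightarrow> smooth_curve (k * d\<^sub>0) (?F g))"
  proof (rule smooth_family_open[OF fun_subring_coeff_functions pos, where F = ?F and ?x0.0 = g\<^sub>0])
    fix m :: "3 \<Rightarrow>\<^sub>0 nat" and i :: 3 and m'
    let ?E = "\<lambda>h. Poly_Mapping.lookup (Poly_Mapping.single m 1 * mpoly_pderiv i h) m'"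
    have add: "?E (h + h') = ?E h + ?E h'" for h h' by (simp add: mpoly_pderiv_add distrib_left lookup_add)
    have const: "?E (mpoly_const z * h) = z * ?E h" for z h
      by (simp add: mpoly_pderiv_mult mult.left_commute[of _ "mpoly_const z"])
    have sum: "?E (sum h J) = (\<Sum>j\<in>J. ?E (h j))" for h :: "(3 \<Rightarrow>\<^sub>0 nat) \<Rightarrow> 3 mpoly" and J
      by (simp only: mpoly_pderiv_sum sum_distrib_left lookup_sum)
    show "(\<lambda>g. ?E (?F g)) \<in> coeff_functions ?t"
    proof (rule coeff_functions_affine)
      fix g assume "g \<in> forms ?t"
      then have "f\<^sub>1 * g = f\<^sub>1 * (\<Sum>n\<in>mdegs ?t. mpoly_const (Poly_Mapping.lookup g n) * Poly_Mapping.single n 1)"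
        by (rule arg_cong[OF form_sum_monomials])
      also have "\<dots> = (\<Sum>n\<in>mdegs ?t. mpoly_const (Poly_Mapping.lookup g n) * (f\<^sub>1 * Poly_Mapping.single n 1))"
        by (simp only: sum_distrib_left mult.left_commute[of f\<^sub>1])
      finally have "f\<^sub>1 * g = (\<Sum>n\<in>mdegs ?t. mpoly_const (Poly_Mapping.lookup g n) * (f\<^sub>1 * Poly_Mapping.single n 1))" .
      then have "?E (f\<^sub>1 * g) = (\<Sum>n\<in>mdegs ?t. Poly_Mapping.lookup g n * ?E (f\<^sub>1 * Poly_Mapping.single n 1))"
        by (simp only: sum const)
      then show "?E (?F g) = ?E (f\<^sub>0 ^ k) + (\<Sum>n\<in>mdegs ?t. Poly_Mapping.lookup g n * ?E (f\<^sub>1 * Poly_Mapping.single n 1))"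
        by (simp only: add)
    qed
  qed (rule g0(2))
  then obtain D where D: "D \<in> coeff_functions ?t" "D g\<^sub>0 \<noteq> 0"
    "\<And>g. ?F g \<in> forms (k * d\<^sub>0) \<Longrightarrow> D g \<noteq> 0 \<Longrightarrow> smooth_curve (k * d\<^sub>0) (?F g)" by blast
  show ?thesis
  proof (rule for_general_formI[OF D(1) g0(1) D(2)])
    fix g assume g: "g \<in> forms ?t" "D g \<noteq> 0"
    show "Q g" by (rule Q[OF g(1) D(3)[OF Ff[OF g(1)] g(2)]])
  qed
qed

section \<open>The new plane curve\<close>

text \<open>A line avoiding the finite set \<open>S\<close> meets the curve \<open>f\<^sub>1\<close>
  by Bezout. Such a point separates the point sets of the two components of the new curve.\<close>

lemma curve_not_in_S: "\<exists>P. mpoly_eval (pt P) f\<^sub>1 = 0 \<and> P \<notin> S"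
proof -
  define lin where "lin = (\<lambda>a. \<Sum>i\<in>UNIV. mpoly_const (a i) * (mvar i :: 3 mpoly))"
  have ev_lin: "mpoly_eval p (lin a) = (\<Sum>i\<in>UNIV. a i * p i)" for p a by (simp add: lin_def)
  have lin0: "lin (pt P) \<noteq> 0" for P
  proof
    assume lin0: "lin (pt P) = 0"
    have "mpoly_pderiv i (lin (pt P)) = mpoly_const (pt P i)" for i
      by (simp add: lin_def mpoly_pderiv_sum mpoly_pderiv_mult mpoly_pderiv_mvar if_distrib[of "(*) _"] cong: if_cong)
    then have "pt P i = 0" for i using lin0 by simp
    with pt_nonzero[of P] show False by auto
  qed
  have "(\<Prod>P\<in>S. lin (pt P)) \<noteq> 0" using lin0 finite_S by simp
  then obtain a where a: "mpoly_eval a (\<Prod>P\<in>S. lin (pt P)) \<noteq> 0" using mpoly_nonzero_value by blast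
  have off: "mpoly_eval (pt P) (lin a) \<noteq> 0" if "P \<in> S" for P
  proof -
    have "mpoly_eval a (lin (pt P)) \<noteq> 0" using a that finite_S by auto
    then show ?thesis by (simp add: ev_lin mult.commute)
  qed
  have l: "lin a \<in> forms 1" unfolding lin_def by (intro forms_sum forms_const_mult forms_mvar)
  obtain P0 where P0: "P0 \<in> S" using S_nonempty by blast
  have nd: "\<not> f\<^sub>1 dvd lin a"
  proof
    assume "f\<^sub>1 dvd lin a"
    then obtain h where "lin a = f\<^sub>1 * h" by blast
    then show False using off[OF P0] P0 by (simp add: S_def)
  qed
  have "C.div_degree (lin a) \<noteq> 0" using C.Bezout[OF l nd] C.d_pos by simp
  then obtain P where P: "curve_ord f\<^sub>1 P (lin a) \<noteq> 0"
    unfolding C.div_degree_def by (metis (mono_tags, lifting) mem_Collect_eq sum.neutral)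
  have on: "mpoly_eval (pt P) f\<^sub>1 = 0" by (rule C.v_on_curve[OF P])
  have "mpoly_eval (pt P) (lin a) = 0" using C.v_eq_0_iff[OF on l nd] P by simp
  then have "P \<notin> S" using off by blast
  with on show ?thesis by blast
qed

lemma mem_curve_points: "P \<in> curve_points F \<longleftrightarrow> mpoly_eval (pt P) F = 0" if "F \<in> forms e"
  using that by (simp add: curve_points_def vanishes_at_iff)

context
  fixes k :: nat and g :: "3 mpoly"
  assumes k: "d\<^sub>1 \<le> k * d\<^sub>0" and n: "n dvd d\<^sub>0" and g: "g \<in> forms (k * d\<^sub>0 - d\<^sub>1)"
    and smooth: "smooth_curve (k * d\<^sub>0) (f\<^sub>0 ^ k + f\<^sub>1 * g)"
begin

abbreviation "B \<equiv> f\<^sub>0 ^ k + f\<^sub>1 * g"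

lemma k_pos: "0 < k"
  using k C.d_pos by (cases k) auto

lemma B_form: "B \<in> forms (k * d\<^sub>0)"
  using smooth by (simp add: smooth_curve_iff)

lemma B_points: "curve_points f\<^sub>1 \<inter> curve_points B = S"
  using k_pos by (auto simp: mem_curve_points[OF C.form] mem_curve_points[OF B_form] S_def)

lemma B_type: "curve_of_type d\<^sub>1 (k * d\<^sub>0) (k * n) f\<^sub>1 B"
  unfolding curve_of_type_def
proof (intro conjI ballI)
  show "1 \<le> d\<^sub>1" using C.d_pos by simp
  show "d\<^sub>1 \<le> k * d\<^sub>0" by (rule k)
  show "k * n dvd k * d\<^sub>0" using n by simp
  show "smooth_curve d\<^sub>1 f\<^sub>1" by (rule C.smooth)
  show "smooth_curve (k * d\<^sub>0) B" by (rule smooth)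
  obtain P where "mpoly_eval (pt P) f\<^sub>1 = 0" "P \<notin> S" using curve_not_in_S by blast
  then show "curve_points f\<^sub>1 \<noteq> curve_points B"
    using B_points mem_curve_points[OF C.form, of P] by blast
  fix P assume "P \<in> curve_points f\<^sub>1 \<inter> curve_points B"
  then have P: "P \<in> S" by (simp only: B_points)
  note pow = C.v_power[OF D.form nd(2), of k]
  have f0k: "f\<^sub>0 ^ k \<in> forms (k * d\<^sub>0)" by (rule forms_power[OF D.form])
  have B: "B = f\<^sub>0 ^ k + g * f\<^sub>1" by (simp add: mult.commute)
  have "\<not> f\<^sub>1 dvd B"
  proof
    assume "f\<^sub>1 dvd B"
    then have "f\<^sub>1 dvd f\<^sub>0 ^ k" using dvd_diff[of f\<^sub>1 B "f\<^sub>1 * g"] by simp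
    with pow show False by blast
  qed
  moreover have "curve_ord f\<^sub>1 P B = k * n"
    using C.v_congr[OF f0k _ B, of P] pow v1[of P] P by simp
  ultimately show "intersection_number P f\<^sub>1 B = enat (k * n)"
    using C.intersection_number_eq_v[OF B_form] by simp
qed

text \<open>The factor \<open>k\<close> cancels in \<open>k * d\<^sub>0 div (k * n)\<close>, so the
  divisor is the same for all \<open>k\<close> and all \<open>g\<close>.\<close>

lemma B_contact_class:
  assumes l: "l \<in> forms 1" "\<not> f\<^sub>1 dvd l"
  shows "(\<lambda>P. contact_divisor f\<^sub>1 B P - int (k * d\<^sub>0 div (k * n)) * cut_divisor f\<^sub>1 l P) = torsion_divisor l"
  using k_pos by (intro ext) (simp add: contact_divisor_def B_points C.cut_divisor_eq[OF l] torsion_divisor_def)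

lemma B_torsion_type:
  assumes ord: "\<And>l. l \<in> forms 1 \<Longrightarrow> \<not> f\<^sub>1 dvd l \<Longrightarrow>
    group.ord (Pic0 f\<^sub>1) (Pic0_class f\<^sub>1 (torsion_divisor l)) = N"
  shows "curve_of_torsion_type d\<^sub>1 (k * d\<^sub>0) (k * n) N f\<^sub>1 B"
proof -
  obtain P where P: "P \<in> S" using S_nonempty by blast
  obtain i where i: "pt P i \<noteq> 0" using pt_nonzero[of P] by auto
  have "for_general_form 1 (\<lambda>l. group.ord (Pic0 f\<^sub>1) (Pic0_class f\<^sub>1
      (\<lambda>P. contact_divisor f\<^sub>1 B P - int (k * d\<^sub>0 div (k * n)) * cut_divisor f\<^sub>1 l P)) = N)"
  \<comment> \<open>Lines missing one point of \<open>S\<close> form the open set: since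
    \<open>f\<^sub>1\<close> vanishes at that point, such a line is not a multiple of it.\<close>
  proof (rule for_general_formI[OF eval_coeff_function[of "pt P"] forms_mvar[of i]])
    show "mpoly_eval (pt P) (mvar i) \<noteq> 0" using i by simp
    fix l assume l: "l \<in> forms 1" "mpoly_eval (pt P) l \<noteq> 0"
    have nd': "\<not> f\<^sub>1 dvd l"
    proof
      assume "f\<^sub>1 dvd l"
      then obtain h where "l = f\<^sub>1 * h" by blast
      then show False using l(2) P by (simp add: S_def)
    qed
    show "group.ord (Pic0 f\<^sub>1) (Pic0_class f\<^sub>1
      (\<lambda>P. contact_divisor f\<^sub>1 B P - int (k * d\<^sub>0 div (k * n)) * cut_divisor f\<^sub>1 l P)) = N"
      unfolding B_contact_class[OF l(1) nd'] by (rule ord[OF l(1) nd'])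
  qed
  with B_type show ?thesis unfolding curve_of_torsion_type_def by blast
qed

end

end

text \<open>If one of the two prime forms divided the other, they would divide each other and have
  the same points.\<close>

lemma contact_pair_of_curve_of_type:
  assumes "curve_of_type d\<^sub>0 d\<^sub>1 n f\<^sub>0 f\<^sub>1"
  shows "contact_pair f\<^sub>0 f\<^sub>1 d\<^sub>0 d\<^sub>1 n"
proof -
  have T: "1 \<le> d\<^sub>0" "d\<^sub>0 \<le> d\<^sub>1" "smooth_curve d\<^sub>0 f\<^sub>0" "smooth_curve d\<^sub>1 f\<^sub>1" "curve_points f\<^sub>0 \<noteq> curve_points f\<^sub>1"
    "\<forall>P \<in> curve_points f\<^sub>0 \<inter> curve_points f\<^sub>1. intersection_number P f\<^sub>0 f\<^sub>1 = enat n"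
    using assms unfolding curve_of_type_def by blast+
  interpret D: smooth_form f\<^sub>0 d\<^sub>0 using T by unfold_locales auto
  interpret C: smooth_form f\<^sub>1 d\<^sub>1 using T by unfold_locales auto
  have pts: "P \<in> curve_points f\<^sub>0 \<longleftrightarrow> mpoly_eval (pt P) f\<^sub>0 = 0" "P \<in> curve_points f\<^sub>1 \<longleftrightarrow> mpoly_eval (pt P) f\<^sub>1 = 0" for P
    by (simp_all add: curve_points_def vanishes_at_iff[OF D.form] vanishes_at_iff[OF C.form])
  have same: False if dvd: "f\<^sub>0 dvd f\<^sub>1" "f\<^sub>1 dvd f\<^sub>0"
  proof -
    obtain a b where "f\<^sub>1 = f\<^sub>0 * a" "f\<^sub>0 = f\<^sub>1 * b" using dvd by (elim dvdE)
    then have "mpoly_eval p f\<^sub>1 = mpoly_eval p f\<^sub>0 * mpoly_eval p a" "mpoly_eval p f\<^sub>0 = mpoly_eval p f\<^sub>1 * mpoly_eval p b" for p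
      using mpoly_eval_simps(6) by metis+
    then have "mpoly_eval p f\<^sub>0 = 0 \<longleftrightarrow> mpoly_eval p f\<^sub>1 = 0" for p by (metis mult_zero_left)
    then have "curve_points f\<^sub>0 = curve_points f\<^sub>1" using pts by blast
    with T(5) show False by blast
  qed
  have nd: "\<not> f\<^sub>0 dvd f\<^sub>1" "\<not> f\<^sub>1 dvd f\<^sub>0"
    using same prime_dvd_prime[OF D.prime C.prime] prime_dvd_prime[OF C.prime D.prime] by blast+
  show ?thesis
  proof (unfold_locales, rule nd(1), rule nd(2))
    fix P assume "mpoly_eval (pt P) f\<^sub>0 = 0" "mpoly_eval (pt P) f\<^sub>1 = 0"
    then have "intersection_number P f\<^sub>0 f\<^sub>1 = enat n" using T(6) pts by blast
    then show "curve_ord f\<^sub>0 P f\<^sub>1 = n" by (simp add: D.intersection_number_eq_v[OF C.form nd(1)])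
  qed
qed

theorem proposition5p5:
  fixes d\<^sub>0 d\<^sub>1 n \<nu> \<mu> k :: nat and f\<^sub>0 f\<^sub>1 g h :: "3 mpoly"
  assumes "curve_of_torsion_type d\<^sub>0 d\<^sub>1 n \<nu> f\<^sub>0 f\<^sub>1"
    and "\<mu> = n div \<nu>"
    and "f\<^sub>0 \<in> forms d\<^sub>0" and "g \<in> forms (d\<^sub>1 - d\<^sub>0)" and "h \<in> forms (d\<^sub>1 div \<mu>)"
    and "f\<^sub>1 = h ^ \<mu> + f\<^sub>0 * g"
    and "k * d\<^sub>0 \<ge> d\<^sub>1"
  shows "for_general_form (k * d\<^sub>0 - d\<^sub>1) (\<lambda>g'.
    smooth_curve (k * d\<^sub>0) (f\<^sub>0 ^ k + f\<^sub>1 * g') \<and>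
    (n dvd d\<^sub>0 \<and> d\<^sub>0 < d\<^sub>1 \<longrightarrow>
      curve_of_torsion_type d\<^sub>1 (k * d\<^sub>0) (k * n) n f\<^sub>1 (f\<^sub>0 ^ k + f\<^sub>1 * g')) \<and>
    (d\<^sub>0 = d\<^sub>1 \<longrightarrow>
      curve_of_torsion_type d\<^sub>1 (k * d\<^sub>0) (k * n) \<nu> f\<^sub>1 (f\<^sub>0 ^ k + f\<^sub>1 * g')))"
proof -
  have type: "curve_of_type d\<^sub>0 d\<^sub>1 n f\<^sub>0 f\<^sub>1" and tors: "for_general_form 1 (\<lambda>l.
      group.ord (Pic0 f\<^sub>0) (Pic0_class f\<^sub>0
        (\<lambda>P. contact_divisor f\<^sub>0 f\<^sub>1 P - int (d\<^sub>1 div n) * cut_divisor f\<^sub>0 l P)) = \<nu>)"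
    using assms(1) unfolding curve_of_torsion_type_def by blast+
  have le: "d\<^sub>0 \<le> d\<^sub>1" and nd1: "n dvd d\<^sub>1" using type unfolding curve_of_type_def by blast+
  interpret contact_pair f\<^sub>0 f\<^sub>1 d\<^sub>0 d\<^sub>1 n by (rule contact_pair_of_curve_of_type[OF type])
  interpret s: contact_pair f\<^sub>1 f\<^sub>0 d\<^sub>1 d\<^sub>0 n by (rule swap)
  have ord_\<nu>: "group.ord (Pic0 f\<^sub>1) (Pic0_class f\<^sub>1 (torsion_divisor l)) = \<nu>"
    if eq: "d\<^sub>0 = d\<^sub>1" and l: "l \<in> forms 1" "\<not> f\<^sub>1 dvd l" for l
  proof -
    \<comment> \<open>On \<open>D\<close> the order is given only for a general line. The open set
      contains a line missing a point of \<open>S\<close>, which is therefore not a multiple of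
      \<open>f\<^sub>0\<close>.\<close>
    obtain P where P: "P \<in> S" using S_nonempty by blast
    obtain l' where l': "l' \<in> forms 1" "mpoly_eval (pt P) l' \<noteq> 0" and ord: "group.ord (Pic0 f\<^sub>0) (Pic0_class f\<^sub>0
        (\<lambda>P. contact_divisor f\<^sub>0 f\<^sub>1 P - int (d\<^sub>1 div n) * cut_divisor f\<^sub>0 l' P)) = \<nu>"
      using for_general_form_meets[OF tors, of P] by blast
    have nd': "\<not> f\<^sub>0 dvd l'"
    proof
      assume "f\<^sub>0 dvd l'"
      then obtain h where "l' = f\<^sub>0 * h" by blast
      then show False using l'(2) P by (simp add: S_def)
    qed
    have "(\<lambda>P. contact_divisor f\<^sub>0 f\<^sub>1 P - int (d\<^sub>1 div n) * cut_divisor f\<^sub>0 l' P) = s.torsion_divisor l'"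
      by (rule ext) (simp add: s.contact_divisor_eq D.cut_divisor_eq[OF l'(1) nd'] s.torsion_divisor_def)
    with ord have "group.ord (Pic0 f\<^sub>0) (Pic0_class f\<^sub>0 (s.torsion_divisor l')) = \<nu>" by simp
    moreover have "n dvd d\<^sub>0" using nd1 eq by simp
    \<comment> \<open>Each order divides the other, by the same argument with the curves
      exchanged.\<close>
    ultimately show ?thesis
      using order_dvd_swap[OF l l'(1) nd' _ eq] s.order_dvd_swap[OF l'(1) nd' l nd1 eq[symmetric]] by (metis dvd_antisym)
  qed
  show ?thesis
  proof (rule general_member_smooth[OF assms(7) le], intro conjI impI)
    fix g' assume g': "g' \<in> forms (k * d\<^sub>0 - d\<^sub>1)" and smooth: "smooth_curve (k * d\<^sub>0) (f\<^sub>0 ^ k + f\<^sub>1 * g')"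
    show "smooth_curve (k * d\<^sub>0) (f\<^sub>0 ^ k + f\<^sub>1 * g')" by (rule smooth)
    show "curve_of_torsion_type d\<^sub>1 (k * d\<^sub>0) (k * n) n f\<^sub>1 (f\<^sub>0 ^ k + f\<^sub>1 * g')" if "n dvd d\<^sub>0 \<and> d\<^sub>0 < d\<^sub>1"
      using that by (intro B_torsion_type[OF assms(7) _ g' smooth] order_eq_n) auto
    show "curve_of_torsion_type d\<^sub>1 (k * d\<^sub>0) (k * n) \<nu> f\<^sub>1 (f\<^sub>0 ^ k + f\<^sub>1 * g')" if "d\<^sub>0 = d\<^sub>1"
      using that nd1 by (intro B_torsion_type[OF assms(7) _ g' smooth] ord_\<nu>) auto
  qed
qed

end
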